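(* For a domain $A$, the following assertions are equivalent. (a) $A$ is a ZPUI-domain. (b) $A$ is an h-local strongly discrete Prüfer domain. (c) $A$ is an h-local ISP-domain. (d) $A$ is a generalized Dedekind ISP-domain. (e) $A$ is an ISP-domain such that $\mathrm{Min}(I)$ is finite for each ideal $I$ of $A$.
   Context: All rings are commutative and unitary; "ideal" of a domain means integral ideal. "Local" (resp. "semilocal") means having a unique maximal ideal (resp. only finitely many maximal ideals), with no Noetherian hypothesis. $\mathrm{Min}(I)$ denotes the set of minimal prime ideals over $I$. A domain $A$ is an ISP-domain (invertible semiprime domain) if every proper nonzero ideal $I$ of $A$ can be written as $I=JQ_1\cdots Q_n$ where $n\geq 1$, $J$ is an invertible ideal of $A$ and each $Q_i$ is a proper radical ideal of $A$. A domain $A$ is a ZPUI-domain if every proper nonzero ideal of $A$ can be factored as a product of an invertible ideal times a nonempty (finite) product of pairwise comaximal prime ideals. A domain $A$ is h-local if $A/I$ is local for each nonzero prime ideal $I$ of $A$ and $A/I$ is semilocal for each nonzero ideal $I$ of $A$. A domain is a Prüfer domain if all its nonzero finitely generated ideals are invertible. A Prüfer domain is strongly discrete if it has no idempotent prime ideal except zero. A generalized Dedekind domain is a strongly discrete Prüfer domain in which every nonzero prime ideal is the radical of a finitely generated ideal. *)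

theory Defs
  imports "HOL-Algebra.QuotRing" "HOL-Algebra.Ideal_Product"
begin

text \<open>
  \<open>frac_class R a b\<close> is the class of all pairs \<open>(c, d)\<close> with \<open>d \<noteq> 0\<close> that represent the fraction
  \<open>a / b\<close>.  Sums and products of classes are unions over all representatives, so that no
  representative has to be chosen.  The lemmas below show that, for a domain, the operations
  are the usual ones, that the result is a field, and that the domain embeds into it.
\<close>

definition frac_class :: "('a, 'm) ring_scheme \<Rightarrow> 'a \<Rightarrow> 'a \<Rightarrow> ('a \<times> 'a) set" where
  "frac_class R a b = {(c, d). c \<in> carrier R \<and> d \<in> carrier R - {\<zero>\<^bsub>R\<^esub>} \<and> a \<otimes>\<^bsub>R\<^esub> d = c \<otimes>\<^bsub>R\<^esub> b}"

definition fraction_field :: "('a, 'm) ring_scheme \<Rightarrow> ('a \<times> 'a) set ring" where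
  "fraction_field R =
    \<lparr>carrier = {frac_class R a b | a b. a \<in> carrier R \<and> b \<in> carrier R - {\<zero>\<^bsub>R\<^esub>}},
     monoid.mult = (\<lambda>x y. \<Union>(a, b)\<in>x. \<Union>(c, d)\<in>y. frac_class R (a \<otimes>\<^bsub>R\<^esub> c) (b \<otimes>\<^bsub>R\<^esub> d)),
     one = frac_class R \<one>\<^bsub>R\<^esub> \<one>\<^bsub>R\<^esub>,
     zero = frac_class R \<zero>\<^bsub>R\<^esub> \<one>\<^bsub>R\<^esub>,
     add = (\<lambda>x y. \<Union>(a, b)\<in>x. \<Union>(c, d)\<in>y.
              frac_class R ((a \<otimes>\<^bsub>R\<^esub> d) \<oplus>\<^bsub>R\<^esub> (c \<otimes>\<^bsub>R\<^esub> b)) (b \<otimes>\<^bsub>R\<^esub> d))\<rparr>"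

definition fraction_embed :: "('a, 'm) ring_scheme \<Rightarrow> 'a \<Rightarrow> ('a \<times> 'a) set" where
  "fraction_embed R a = frac_class R a \<one>\<^bsub>R\<^esub>"

context domain
begin

lemma frac_self:
  assumes "a \<in> carrier R" "b \<in> carrier R - {\<zero>}"
  shows "(a, b) \<in> frac_class R a b"
  using assms by (simp add: frac_class_def)

lemma frac_eq_iff:
  assumes a: "a \<in> carrier R" and b: "b \<in> carrier R - {\<zero>}"
    and c: "c \<in> carrier R" and d: "d \<in> carrier R - {\<zero>}"
  shows "frac_class R a b = frac_class R c d \<longleftrightarrow> a \<otimes> d = c \<otimes> b"
proof
  assume "frac_class R a b = frac_class R c d"
  then have "(c, d) \<in> frac_class R a b"
    using frac_self[OF c d] by simp
  then show "a \<otimes> d = c \<otimes> b"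
    by (simp add: frac_class_def)
next
  have sub: "frac_class R a b \<subseteq> frac_class R c d"
    if "a \<in> carrier R" "b \<in> carrier R - {\<zero>}" "c \<in> carrier R" "d \<in> carrier R - {\<zero>}"
      and eq: "a \<otimes> d = c \<otimes> b" for a b c d
  proof
    fix p assume "p \<in> frac_class R a b"
    then obtain x y where p: "p = (x, y)" and x: "x \<in> carrier R" and y: "y \<in> carrier R - {\<zero>}"
      and xy: "a \<otimes> y = x \<otimes> b"
      by (auto simp: frac_class_def)
    have "b \<otimes> (c \<otimes> y) = (c \<otimes> b) \<otimes> y"
      using that y by (simp add: m_ac)
    also have "\<dots> = (a \<otimes> y) \<otimes> d"
      using that y by (simp add: eq[symmetric] m_ac)
    also have "\<dots> = b \<otimes> (x \<otimes> d)"
      using that x y by (simp add: xy m_ac)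
    finally have "c \<otimes> y = x \<otimes> d"
      using m_lcancel[of b "c \<otimes> y" "x \<otimes> d"] that x y by auto
    then show "p \<in> frac_class R c d"
      using p x y by (simp add: frac_class_def)
  qed
  assume eq: "a \<otimes> d = c \<otimes> b"
  show "frac_class R a b = frac_class R c d"
    using sub[OF a b c d eq] sub[OF c d a b eq[symmetric]] by blast
qed

lemma frac_memD:
  assumes a: "a \<in> carrier R" and b: "b \<in> carrier R - {\<zero>}" and "(x, y) \<in> frac_class R a b"
  shows "x \<in> carrier R" "y \<in> carrier R - {\<zero>}" "a \<otimes> y = x \<otimes> b"
  using assms(3) by (auto simp: frac_class_def)

lemma frac_mult:
  assumes a: "a \<in> carrier R" and b: "b \<in> carrier R - {\<zero>}"
    and c: "c \<in> carrier R" and d: "d \<in> carrier R - {\<zero>}"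
  shows "frac_class R a b \<otimes>\<^bsub>fraction_field R\<^esub> frac_class R c d = frac_class R (a \<otimes> c) (b \<otimes> d)"
proof -
  have *: "frac_class R (x \<otimes> z) (y \<otimes> w) = frac_class R (a \<otimes> c) (b \<otimes> d)"
    if "(x, y) \<in> frac_class R a b" "(z, w) \<in> frac_class R c d" for x y z w
  proof -
    note xy = frac_memD[OF a b that(1)]
    note zw = frac_memD[OF c d that(2)]
    have "(x \<otimes> z) \<otimes> (b \<otimes> d) = (x \<otimes> b) \<otimes> (z \<otimes> d)"
      using xy(1,2) zw(1,2) a b c d by (simp add: m_ac)
    also have "\<dots> = (a \<otimes> c) \<otimes> (y \<otimes> w)"
      using xy(1,2) zw(1,2) a b c d by (simp add: xy(3)[symmetric] zw(3)[symmetric] m_ac)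
    finally show ?thesis
      using xy(1,2) zw(1,2) a b c d by (subst frac_eq_iff) (auto simp: integral_iff)
  qed
  have "(\<Union>(x, y)\<in>frac_class R a b. \<Union>(z, w)\<in>frac_class R c d. frac_class R (x \<otimes> z) (y \<otimes> w))
      = frac_class R (a \<otimes> c) (b \<otimes> d)"
    using * frac_self[OF a b] frac_self[OF c d] by fast
  then show ?thesis
    by (simp add: fraction_field_def)
qed

lemma frac_add:
  assumes a: "a \<in> carrier R" and b: "b \<in> carrier R - {\<zero>}"
    and c: "c \<in> carrier R" and d: "d \<in> carrier R - {\<zero>}"
  shows "frac_class R a b \<oplus>\<^bsub>fraction_field R\<^esub> frac_class R c d = frac_class R (a \<otimes> d \<oplus> c \<otimes> b) (b \<otimes> d)"
proof -
  have *: "frac_class R (x \<otimes> w \<oplus> z \<otimes> y) (y \<otimes> w) = frac_class R (a \<otimes> d \<oplus> c \<otimes> b) (b \<otimes> d)"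
    if "(x, y) \<in> frac_class R a b" "(z, w) \<in> frac_class R c d" for x y z w
  proof -
    note xy = frac_memD[OF a b that(1)]
    note zw = frac_memD[OF c d that(2)]
    have "(x \<otimes> w \<oplus> z \<otimes> y) \<otimes> (b \<otimes> d) = (x \<otimes> b) \<otimes> (w \<otimes> d) \<oplus> (z \<otimes> d) \<otimes> (y \<otimes> b)"
      using xy(1,2) zw(1,2) a b c d by (simp add: l_distr r_distr m_ac)
    also have "\<dots> = (a \<otimes> d \<oplus> c \<otimes> b) \<otimes> (y \<otimes> w)"
      using xy(1,2) zw(1,2) a b c d
      by (simp add: xy(3)[symmetric] zw(3)[symmetric] l_distr r_distr m_ac)
    finally show ?thesis
      using xy(1,2) zw(1,2) a b c d by (subst frac_eq_iff) (auto simp: integral_iff)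
  qed
  have "(\<Union>(x, y)\<in>frac_class R a b. \<Union>(z, w)\<in>frac_class R c d. frac_class R (x \<otimes> w \<oplus> z \<otimes> y) (y \<otimes> w))
      = frac_class R (a \<otimes> d \<oplus> c \<otimes> b) (b \<otimes> d)"
    using * frac_self[OF a b] frac_self[OF c d] by fast
  then show ?thesis
    by (simp add: fraction_field_def)
qed

lemma frac_in_fraction_field [intro]:
  "\<lbrakk>a \<in> carrier R; b \<in> carrier R - {\<zero>}\<rbrakk> \<Longrightarrow> frac_class R a b \<in> carrier (fraction_field R)"
  by (auto simp: fraction_field_def)

lemma fraction_fieldE:
  assumes "x \<in> carrier (fraction_field R)"
  obtains a b where "a \<in> carrier R" "b \<in> carrier R - {\<zero>}" "x = frac_class R a b"
  using assms by (auto simp: fraction_field_def)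

lemma fraction_field_one: "\<one>\<^bsub>fraction_field R\<^esub> = frac_class R \<one> \<one>"
  and fraction_field_zero: "\<zero>\<^bsub>fraction_field R\<^esub> = frac_class R \<zero> \<one>"
  by (simp_all add: fraction_field_def)

lemma fraction_field_is_cring: "cring (fraction_field R)"
proof (rule cringI)
  let ?K = "fraction_field R"
  show "abelian_group ?K"
  proof (rule abelian_groupI)
    fix x y assume "x \<in> carrier ?K" "y \<in> carrier ?K"
    then show "x \<oplus>\<^bsub>?K\<^esub> y \<in> carrier ?K"
      by (elim fraction_fieldE) (simp add: frac_add frac_in_fraction_field integral_iff)
  next
    show "\<zero>\<^bsub>?K\<^esub> \<in> carrier ?K"
      by (simp add: fraction_field_zero frac_in_fraction_field)
  next
    fix x y z assume "x \<in> carrier ?K" "y \<in> carrier ?K" "z \<in> carrier ?K"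
    then show "x \<oplus>\<^bsub>?K\<^esub> y \<oplus>\<^bsub>?K\<^esub> z = x \<oplus>\<^bsub>?K\<^esub> (y \<oplus>\<^bsub>?K\<^esub> z)"
      by (elim fraction_fieldE)
        (simp add: frac_add integral_iff l_distr r_distr a_ac m_ac)
  next
    fix x y assume "x \<in> carrier ?K" "y \<in> carrier ?K"
    then show "x \<oplus>\<^bsub>?K\<^esub> y = y \<oplus>\<^bsub>?K\<^esub> x"
      by (elim fraction_fieldE) (simp add: frac_add a_ac m_ac)
  next
    fix x assume "x \<in> carrier ?K"
    then show "\<zero>\<^bsub>?K\<^esub> \<oplus>\<^bsub>?K\<^esub> x = x"
      by (elim fraction_fieldE) (simp add: fraction_field_zero frac_add)
  next
    fix x assume "x \<in> carrier ?K"
    then obtain a b where ab: "a \<in> carrier R" "b \<in> carrier R - {\<zero>}" and x: "x = frac_class R a b"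
      by (elim fraction_fieldE)
    have "frac_class R (\<ominus> a) b \<oplus>\<^bsub>?K\<^esub> x = \<zero>\<^bsub>?K\<^esub>"
      using ab by (simp add: x fraction_field_zero frac_add frac_eq_iff integral_iff l_minus l_neg)
    then show "\<exists>y\<in>carrier ?K. y \<oplus>\<^bsub>?K\<^esub> x = \<zero>\<^bsub>?K\<^esub>"
      using ab by (intro bexI[of _ "frac_class R (\<ominus> a) b"] frac_in_fraction_field) simp_all
  qed
  show "comm_monoid ?K"
  proof (rule comm_monoidI)
    fix x y assume "x \<in> carrier ?K" "y \<in> carrier ?K"
    then show "x \<otimes>\<^bsub>?K\<^esub> y \<in> carrier ?K"
      by (elim fraction_fieldE) (simp add: frac_mult frac_in_fraction_field integral_iff)
  next
    show "\<one>\<^bsub>?K\<^esub> \<in> carrier ?K"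
      by (simp add: fraction_field_one frac_in_fraction_field)
  next
    fix x y z assume "x \<in> carrier ?K" "y \<in> carrier ?K" "z \<in> carrier ?K"
    then show "x \<otimes>\<^bsub>?K\<^esub> y \<otimes>\<^bsub>?K\<^esub> z = x \<otimes>\<^bsub>?K\<^esub> (y \<otimes>\<^bsub>?K\<^esub> z)"
      by (elim fraction_fieldE) (simp add: frac_mult integral_iff m_ac)
  next
    fix x assume "x \<in> carrier ?K"
    then show "\<one>\<^bsub>?K\<^esub> \<otimes>\<^bsub>?K\<^esub> x = x"
      by (elim fraction_fieldE) (simp add: fraction_field_one frac_mult)
  next
    fix x y assume "x \<in> carrier ?K" "y \<in> carrier ?K"
    then show "x \<otimes>\<^bsub>?K\<^esub> y = y \<otimes>\<^bsub>?K\<^esub> x"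
      by (elim fraction_fieldE) (simp add: frac_mult m_ac)
  qed
  fix x y z assume "x \<in> carrier ?K" "y \<in> carrier ?K" "z \<in> carrier ?K"
  then show "(x \<oplus>\<^bsub>?K\<^esub> y) \<otimes>\<^bsub>?K\<^esub> z = x \<otimes>\<^bsub>?K\<^esub> z \<oplus>\<^bsub>?K\<^esub> y \<otimes>\<^bsub>?K\<^esub> z"
    by (elim fraction_fieldE)
      (simp add: frac_add frac_mult frac_eq_iff integral_iff l_distr r_distr m_ac)
qed

lemma fraction_field_is_field: "field (fraction_field R)"
proof -
  let ?K = "fraction_field R"
  interpret K: cring ?K
    by (rule fraction_field_is_cring)
  show ?thesis
  proof (rule K.cring_fieldI2)
    show "\<zero>\<^bsub>?K\<^esub> \<noteq> \<one>\<^bsub>?K\<^esub>"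
      by (simp add: fraction_field_zero fraction_field_one frac_eq_iff)
  next
    fix x assume "x \<in> carrier ?K" and nz: "x \<noteq> \<zero>\<^bsub>?K\<^esub>"
    then obtain a b where ab: "a \<in> carrier R" "b \<in> carrier R - {\<zero>}" and x: "x = frac_class R a b"
      by (elim fraction_fieldE)
    have a: "a \<in> carrier R - {\<zero>}"
      using nz ab by (auto simp: x fraction_field_zero frac_eq_iff)
    have "x \<otimes>\<^bsub>?K\<^esub> frac_class R b a = \<one>\<^bsub>?K\<^esub>"
      using a ab by (simp add: x fraction_field_one frac_mult frac_eq_iff integral_iff m_ac)
    then show "\<exists>y\<in>carrier ?K. x \<otimes>\<^bsub>?K\<^esub> y = \<one>\<^bsub>?K\<^esub>"
      using a ab by (intro bexI[of _ "frac_class R b a"] frac_in_fraction_field) simp_all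
  qed
qed

lemma fraction_embed_hom: "fraction_embed R \<in> ring_hom R (fraction_field R)"
  by (rule ring_hom_memI)
    (simp_all add: fraction_embed_def fraction_field_one frac_add frac_mult frac_in_fraction_field)

lemma fraction_embed_inj: "inj_on (fraction_embed R) (carrier R)"
  by (rule inj_onI) (simp add: fraction_embed_def frac_eq_iff)

end

definition fractional_ideal :: "('a, 'm) ring_scheme \<Rightarrow> ('a \<times> 'a) set set \<Rightarrow> bool" where
  "fractional_ideal R F \<longleftrightarrow>
     subgroup F (add_monoid (fraction_field R)) \<and>
     (\<forall>a\<in>carrier R. \<forall>x\<in>F. fraction_embed R a \<otimes>\<^bsub>fraction_field R\<^esub> x \<in> F) \<and>
     (\<exists>d\<in>carrier R - {\<zero>\<^bsub>R\<^esub>}. \<forall>x\<in>F.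
        fraction_embed R d \<otimes>\<^bsub>fraction_field R\<^esub> x \<in> fraction_embed R ` carrier R)"

text \<open>
  The product below is taken in the fraction field; the inductive set \<^const>\<open>ideal_prod\<close>
  consists of the finite sums of products for arbitrary subsets of a ring, so it is also the
  product of two submodules.
\<close>

definition invertible_ideal :: "('a, 'm) ring_scheme \<Rightarrow> 'a set \<Rightarrow> bool" where
  "invertible_ideal R I \<longleftrightarrow> ideal I R \<and>
     (\<exists>F. fractional_ideal R F \<and>
          ideal_prod (fraction_field R) (fraction_embed R ` I) F = fraction_embed R ` carrier R)"

definition ideal_radical :: "('a, 'm) ring_scheme \<Rightarrow> 'a set \<Rightarrow> 'a set" where
  "ideal_radical R I = {a \<in> carrier R. \<exists>n::nat. n > 0 \<and> a [^]\<^bsub>R\<^esub> n \<in> I}"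

definition radical_ideal :: "('a, 'm) ring_scheme \<Rightarrow> 'a set \<Rightarrow> bool" where
  "radical_ideal R I \<longleftrightarrow> ideal I R \<and> ideal_radical R I = I"

definition fg_ideal :: "('a, 'm) ring_scheme \<Rightarrow> 'a set \<Rightarrow> bool" where
  "fg_ideal R I \<longleftrightarrow> (\<exists>S. finite S \<and> S \<subseteq> carrier R \<and> I = Idl\<^bsub>R\<^esub> S)"

definition minimal_primes :: "('a, 'm) ring_scheme \<Rightarrow> 'a set \<Rightarrow> 'a set set" where
  "minimal_primes R I =
     {P. primeideal P R \<and> I \<subseteq> P \<and> (\<forall>Q. primeideal Q R \<and> I \<subseteq> Q \<and> Q \<subseteq> P \<longrightarrow> Q = P)}"

definition comaximal :: "('a, 'm) ring_scheme \<Rightarrow> 'a set \<Rightarrow> 'a set \<Rightarrow> bool" where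
  "comaximal R I J \<longleftrightarrow> I <+>\<^bsub>R\<^esub> J = carrier R"

definition ideal_list_prod :: "('a, 'm) ring_scheme \<Rightarrow> 'a set list \<Rightarrow> 'a set" where
  "ideal_list_prod R Is = foldr (ideal_prod R) Is (carrier R)"

definition local_cring :: "('a, 'm) ring_scheme \<Rightarrow> bool" where
  "local_cring R \<longleftrightarrow> cring R \<and> (\<exists>!M. maximalideal M R)"

definition semilocal_cring :: "('a, 'm) ring_scheme \<Rightarrow> bool" where
  "semilocal_cring R \<longleftrightarrow> cring R \<and> finite {M. maximalideal M R}"

locale ISP_domain = domain +
  assumes ISP: "\<lbrakk>ideal I R; I \<noteq> {\<zero>}; I \<noteq> carrier R\<rbrakk> \<Longrightarrow>
    \<exists>J Qs. invertible_ideal R J \<and> Qs \<noteq> [] \<and>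
      (\<forall>Q\<in>set Qs. radical_ideal R Q \<and> Q \<noteq> carrier R) \<and>
      I = J \<cdot> ideal_list_prod R Qs"

locale ZPUI_domain = domain +
  assumes ZPUI: "\<lbrakk>ideal I R; I \<noteq> {\<zero>}; I \<noteq> carrier R\<rbrakk> \<Longrightarrow>
    \<exists>J Ps. invertible_ideal R J \<and> Ps \<noteq> [] \<and>
      (\<forall>P\<in>set Ps. primeideal P R) \<and>
      (\<forall>i<length Ps. \<forall>j<length Ps. i \<noteq> j \<longrightarrow> comaximal R (Ps ! i) (Ps ! j)) \<and>
      I = J \<cdot> ideal_list_prod R Ps"

locale h_local_domain = domain +
  assumes quot_prime_local: "\<lbrakk>primeideal P R; P \<noteq> {\<zero>}\<rbrakk> \<Longrightarrow> local_cring (R Quot P)"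
    and quot_semilocal: "\<lbrakk>ideal I R; I \<noteq> {\<zero>}\<rbrakk> \<Longrightarrow> semilocal_cring (R Quot I)"

locale pruefer_domain = domain +
  assumes fg_invertible: "\<lbrakk>fg_ideal R I; I \<noteq> {\<zero>}\<rbrakk> \<Longrightarrow> invertible_ideal R I"

locale strongly_discrete_pruefer_domain = pruefer_domain +
  assumes idempotent_prime: "\<lbrakk>primeideal P R; P \<cdot> P = P\<rbrakk> \<Longrightarrow> P = {\<zero>}"

locale generalized_dedekind_domain = strongly_discrete_pruefer_domain +
  assumes prime_radical_fg:
    "\<lbrakk>primeideal P R; P \<noteq> {\<zero>}\<rbrakk> \<Longrightarrow> \<exists>I. fg_ideal R I \<and> P = ideal_radical R I"

end

theory Submission
  imports Defs
begin

text \<open>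
  No ring of fractions is formed: instead of passing from \<open>A\<close> to the localization at a prime
  \<open>P\<close>, one works with the saturation \<open>sat P I\<close>, the contraction to \<open>A\<close> of the ideal generated
  by \<open>I\<close> in the localization.

  Let \<open>A\<close> be an ISP-domain. Every \<open>P\<close>-saturated nonzero ideal below \<open>P\<close> is an invertible ideal
  times a nonempty product of radical \<open>P\<close>-saturated ideals below \<open>P\<close>. If \<open>\<pi> \<in> P\<close> is not locally
  in \<open>P\<^sup>2\<close>, then \<open>(p\<^sup>2, \<pi>)\<close> is locally radical for every \<open>p \<in> P\<close>, which forces \<open>p \<in> (\<pi>)\<close>; so \<open>P\<close>
  is locally principal. Primes minimal over \<open>N + (x)\<close>, with \<open>N\<close> prime and \<open>x \<notin> N\<close>, have such a \<open>\<pi>\<close>;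
  hence a proper radical ideal that is locally principal and nonzero equals \<open>P\<close> locally, and since
  every nonzero \<open>x \<in> P\<close> has a factorization, every nonzero prime is locally principal. It follows that
  primes below \<open>P\<close> form a chain, that they are divisible by the elements of \<open>P\<close> outside them, and
  (by Nakayama's argument for two generators) that \<open>A\<close> is locally a valuation domain.

  A nonzero prime \<open>P\<close> below two maximal ideals \<open>M1\<close>, \<open>M2\<close> is excluded by an ideal that is \<open>P\<close> at \<open>M1\<close>
  and principal at \<open>M2\<close>. Thus being h-local reduces to a finiteness property, which follows from
  finiteness of \<open>Min(xA)\<close>, and in a ZPUI-domain from factoring the ideals that are \<open>(x\<^sup>2)\<close> at one
  maximal ideal and trivial at all others. In the other direction, an h-local strongly discrete
  Pruefer domain factors each ideal as the finite product of its saturations at maximal ideals, each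
  of the form \<open>J \<cdot> P\<close>.
\<close>

text \<open>Saturations are ideals of \<open>A\<close> and behave worse than localized ideals: a
  product of saturated ideals need not be saturated, and the saturation of an invertible ideal need
  not be invertible. Hence local equalities are kept as inclusions into a \<open>sat\<close>, and in
  a factorization the radical factors are saturated while the invertible factor stays as it is.
  Units of the local ring become elements outside \<open>P\<close>.

  Nothing is Noetherian and the ideals concerned need not be finitely generated, so Nakayama's lemma
  does not apply as such. It is replaced by cancellations that involve very few generators:
  \<open>x\<close> modulo the prime \<open>N\<close> for a prime minimal over
  \<open>N + (x)\<close>, or two elements of which one turns out to divide the other.

  In the step with \<open>M1\<close> and \<open>M2\<close> the two local shapes exclude each other.
  A factor of a principal ideal is principal, and a radical one then equals \<open>M2\<close> at
  \<open>M2\<close>, which is too large to lie in \<open>P\<close>; whereas \<open>P\<close>, being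
  equal to \<open>s P\<close> for \<open>s\<close> in \<open>M1\<close> outside \<open>P\<close>, is
  not principal at \<open>M1\<close>.\<close>

no_notation Sum_Type.Plus (infixr \<open><+>\<close> 65)

section \<open>Ideals and prime ideals\<close>

context cring
begin

lemma ideal_zero_mem: "ideal I R \<Longrightarrow> \<zero> \<in> I"
  by (simp add: additive_subgroup.zero_closed ideal.axioms(1))

lemma ideal_add_mem: "\<lbrakk>ideal I R; x \<in> I; y \<in> I\<rbrakk> \<Longrightarrow> x \<oplus> y \<in> I"
  by (simp add: additive_subgroup.a_closed ideal.axioms(1))

lemma ideal_uminus_mem: "\<lbrakk>ideal I R; x \<in> I\<rbrakk> \<Longrightarrow> \<ominus> x \<in> I"
  by (simp add: additive_subgroup.a_inv_closed ideal.axioms(1))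

lemma ideal_subset_carrier: "ideal I R \<Longrightarrow> I \<subseteq> carrier R"
  by (meson ideal.Icarr subsetI)

lemma cring_idealI:
  assumes "I \<subseteq> carrier R" "\<zero> \<in> I" "\<And>x y. \<lbrakk>x \<in> I; y \<in> I\<rbrakk> \<Longrightarrow> x \<oplus> y \<in> I"
    and mult: "\<And>r x. \<lbrakk>r \<in> carrier R; x \<in> I\<rbrakk> \<Longrightarrow> r \<otimes> x \<in> I"
  shows "ideal I R"
proof (rule idealI)
  show "ring R" by (rule ring_axioms)
  show "subgroup I (add_monoid R)"
  proof (rule add.subgroupI)
    show "I \<subseteq> carrier R" "I \<noteq> {}" using assms by auto
    show "\<ominus> a \<in> I" if "a \<in> I" for a
    proof -
      have "\<ominus> a = (\<ominus> \<one>) \<otimes> a" using that assms(1) by (auto simp: l_minus)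
      then show ?thesis using mult[of "\<ominus> \<one>" a] that by simp
    qed
    show "a \<oplus> b \<in> I" if "a \<in> I" "b \<in> I" for a b using that assms by auto
  qed
  show "x \<otimes> a \<in> I" if "a \<in> I" "x \<in> carrier R" for a x using that mult by auto
  then show "a \<otimes> x \<in> I" if "a \<in> I" "x \<in> carrier R" for a x
    using that m_comm[of a x] assms(1) by auto
qed

lemma ideal_eq_carrier_iff: "ideal I R \<Longrightarrow> I = carrier R \<longleftrightarrow> \<one> \<in> I"
  using ideal.one_imp_carrier by auto

lemma prime_is_ideal: "primeideal P R \<Longrightarrow> ideal P R"
  by (rule primeideal.axioms(1))

lemma prime_one_notin: "primeideal P R \<Longrightarrow> \<one> \<notin> P"
  using ideal_eq_carrier_iff prime_is_ideal primeideal.I_notcarr by metis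

lemma prime_one_compl [simp]: "primeideal P R \<Longrightarrow> \<one> \<in> carrier R - P"
  using prime_one_notin by simp

lemma prime_mult_compl:
  "\<lbrakk>primeideal P R; s \<in> carrier R - P; t \<in> carrier R - P\<rbrakk> \<Longrightarrow> s \<otimes> t \<in> carrier R - P"
  using primeideal.I_prime by fastforce

lemma prime_cancel:
  "\<lbrakk>primeideal P R; s \<in> carrier R - P; x \<in> carrier R; s \<otimes> x \<in> P\<rbrakk> \<Longrightarrow> x \<in> P"
  using primeideal.I_prime by fastforce

lemma prime_pow_compl:
  "\<lbrakk>primeideal P R; s \<in> carrier R - P\<rbrakk> \<Longrightarrow> s [^] (k::nat) \<in> carrier R - P"
  by (induct k) (auto intro: prime_mult_compl simp: prime_one_notin dest: primeideal.I_prime)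

lemma prime_pow_mem:
  assumes "primeideal P R" "x \<in> carrier R" "x [^] (k::nat) \<in> P" shows "x \<in> P"
  using prime_pow_compl[OF assms(1), of x k] assms by blast

section \<open>Principal ideals, sums and products of ideals\<close>

lemma PIdl_iff: "x \<in> PIdl a \<longleftrightarrow> (\<exists>r\<in>carrier R. x = r \<otimes> a)"
  by (auto simp: cgenideal_def)

lemma PIdl_subset_iff: "\<lbrakk>ideal I R; a \<in> carrier R\<rbrakk> \<Longrightarrow> PIdl a \<subseteq> I \<longleftrightarrow> a \<in> I"
  using cgenideal_minimal cgenideal_self by blast

lemma add_ideal_mem1: "\<lbrakk>ideal I R; ideal J R; x \<in> I\<rbrakk> \<Longrightarrow> x \<in> I <+> J"
  unfolding set_add_def' using ideal_zero_mem[of J] ideal.Icarr[of I R x] by fastforce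

lemma add_ideal_mem2: "\<lbrakk>ideal I R; ideal J R; x \<in> J\<rbrakk> \<Longrightarrow> x \<in> I <+> J"
  unfolding set_add_def' using ideal_zero_mem[of I] ideal.Icarr[of J R x] by fastforce

lemma add_ideal_subset: "\<lbrakk>ideal K R; I \<subseteq> K; J \<subseteq> K\<rbrakk> \<Longrightarrow> I <+> J \<subseteq> K"
  unfolding set_add_def' using ideal_add_mem by blast

lemma add_idealE:
  fixes x :: 'a
  assumes "x \<in> I <+> J" obtains i j where "i \<in> I" "j \<in> J" "x = i \<oplus> j"
  using assms unfolding set_add_def' by blast

lemma add_PIdlE:
  fixes x :: 'a
  assumes "x \<in> I <+> PIdl a" obtains i r where "i \<in> I" "r \<in> carrier R" "x = i \<oplus> r \<otimes> a"
  using assms by (elim add_idealE) (auto simp: PIdl_iff)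

lemma ideal_prod_subsetI:
  assumes "ideal K R" "\<And>i j. \<lbrakk>i \<in> I; j \<in> J\<rbrakk> \<Longrightarrow> i \<otimes> j \<in> K"
  shows "I \<cdot> J \<subseteq> K"
proof
  fix x assume "x \<in> I \<cdot> J"
  then show "x \<in> K"
    by induct (auto simp: assms ideal_add_mem)
qed

lemma ideal_prod_mono: "\<lbrakk>I \<subseteq> I'; J \<subseteq> J'; ideal I' R; ideal J' R\<rbrakk> \<Longrightarrow> I \<cdot> J \<subseteq> I' \<cdot> J'"
  by (rule ideal_prod_subsetI) (auto intro: ideal_prod.prod ideal_prod_is_ideal)

lemma ideal_prod_subset_left: "\<lbrakk>ideal I R; ideal J R\<rbrakk> \<Longrightarrow> I \<cdot> J \<subseteq> I"
  using ideal_prod_inter by blast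

lemma ideal_prod_subset_right: "\<lbrakk>ideal I R; ideal J R\<rbrakk> \<Longrightarrow> I \<cdot> J \<subseteq> J"
  using ideal_prod_inter by blast

lemma carrier_ideal_prod: "ideal I R \<Longrightarrow> carrier R \<cdot> I = I"
  using ideal_prod_one ideal_prod_commute oneideal by metis

lemma PIdl_prod: "\<lbrakk>a \<in> carrier R; b \<in> carrier R\<rbrakk> \<Longrightarrow> (PIdl a) \<cdot> (PIdl b) = PIdl (a \<otimes> b)"
proof
  assume ab: "a \<in> carrier R" "b \<in> carrier R"
  show "(PIdl a) \<cdot> (PIdl b) \<subseteq> PIdl (a \<otimes> b)"
  proof (rule ideal_prod_subsetI)
    show "ideal (PIdl (a \<otimes> b)) R" using ab by (simp add: cgenideal_ideal)
    fix i j assume "i \<in> PIdl a" "j \<in> PIdl b"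
    then obtain r s where "r \<in> carrier R" "s \<in> carrier R" "i = r \<otimes> a" "j = s \<otimes> b"
      by (auto simp: PIdl_iff)
    then show "i \<otimes> j \<in> PIdl (a \<otimes> b)"
      using ab by (auto simp: PIdl_iff m_ac intro!: bexI[of _ "r \<otimes> s"])
  qed
  show "PIdl (a \<otimes> b) \<subseteq> (PIdl a) \<cdot> (PIdl b)"
    using ab by (subst PIdl_subset_iff)
      (auto intro: ideal_prod_is_ideal cgenideal_ideal ideal_prod.prod cgenideal_self)
qed

lemma list_prod_Nil [simp]: "ideal_list_prod R [] = carrier R"
  and list_prod_Cons [simp]: "ideal_list_prod R (I # Is) = I \<cdot> ideal_list_prod R Is"
  by (simp_all add: ideal_list_prod_def)

lemma list_prod_ideal: "(\<And>I. I \<in> set Is \<Longrightarrow> ideal I R) \<Longrightarrow> ideal (ideal_list_prod R Is) R"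
  by (induct Is) (auto intro: ideal_prod_is_ideal oneideal)

lemma list_prod_subset_mem:
  "\<lbrakk>\<And>I. I \<in> set Is \<Longrightarrow> ideal I R; J \<in> set Is\<rbrakk> \<Longrightarrow> ideal_list_prod R Is \<subseteq> J"
proof (induct Is)
  case (Cons I Is)
  have "ideal I R" "ideal (ideal_list_prod R Is) R" using Cons.prems by (auto intro: list_prod_ideal)
  then have "I \<cdot> ideal_list_prod R Is \<subseteq> I \<inter> ideal_list_prod R Is"
    by (rule ideal_prod_inter)
  then show ?case using Cons by auto
qed simp

lemma list_prod_subset_prime:
  assumes "primeideal P R" "\<And>I. I \<in> set Is \<Longrightarrow> ideal I R" "ideal_list_prod R Is \<subseteq> P"
  shows "\<exists>I\<in>set Is. I \<subseteq> P"
  using assms(2,3)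
proof (induct Is)
  case Nil
  then show ?case using prime_one_notin[OF assms(1)] by auto
next
  case (Cons I Is)
  then have "I \<subseteq> P \<or> ideal_list_prod R Is \<subseteq> P"
    by (intro primeideal_divides_ideal_prod) (auto intro: assms list_prod_ideal)
  then show ?case using Cons by auto
qed

lemma prime_inter_prod:
  assumes "primeideal P R" "ideal I R" "ideal J R"
  shows "I \<cdot> J \<subseteq> P \<longleftrightarrow> I \<subseteq> P \<or> J \<subseteq> P"
  using primeideal_divides_ideal_prod[OF assms] ideal_prod_inter[OF assms(2,3)] by blast

text \<open>Lets a condition on products with \<open>a\<close> be checked on generators, or locally:
  its solutions form an ideal.\<close>

lemma colon_ideal:
  assumes "ideal K R" "a \<in> carrier R"
  shows "ideal {z \<in> carrier R. a \<otimes> z \<in> K} R"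
proof (rule cring_idealI)
  fix r x assume rx: "r \<in> carrier R" "x \<in> {z \<in> carrier R. a \<otimes> z \<in> K}"
  then have "a \<otimes> (r \<otimes> x) = r \<otimes> (a \<otimes> x)" using assms by (auto simp: m_ac)
  then show "r \<otimes> x \<in> {z \<in> carrier R. a \<otimes> z \<in> K}"
    using rx assms by (auto intro: ideal.I_l_closed)
qed (use assms in \<open>auto simp: ideal_zero_mem r_distr ideal_add_mem\<close>)

lemma Union_chain_ideal:
  assumes ne: "C \<noteq> {}" and ch: "\<And>I J. \<lbrakk>I \<in> C; J \<in> C\<rbrakk> \<Longrightarrow> I \<subseteq> J \<or> J \<subseteq> I"
    and id: "\<And>I. I \<in> C \<Longrightarrow> ideal I R"
  shows "ideal (\<Union>C) R"
proof (rule cring_idealI)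
  show "\<Union>C \<subseteq> carrier R" using id ideal_subset_carrier by blast
  show "\<zero> \<in> \<Union>C" using ne id ideal_zero_mem by blast
  show "x \<oplus> y \<in> \<Union>C" if xy: "x \<in> \<Union>C" "y \<in> \<Union>C" for x y
  proof -
    obtain I J where "I \<in> C" "J \<in> C" "x \<in> I" "y \<in> J" using xy by blast
    then obtain K where "K \<in> C" "x \<in> K" "y \<in> K" using ch by blast
    then show ?thesis using id ideal_add_mem by blast
  qed
  show "r \<otimes> x \<in> \<Union>C" if "r \<in> carrier R" "x \<in> \<Union>C" for r x
    using that id ideal.I_l_closed by fast
qed

section \<open>Finitely generated ideals\<close>

lemma fg_ideal_is_ideal: "fg_ideal R I \<Longrightarrow> ideal I R"
  by (auto simp: fg_ideal_def intro: genideal_ideal)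

lemma fg_ideal_PIdl: "a \<in> carrier R \<Longrightarrow> fg_ideal R (PIdl a)"
  unfolding fg_ideal_def by (intro exI[of _ "{a}"]) (auto simp: cgenideal_eq_genideal)

lemma fg_ideal_carrier: "fg_ideal R (carrier R)"
  using fg_ideal_PIdl[of \<one>] by (simp add: cgenideal_eq_genideal genideal_one)

lemma fg_ideal_add:
  assumes "fg_ideal R I" "fg_ideal R J" shows "fg_ideal R (I <+> J)"
proof -
  obtain S T where S: "finite S" "S \<subseteq> carrier R" "I = Idl S" and T: "finite T" "T \<subseteq> carrier R" "J = Idl T"
    using assms by (auto simp: fg_ideal_def)
  have "I <+> J = Idl (S \<union> T)"
  proof
    have "S \<subseteq> Idl (S \<union> T)" "T \<subseteq> Idl (S \<union> T)" using genideal_self[of "S \<union> T"] S T by auto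
    then show "I <+> J \<subseteq> Idl (S \<union> T)"
      using S T genideal_ideal[of "S \<union> T"] genideal_minimal[of "Idl (S \<union> T)"]
      by (intro add_ideal_subset) simp_all
    show "Idl (S \<union> T) \<subseteq> I <+> J"
    proof (rule genideal_minimal)
      have *: "ideal I R" "ideal J R" using S T genideal_ideal by auto
      show "ideal (I <+> J) R" using * by (rule add_ideals)
      have "S \<subseteq> I" "T \<subseteq> J" using S T genideal_self by auto
      then show "S \<union> T \<subseteq> I <+> J" using * add_ideal_mem1[of I J] add_ideal_mem2[of I J] by blast
    qed
  qed
  then show ?thesis unfolding fg_ideal_def using S T by (intro exI[of _ "S \<union> T"]) auto
qed

lemma fg_ideal_prod:
  assumes "fg_ideal R I" "fg_ideal R J" shows "fg_ideal R (I \<cdot> J)"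
proof -
  obtain S T where S: "finite S" "S \<subseteq> carrier R" "I = Idl S" and T: "finite T" "T \<subseteq> carrier R" "J = Idl T"
    using assms by (auto simp: fg_ideal_def)
  define U where "U = (\<lambda>(s, t). s \<otimes> t) ` (S \<times> T)"
  have U: "U \<subseteq> carrier R" "finite U" using S T by (auto simp: U_def)
  have id: "ideal I R" "ideal J R" "ideal (Idl U) R" using S T U genideal_ideal by auto
  \<comment> \<open>Membership in \<open>Idl U\<close> is extended from generators one factor at a
    time: first from \<open>T\<close> to \<open>J\<close> for fixed \<open>s\<close>, then from
    \<open>S\<close> to \<open>I\<close> for fixed \<open>y\<close>.\<close>
  have 1: "s \<otimes> y \<in> Idl U" if "s \<in> S" "y \<in> J" for s y
  proof -
    have "ideal {z \<in> carrier R. s \<otimes> z \<in> Idl U} R" using that S id by (intro colon_ideal) auto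
    moreover have "T \<subseteq> {z \<in> carrier R. s \<otimes> z \<in> Idl U}"
      using that T genideal_self[OF U(1)] by (auto simp: U_def)
    ultimately show ?thesis using that genideal_minimal T(3) by blast
  qed
  have "I \<cdot> J \<subseteq> Idl U"
  proof (rule ideal_prod_subsetI[OF id(3)])
    fix x y assume xy: "x \<in> I" "y \<in> J"
    have y: "y \<in> carrier R" using xy id ideal.Icarr by fast
    have "ideal {z \<in> carrier R. y \<otimes> z \<in> Idl U} R" using y id by (intro colon_ideal) auto
    moreover have "S \<subseteq> {z \<in> carrier R. y \<otimes> z \<in> Idl U}"
      using 1[OF _ xy(2)] S y m_comm by fastforce
    ultimately have "y \<otimes> x \<in> Idl U" using xy genideal_minimal S(3) by blast
    then show "x \<otimes> y \<in> Idl U" using m_comm xy y id ideal.Icarr by metis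
  qed
  moreover have "Idl U \<subseteq> I \<cdot> J"
  proof (rule genideal_minimal)
    show "ideal (I \<cdot> J) R" using id by (intro ideal_prod_is_ideal)
    have "S \<subseteq> I" "T \<subseteq> J" using S T genideal_self by auto
    then show "U \<subseteq> I \<cdot> J" by (auto simp: U_def intro!: ideal_prod.prod)
  qed
  ultimately show ?thesis unfolding fg_ideal_def using U by (intro exI[of _ U]) auto
qed

text \<open>Krull's separation lemma; multiplicatively closed sets of elements correspond to families
  of principal ideals.\<close>

lemma prime_avoiding_fg_family:
  assumes fg: "\<And>X. X \<in> F \<Longrightarrow> fg_ideal R X" and one: "carrier R \<in> F"
    and mult: "\<And>X Y. \<lbrakk>X \<in> F; Y \<in> F\<rbrakk> \<Longrightarrow> X \<cdot> Y \<in> F"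
    and I: "ideal I R" and avoid: "\<And>X. X \<in> F \<Longrightarrow> \<not> X \<subseteq> I"
  obtains P where "primeideal P R" "I \<subseteq> P" "\<And>X. X \<in> F \<Longrightarrow> \<not> X \<subseteq> P"
proof -
  define A where "A = {J. ideal J R \<and> I \<subseteq> J \<and> (\<forall>X\<in>F. \<not> X \<subseteq> J)}"
  have "\<exists>M\<in>A. \<forall>X\<in>A. M \<subseteq> X \<longrightarrow> X = M"
  proof (rule subset_Zorn_nonempty)
    show "A \<noteq> {}" using I avoid by (auto simp: A_def)
    fix C assume C: "C \<noteq> {}" "subset.chain A C"
    have CA: "\<And>J. J \<in> C \<Longrightarrow> J \<in> A" and ch: "\<And>J K. \<lbrakk>J \<in> C; K \<in> C\<rbrakk> \<Longrightarrow> J \<subseteq> K \<or> K \<subseteq> J"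
      using C(2) by (auto simp: subset_chain_def)
    have "ideal (\<Union>C) R" using C(1) ch CA by (intro Union_chain_ideal) (auto simp: A_def)
    moreover have "I \<subseteq> \<Union>C" using C(1) CA by (auto simp: A_def)
    \<comment> \<open>This is where finite generation enters: finitely many generators inside the
      union of a chain lie in a single member of it.\<close>
    moreover have "\<not> X \<subseteq> \<Union>C" if "X \<in> F" for X
    proof
      assume X: "X \<subseteq> \<Union>C"
      obtain S where S: "finite S" "S \<subseteq> carrier R" "X = Idl S" using fg[OF \<open>X \<in> F\<close>] by (auto simp: fg_ideal_def)
      have "S \<subseteq> \<Union>C" using X S genideal_self by blast
      then obtain J where "J \<in> C" "S \<subseteq> J"
        using finite_subset_Union_chain[OF S(1) _ C(1)] C(2) by blast
      then have "X \<subseteq> J" using CA[of J] genideal_minimal[of J S] S by (simp add: A_def)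
      then show False using CA[OF \<open>J \<in> C\<close>] that by (auto simp: A_def)
    qed
    ultimately show "\<Union>C \<in> A" by (simp add: A_def)
  qed
  then obtain M where M: "ideal M R" "I \<subseteq> M" "\<And>X. X \<in> F \<Longrightarrow> \<not> X \<subseteq> M"
    and max: "\<And>J. \<lbrakk>ideal J R; M \<subseteq> J; \<forall>X\<in>F. \<not> X \<subseteq> J\<rbrakk> \<Longrightarrow> J = M"
    unfolding A_def by (auto 4 4)
  have "primeideal M R"
  proof (rule primeidealI[OF M(1) is_cring])
    show "carrier R \<noteq> M" using M(3)[OF one] by auto
    fix a b assume ab: "a \<in> carrier R" "b \<in> carrier R" "a \<otimes> b \<in> M"
    show "a \<in> M \<or> b \<in> M"
    proof (rule ccontr)
      assume "\<not> (a \<in> M \<or> b \<in> M)"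
      then have nM: "a \<notin> M" "b \<notin> M" by auto
      have *: "\<exists>X\<in>F. X \<subseteq> M <+> PIdl c" if c: "c \<in> carrier R" "c \<notin> M" for c
      proof (rule ccontr)
        assume "\<not> (\<exists>X\<in>F. X \<subseteq> M <+> PIdl c)"
        moreover have "ideal (M <+> PIdl c) R" using M c by (intro add_ideals cgenideal_ideal)
        moreover have "M \<subseteq> M <+> PIdl c" using M c cgenideal_ideal add_ideal_mem1 by blast
        ultimately have "M <+> PIdl c = M" by (intro max) auto
        moreover have "c \<in> M <+> PIdl c" using M c cgenideal_ideal cgenideal_self by (intro add_ideal_mem2) auto
        ultimately show False using c by auto
      qed
      obtain X Y where XY: "X \<in> F" "X \<subseteq> M <+> PIdl a" "Y \<in> F" "Y \<subseteq> M <+> PIdl b"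
        using *[OF ab(1) nM(1)] *[OF ab(2) nM(2)] by blast
      have "X \<cdot> Y \<subseteq> M"
      proof (rule ideal_prod_subsetI[OF M(1)])
        fix i j assume "i \<in> X" "j \<in> Y"
        then have ij: "i \<in> M <+> PIdl a" "j \<in> M <+> PIdl b" using XY(2,4) by auto
        obtain m r where i: "m \<in> M" "r \<in> carrier R" "i = m \<oplus> r \<otimes> a" by (rule add_PIdlE[OF ij(1)])
        obtain n s where j: "n \<in> M" "s \<in> carrier R" "j = n \<oplus> s \<otimes> b" by (rule add_PIdlE[OF ij(2)])
        note h = i j
        have c: "m \<in> carrier R" "n \<in> carrier R" using h ideal.Icarr[OF M(1)] by auto
        have jc: "j \<in> carrier R" using h c ab by simp
        have "i \<otimes> j = m \<otimes> j \<oplus> ((r \<otimes> a) \<otimes> n \<oplus> (r \<otimes> s) \<otimes> (a \<otimes> b))"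
          using h c ab by (simp add: l_distr r_distr m_ac a_ac)
        also have "\<dots> \<in> M"
          using ideal.I_r_closed[OF M(1) h(1) jc] ideal.I_l_closed[OF M(1) h(4), of "r \<otimes> a"]
            ideal.I_l_closed[OF M(1) ab(3), of "r \<otimes> s"] h(2,5) ab(1)
          by (intro ideal_add_mem[OF M(1)]) simp_all
        finally show "i \<otimes> j \<in> M" .
      qed
      then show False using M(3) mult XY by blast
    qed
  qed
  then show thesis using that M by blast
qed

lemma prime_avoiding_mult_set:
  assumes "S \<subseteq> carrier R" "\<one> \<in> S" "\<And>s t. \<lbrakk>s \<in> S; t \<in> S\<rbrakk> \<Longrightarrow> s \<otimes> t \<in> S"
    and "ideal I R" "S \<inter> I = {}"
  obtains P where "primeideal P R" "I \<subseteq> P" "S \<inter> P = {}"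
proof -
  obtain P where P: "primeideal P R" "I \<subseteq> P" "\<And>X. X \<in> (\<lambda>s. PIdl s) ` S \<Longrightarrow> \<not> X \<subseteq> P"
  proof (rule prime_avoiding_fg_family[of "(\<lambda>s. PIdl s) ` S" I])
    show "carrier R \<in> (\<lambda>s. PIdl s) ` S"
      using assms(2) by (metis cgenideal_eq_genideal genideal_one image_eqI one_closed)
    show "fg_ideal R X" if "X \<in> (\<lambda>s. PIdl s) ` S" for X using that assms fg_ideal_PIdl by auto
    show "X \<cdot> Y \<in> (\<lambda>s. PIdl s) ` S" if XY: "X \<in> (\<lambda>s. PIdl s) ` S" "Y \<in> (\<lambda>s. PIdl s) ` S" for X Y
    proof -
      obtain s t where "s \<in> S" "t \<in> S" "X = PIdl s" "Y = PIdl t" using XY by auto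
      then have "X \<cdot> Y = PIdl (s \<otimes> t)" "s \<otimes> t \<in> S" using assms(1,3) PIdl_prod[of s t] by auto
      then show ?thesis by blast
    qed
    show "\<not> X \<subseteq> I" if X: "X \<in> (\<lambda>s. PIdl s) ` S" for X
    proof -
      obtain s where s: "s \<in> S" "X = PIdl s" using X by auto
      then have "s \<notin> I" using assms(5) by auto
      then show ?thesis using s assms(1,4) by (auto simp: PIdl_subset_iff)
    qed
  qed (use assms in auto)
  have "s \<notin> P" if "s \<in> S" for s
    using P(3)[of "PIdl s"] that assms(1) PIdl_subset_iff[OF prime_is_ideal[OF P(1)], of s] by blast
  then show thesis using that P by blast
qed

text \<open>Krull's lemma for the multiplicative set generated by \<open>x\<close> and the
  complement of \<open>P\<close>. It plays the role of the fact that, in the localization at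
  \<open>P\<close>, an element with no power in \<open>I\<close> is missed by some prime over
  \<open>I\<close>.\<close>

lemma prime_ge_notin:
  assumes P: "primeideal P R" and I: "ideal I R" and x: "x \<in> carrier R"
    and no: "\<And>s k. s \<in> carrier R - P \<Longrightarrow> s \<otimes> x [^] (k::nat) \<notin> I"
  obtains N where "primeideal N R" "I \<subseteq> N" "N \<subseteq> P" "x \<notin> N"
proof -
  define S where "S = {s \<otimes> x [^] (k::nat) | s k. s \<in> carrier R - P}"
  obtain N where N: "primeideal N R" "I \<subseteq> N" "S \<inter> N = {}"
  proof (rule prime_avoiding_mult_set[of S I])
    show "S \<subseteq> carrier R" using x by (auto simp: S_def)
    show "\<one> \<in> S" using P by (auto simp: S_def prime_one_notin intro!: exI[of _ \<one>] exI[of _ "0::nat"])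
    show "a \<otimes> b \<in> S" if ab: "a \<in> S" "b \<in> S" for a b
    proof -
      obtain s k t l where st: "s \<in> carrier R - P" "t \<in> carrier R - P"
        and eq: "a = s \<otimes> x [^] (k::nat)" "b = t \<otimes> x [^] (l::nat)"
        using ab by (auto simp: S_def)
      have "a \<otimes> b = (s \<otimes> t) \<otimes> x [^] (k + l)"
        using st x by (simp add: eq nat_pow_mult[symmetric] m_ac)
      then show ?thesis using prime_mult_compl[OF P st] by (auto simp: S_def)
    qed
    show "S \<inter> I = {}" using no by (auto simp: S_def)
  qed (use I in auto)
  have "s \<in> S" if "s \<in> carrier R - P" for s
    using that by (auto simp: S_def intro!: exI[of _ s] exI[of _ "0::nat"])
  then have "N \<subseteq> P" using N ideal_subset_carrier[OF prime_is_ideal[OF N(1)]] by auto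
  moreover have "x \<in> S" using x P by (auto simp: S_def prime_one_notin intro!: exI[of _ \<one>] exI[of _ "1::nat"])
  ultimately show thesis using that N by blast
qed

section \<open>Maximal ideals and minimal primes\<close>

lemma maximal_ideal_ge:
  assumes "ideal I R" "I \<noteq> carrier R"
  obtains M where "maximalideal M R" "I \<subseteq> M"
proof -
  define A where "A = {J. ideal J R \<and> I \<subseteq> J \<and> \<one> \<notin> J}"
  have "\<exists>M\<in>A. \<forall>X\<in>A. M \<subseteq> X \<longrightarrow> X = M"
  proof (rule subset_Zorn_nonempty)
    show "A \<noteq> {}" using assms ideal_eq_carrier_iff by (auto simp: A_def)
    fix C assume C: "C \<noteq> {}" "subset.chain A C"
    have CA: "\<And>J. J \<in> C \<Longrightarrow> J \<in> A" and ch: "\<And>J K. \<lbrakk>J \<in> C; K \<in> C\<rbrakk> \<Longrightarrow> J \<subseteq> K \<or> K \<subseteq> J"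
      using C(2) by (auto simp: subset_chain_def)
    have "ideal (\<Union>C) R" using C(1) ch CA by (intro Union_chain_ideal) (auto simp: A_def)
    then show "\<Union>C \<in> A" using C(1) CA by (auto simp: A_def)
  qed
  then obtain M where M: "ideal M R" "I \<subseteq> M" "\<one> \<notin> M"
    and max: "\<And>J. \<lbrakk>ideal J R; M \<subseteq> J; \<one> \<notin> J\<rbrakk> \<Longrightarrow> J = M"
    unfolding A_def by (auto 4 4)
  have "maximalideal M R"
    using M max ideal_eq_carrier_iff by (intro maximalidealI) auto
  then show thesis using that M by blast
qed

lemma maximal_is_ideal: "maximalideal M R \<Longrightarrow> ideal M R"
  by (rule maximalideal.axioms(1))

lemma maximal_eqI:
  "\<lbrakk>maximalideal M R; primeideal N R; M \<subseteq> N\<rbrakk> \<Longrightarrow> N = M"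
  using maximalideal.I_maximal[of M R N] prime_is_ideal[of N] ideal_subset_carrier[of N]
    primeideal.I_notcarr[of N R] by auto

lemma minimal_prime_le:
  assumes P: "primeideal P R" "I \<subseteq> P"
  obtains N where "N \<in> minimal_primes R I" "N \<subseteq> P"
proof -
  \<comment> \<open>Complements reverse inclusion, so a maximal member of \<open>A\<close> is the
    complement of a minimal prime.\<close>
  define A where "A = {- Q | Q. primeideal Q R \<and> I \<subseteq> Q \<and> Q \<subseteq> P}"
  have "\<exists>M\<in>A. \<forall>X\<in>A. M \<subseteq> X \<longrightarrow> X = M"
  proof (rule subset_Zorn_nonempty)
    show "A \<noteq> {}" using P by (auto simp: A_def)
    fix C assume C: "C \<noteq> {}" "subset.chain A C"
    have CA: "\<And>X. X \<in> C \<Longrightarrow> X \<in> A" and ch: "\<And>J K. \<lbrakk>J \<in> C; K \<in> C\<rbrakk> \<Longrightarrow> J \<subseteq> K \<or> K \<subseteq> J"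
      using C(2) by (auto simp: subset_chain_def)
    define D where "D = uminus ` C"
    have D0: "primeideal Q R \<and> I \<subseteq> Q \<and> Q \<subseteq> P" if Q: "Q \<in> D" for Q
    proof -
      obtain X where "X \<in> C" "Q = - X" using Q by (auto simp: D_def)
      then show ?thesis using CA[of X] by (auto simp: A_def)
    qed
    then have D: "\<And>Q. Q \<in> D \<Longrightarrow> primeideal Q R" "\<And>Q. Q \<in> D \<Longrightarrow> I \<subseteq> Q" "\<And>Q. Q \<in> D \<Longrightarrow> Q \<subseteq> P"
      by blast+
    have Dne: "D \<noteq> {}" using C(1) by (simp add: D_def)
    have chD: "J \<subseteq> K \<or> K \<subseteq> J" if "J \<in> D" "K \<in> D" for J K
      using that ch by (auto simp: D_def)
    have "primeideal (\<Inter>D) R"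
    proof (rule primeidealI[OF _ is_cring])
      show "ideal (\<Inter>D) R" using D Dne by (intro i_Intersect) (auto intro: prime_is_ideal)
      show "carrier R \<noteq> \<Inter>D" using D(1) Dne prime_one_notin by auto
      fix a b assume ab: "a \<in> carrier R" "b \<in> carrier R" "a \<otimes> b \<in> \<Inter>D"
      show "a \<in> \<Inter>D \<or> b \<in> \<Inter>D"
      proof (rule ccontr)
        assume "\<not> (a \<in> \<Inter>D \<or> b \<in> \<Inter>D)"
        then obtain Q Q' where "Q \<in> D" "a \<notin> Q" "Q' \<in> D" "b \<notin> Q'" by blast
        then obtain Q'' where "Q'' \<in> D" "a \<notin> Q''" "b \<notin> Q''" using chD by blast
        then show False using primeideal.I_prime[OF D(1)[of Q'']] ab by blast
      qed
    qed
    moreover have "I \<subseteq> \<Inter>D" "\<Inter>D \<subseteq> P" using D Dne by blast+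
    moreover have "\<Union>C = - \<Inter>D" by (auto simp: D_def)
    ultimately show "\<Union>C \<in> A" by (auto simp: A_def)
  qed
  then obtain X where X: "X \<in> A" and Xmax: "\<And>Y. \<lbrakk>Y \<in> A; X \<subseteq> Y\<rbrakk> \<Longrightarrow> Y = X" by blast
  obtain N where N: "primeideal N R" "I \<subseteq> N" "N \<subseteq> P" "X = - N" using X by (auto simp: A_def)
  have min: "Q = N" if "primeideal Q R" "I \<subseteq> Q" "Q \<subseteq> P" "Q \<subseteq> N" for Q
    using Xmax[of "- Q"] that N(4) by (auto simp: A_def)
  have "N \<in> minimal_primes R I" using N min unfolding minimal_primes_def by blast
  then show thesis using that N by blast
qed

lemma minimal_primesD:
  assumes "P \<in> minimal_primes R I"
  shows "primeideal P R" "I \<subseteq> P" "\<And>Q. \<lbrakk>primeideal Q R; I \<subseteq> Q; Q \<subseteq> P\<rbrakk> \<Longrightarrow> Q = P"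
  using assms by (auto simp: minimal_primes_def)

text \<open>Locally at \<open>P\<close> there is no other prime over \<open>I\<close>, so every
  element of \<open>P\<close> is nilpotent modulo \<open>I\<close> there.\<close>

lemma minimal_prime_power:
  assumes P: "P \<in> minimal_primes R I" and I: "ideal I R" and x: "x \<in> P"
  obtains s k where "s \<in> carrier R - P" "s \<otimes> x [^] (k::nat) \<in> I"
proof (rule ccontr)
  assume "\<not> thesis"
  then have no: "\<And>s k. s \<in> carrier R - P \<Longrightarrow> s \<otimes> x [^] (k::nat) \<notin> I" using that by blast
  note P = minimal_primesD[OF P]
  have "x \<in> carrier R" using x P ideal.Icarr prime_is_ideal by metis
  then obtain N where "primeideal N R" "I \<subseteq> N" "N \<subseteq> P" "x \<notin> N"
    using prime_ge_notin[OF P(1) I _ no] by metis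
  then show False using P(3) x by blast
qed

end

section \<open>Saturation at a prime ideal\<close>

text \<open>Transfers uniqueness of a maximal ideal along a bijection, by way of
  cardinalities.\<close>

lemma ex1_iff_card_1: "(\<exists>!x. x \<in> X) \<longleftrightarrow> card X = 1"
proof
  assume "\<exists>!x. x \<in> X"
  then obtain x where "X = {x}" by blast
  then show "card X = 1" by simp
next
  assume "card X = 1"
  then obtain x where "X = {x}" by (auto simp: card_1_singleton_iff)
  then show "\<exists>!x. x \<in> X" by simp
qed

context cring
begin

definition sat :: "'a set \<Rightarrow> 'a set \<Rightarrow> 'a set" where
  "sat P I = {x \<in> carrier R. \<exists>s\<in>carrier R - P. s \<otimes> x \<in> I}"

lemma satI: "\<lbrakk>s \<in> carrier R - P; x \<in> carrier R; s \<otimes> x \<in> I\<rbrakk> \<Longrightarrow> x \<in> sat P I"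
  by (auto simp: sat_def)

lemma satE:
  assumes "x \<in> sat P I" obtains s where "s \<in> carrier R - P" "x \<in> carrier R" "s \<otimes> x \<in> I"
  using assms by (auto simp: sat_def)

lemma sat_subset_carrier: "sat P I \<subseteq> carrier R"
  by (auto simp: sat_def)

lemma sat_ideal:
  assumes P: "primeideal P R" and I: "ideal I R" shows "ideal (sat P I) R"
proof (rule cring_idealI[OF sat_subset_carrier])
  show "\<zero> \<in> sat P I"
    by (rule satI[of \<one>]) (use P I in \<open>simp_all add: ideal_zero_mem prime_one_notin\<close>)
  fix x assume x: "x \<in> sat P I"
  then obtain s where s: "s \<in> carrier R - P" "x \<in> carrier R" "s \<otimes> x \<in> I" by (rule satE)
  show "r \<otimes> x \<in> sat P I" if r: "r \<in> carrier R" for r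
  proof (rule satI[OF s(1)])
    have "s \<otimes> (r \<otimes> x) = r \<otimes> (s \<otimes> x)" using s r by (simp add: m_ac)
    then show "s \<otimes> (r \<otimes> x) \<in> I" using r s ideal.I_l_closed[OF I] by simp
  qed (use r s in simp)
  fix y assume "y \<in> sat P I"
  then obtain t where t: "t \<in> carrier R - P" "y \<in> carrier R" "t \<otimes> y \<in> I" by (rule satE)
  show "x \<oplus> y \<in> sat P I"
  proof (rule satI[OF prime_mult_compl[OF P s(1) t(1)]])
    have "s \<otimes> t \<otimes> (x \<oplus> y) = t \<otimes> (s \<otimes> x) \<oplus> s \<otimes> (t \<otimes> y)" using s t by (simp add: m_ac r_distr)
    then show "s \<otimes> t \<otimes> (x \<oplus> y) \<in> I"
      using s t by (simp add: ideal_add_mem[OF I] ideal.I_l_closed[OF I])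
  qed (use s t in simp)
qed

lemma subset_sat: "\<lbrakk>primeideal P R; ideal I R\<rbrakk> \<Longrightarrow> I \<subseteq> sat P I"
  by (auto intro!: satI[of \<one>] simp: prime_one_notin ideal.Icarr)

lemma sat_mono: "I \<subseteq> J \<Longrightarrow> sat P I \<subseteq> sat P J"
  by (auto simp: sat_def)

lemma sat_antimono: "N \<subseteq> P \<Longrightarrow> sat P I \<subseteq> sat N I"
  by (auto simp: sat_def)

text \<open>Transitivity of localization: since \<open>N\<close> lies in \<open>P\<close>,
  denominators outside \<open>P\<close> are also outside \<open>N\<close> and can be multiplied into
  those for \<open>N\<close>.\<close>

lemma sat_sat:
  assumes P: "primeideal P R" and N: "primeideal N R" "N \<subseteq> P" and I: "ideal I R"
  shows "sat N (sat P I) = sat N I"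
proof
  show "sat N I \<subseteq> sat N (sat P I)" by (intro sat_mono subset_sat P I)
  show "sat N (sat P I) \<subseteq> sat N I"
  proof
    fix x assume "x \<in> sat N (sat P I)"
    then obtain s where s: "s \<in> carrier R - N" "x \<in> carrier R" "s \<otimes> x \<in> sat P I" by (rule satE)
    then obtain t where t: "t \<in> carrier R - P" "t \<otimes> (s \<otimes> x) \<in> I" by (auto elim: satE)
    have "t \<in> carrier R - N" using t N by auto
    then show "x \<in> sat N I"
      by (rule satI[OF prime_mult_compl[OF N(1) _ s(1)]]) (use s t in \<open>simp_all add: m_assoc\<close>)
  qed
qed

lemma sat_idem: "\<lbrakk>primeideal P R; ideal I R\<rbrakk> \<Longrightarrow> sat P (sat P I) = sat P I"
  by (simp add: sat_sat)

lemma sat_least: "\<lbrakk>primeideal P R; ideal J R; I \<subseteq> sat P J\<rbrakk> \<Longrightarrow> sat P I \<subseteq> sat P J"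
  using sat_mono sat_idem by blast

lemma sat_subset_prime:
  assumes "primeideal N R" "N \<subseteq> P" "I \<subseteq> N" shows "sat P I \<subseteq> N"
  using assms prime_cancel[OF assms(1)] by (auto simp: sat_def)

lemma sat_eq_carrier:
  assumes "ideal I R" "\<not> I \<subseteq> P" shows "sat P I = carrier R"
proof -
  obtain s where "s \<in> I" "s \<in> carrier R - P" using assms ideal_subset_carrier by blast
  then have "x \<in> sat P I" if "x \<in> carrier R" for x
    using that assms(1) by (auto intro!: satI[of s] ideal.I_r_closed)
  then show ?thesis using sat_subset_carrier by blast
qed

text \<open>Stands in for the compatibility of localization with products: the denominators of two
  factors multiply to one for the product.\<close>

lemma sat_prod_subset:
  assumes P: "primeideal P R" and "ideal I R" "ideal J R" "ideal I' R" "ideal J' R"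
    and I: "I \<subseteq> sat P I'" and J: "J \<subseteq> sat P J'"
  shows "I \<cdot> J \<subseteq> sat P (I' \<cdot> J')"
proof (rule ideal_prod_subsetI)
  show "ideal (sat P (I' \<cdot> J')) R" using assms by (intro sat_ideal ideal_prod_is_ideal)
  fix i j assume "i \<in> I" "j \<in> J"
  then have ij: "i \<in> sat P I'" "j \<in> sat P J'" using I J by auto
  obtain s where s: "s \<in> carrier R - P" "i \<in> carrier R" "s \<otimes> i \<in> I'" by (rule satE[OF ij(1)])
  obtain t where t: "t \<in> carrier R - P" "j \<in> carrier R" "t \<otimes> j \<in> J'" by (rule satE[OF ij(2)])
  have "s \<otimes> t \<otimes> (i \<otimes> j) = (s \<otimes> i) \<otimes> (t \<otimes> j)" using s t by (simp add: m_ac)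
  then have "s \<otimes> t \<otimes> (i \<otimes> j) \<in> I' \<cdot> J'" using s t by (simp add: ideal_prod.prod)
  then show "i \<otimes> j \<in> sat P (I' \<cdot> J')"
    by (rule satI[OF prime_mult_compl[OF P s(1) t(1)], rotated]) (use s t in simp)
qed

lemma subset_sat_prod:
  assumes "ideal I R" "ideal J R" "\<not> J \<subseteq> P" shows "I \<subseteq> sat P (I \<cdot> J)"
proof
  fix i assume i: "i \<in> I"
  obtain s where s: "s \<in> J" "s \<in> carrier R - P" using assms ideal_subset_carrier by blast
  have "i \<in> carrier R" using i assms ideal.Icarr by fast
  moreover have "s \<otimes> i \<in> I \<cdot> J"
    using ideal_prod.prod[OF i s(1), of R] calculation s by (simp add: m_comm)
  ultimately show "i \<in> sat P (I \<cdot> J)" using s by (auto intro: satI)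
qed

lemma mem_sat_PIdl:
  "x \<in> sat P (PIdl a) \<longleftrightarrow> x \<in> carrier R \<and> (\<exists>s\<in>carrier R - P. \<exists>r\<in>carrier R. s \<otimes> x = r \<otimes> a)"
  by (auto simp: sat_def PIdl_iff)

lemma mem_prod_PIdl:
  assumes "ideal I R" "a \<in> carrier R"
  shows "x \<in> I \<cdot> (PIdl a) \<longleftrightarrow> (\<exists>i\<in>I. x = i \<otimes> a)"
proof
  assume "x \<in> I \<cdot> (PIdl a)"
  then show "\<exists>i\<in>I. x = i \<otimes> a"
  proof induct
    case (prod i j)
    then obtain r where r: "r \<in> carrier R" "j = r \<otimes> a" by (auto simp: PIdl_iff)
    have "i \<in> carrier R" using prod assms ideal.Icarr by fast
    then have "i \<otimes> j = (i \<otimes> r) \<otimes> a" using r assms by (simp add: m_ac)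
    moreover have "i \<otimes> r \<in> I" using prod r assms ideal.I_r_closed by fast
    ultimately show ?case by blast
  next
    case (sum s1 s2)
    then obtain i j where "i \<in> I" "j \<in> I" "s1 = i \<otimes> a" "s2 = j \<otimes> a" by blast
    then have "s1 \<oplus> s2 = (i \<oplus> j) \<otimes> a" "i \<oplus> j \<in> I"
      using assms ideal.Icarr[OF assms(1)] ideal_add_mem by (simp_all add: l_distr)
    then show ?case by blast
  qed
next
  assume "\<exists>i\<in>I. x = i \<otimes> a"
  then show "x \<in> I \<cdot> (PIdl a)" using assms by (auto intro: ideal_prod.prod cgenideal_self)
qed

text \<open>The multipliers taking \<open>x\<close> into \<open>J\<close> form an ideal that lies in
  no maximal ideal, hence contains \<open>\<one>\<close>.\<close>

lemma ideal_subset_local: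
  assumes "ideal I R" "ideal J R" and loc: "\<And>M. maximalideal M R \<Longrightarrow> I \<subseteq> sat M J"
  shows "I \<subseteq> J"
proof
  fix x assume x: "x \<in> I"
  then have xc: "x \<in> carrier R" using assms ideal.Icarr by fast
  define C where "C = {z \<in> carrier R. x \<otimes> z \<in> J}"
  have C: "ideal C R" unfolding C_def by (rule colon_ideal[OF assms(2) xc])
  have "C = carrier R"
  proof (rule ccontr)
    assume "C \<noteq> carrier R"
    then obtain M where M: "maximalideal M R" "C \<subseteq> M" using maximal_ideal_ge[OF C] by blast
    have "x \<in> sat M J" using loc[OF M(1)] x by auto
    then obtain s where "s \<in> carrier R - M" "s \<otimes> x \<in> J" by (rule satE)
    then have "s \<in> C" "s \<notin> M" using xc by (auto simp: C_def m_comm)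
    then show False using M by blast
  qed
  then have "\<one> \<in> C" by simp
  then show "x \<in> J" using xc by (simp add: C_def)
qed

text \<open>A common denominator exists as the product of the denominators of the finitely many
  generators.\<close>

lemma fg_ideal_sat_common:
  assumes fg: "fg_ideal R I" and P: "primeideal P R" and J: "ideal J R" and sub: "I \<subseteq> sat P J"
  obtains s where "s \<in> carrier R - P" "\<And>x. x \<in> I \<Longrightarrow> s \<otimes> x \<in> J"
proof -
  obtain S where S: "finite S" "S \<subseteq> carrier R" "I = Idl S" using fg by (auto simp: fg_ideal_def)
  have "S \<subseteq> sat P J" using genideal_self S sub by blast
  with S(1) have "\<exists>s\<in>carrier R - P. \<forall>x\<in>S. s \<otimes> x \<in> J"
  proof (induct rule: finite_induct)
    case empty
    then show ?case using prime_one_compl[OF P] by blast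
  next
    case (insert x S)
    then obtain s where s: "s \<in> carrier R - P" "\<forall>x\<in>S. s \<otimes> x \<in> J" by blast
    have Sc: "S \<subseteq> carrier R" using insert.prems sat_subset_carrier[of P J] by auto
    obtain t where t: "t \<in> carrier R - P" "x \<in> carrier R" "t \<otimes> x \<in> J" using insert by (auto elim: satE)
    have "t \<otimes> s \<otimes> y = t \<otimes> (s \<otimes> y)" if "y \<in> S" for y using that s t Sc by (auto simp: m_ac)
    moreover have "t \<otimes> s \<otimes> x = s \<otimes> (t \<otimes> x)" using s t by (auto simp: m_ac)
    ultimately have "\<forall>y\<in>insert x S. t \<otimes> s \<otimes> y \<in> J"
      using s t ideal.I_l_closed[OF J] by auto
    then show ?case using prime_mult_compl[OF P t(1) s(1)] by blast
  qed
  then obtain s where s: "s \<in> carrier R - P" "\<forall>x\<in>S. s \<otimes> x \<in> J" by blast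
  have "ideal {z \<in> carrier R. s \<otimes> z \<in> J} R" using s by (intro colon_ideal J) auto
  then have "I \<subseteq> {z \<in> carrier R. s \<otimes> z \<in> J}"
    unfolding S(3) by (rule genideal_minimal) (use S s in auto)
  then show thesis using that s by blast
qed

section \<open>Maximal ideals of quotient rings\<close>

lemma bij_betw_maximal_quot:
  assumes I: "ideal I R"
  shows "bij_betw (\<lambda>J. (+>) I ` J) {M. maximalideal M R \<and> I \<subseteq> M} {M. maximalideal M (R Quot I)}"
proof -
  let ?f = "\<lambda>J. (+>) I ` J"
  interpret Q: cring "R Quot I" using I is_cring by (rule ideal.quotient_is_cring)
  have bij: "bij_betw ?f {J. ideal J R \<and> I \<subseteq> J} {J. ideal J (R Quot I)}"
    by (rule quot_ideal_correspondence[OF I])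
  \<comment> \<open>An ideal above \<open>I\<close> is the union of the cosets in its image. Hence
    the correspondence preserves and reflects inclusion, and with it maximality.\<close>
  have un: "\<Union> (?f J) = J" if "ideal J R" "I \<subseteq> J" for J
    using ideal_incl_iff[OF I that(1)] that(2) by simp
  have inj: "J = K" if "ideal J R" "I \<subseteq> J" "ideal K R" "I \<subseteq> K" "?f J = ?f K" for J K
  proof -
    have "J = \<Union> (?f J)" using un[OF that(1,2)] by (rule sym)
    also have "\<dots> = \<Union> (?f K)" by (simp only: that(5))
    also have "\<dots> = K" by (rule un[OF that(3,4)])
    finally show ?thesis .
  qed
  have img: "ideal (?f J) (R Quot I)" if "ideal J R" "I \<subseteq> J" for J
    using imageI[of J "{J. ideal J R \<and> I \<subseteq> J}" ?f] that
    unfolding bij_betw_imp_surj_on[OF bij] by simp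
  have surj: "\<exists>J. ideal J R \<and> I \<subseteq> J \<and> K = ?f J" if K: "ideal K (R Quot I)" for K
  proof -
    have "K \<in> ?f ` {J. ideal J R \<and> I \<subseteq> J}"
      unfolding bij_betw_imp_surj_on[OF bij] using K by simp
    then obtain J where J: "K = ?f J" "J \<in> {J. ideal J R \<and> I \<subseteq> J}" by (rule imageE)
    show ?thesis by (rule exI[of _ J]) (use J in simp)
  qed
  have le: "?f J \<subseteq> ?f K \<longleftrightarrow> J \<subseteq> K" if "ideal J R" "I \<subseteq> J" "ideal K R" "I \<subseteq> K" for J K
  proof
    assume "?f J \<subseteq> ?f K"
    then have "\<Union> (?f J) \<subseteq> \<Union> (?f K)" by (rule Union_mono)
    then show "J \<subseteq> K" by (simp only: un[OF that(1,2)] un[OF that(3,4)])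
  qed (rule image_mono)
  have fc: "?f (carrier R) = carrier (R Quot I)"
    by (auto simp: FactRing_def A_RCOSETS_def')
  have max: "maximalideal (?f J) (R Quot I) \<longleftrightarrow> maximalideal J R" if J: "ideal J R" "I \<subseteq> J" for J
  proof
    assume m: "maximalideal (?f J) (R Quot I)"
    show "maximalideal J R"
    proof (rule maximalidealI[OF J(1)])
      show "carrier R \<noteq> J" using maximalideal.I_notcarr[OF m] fc by auto
      fix K assume K: "ideal K R" "J \<subseteq> K" "K \<subseteq> carrier R"
      have IK: "I \<subseteq> K" using J K by blast
      have "?f K = ?f J \<or> ?f K = carrier (R Quot I)"
        using K img[OF K(1) IK] by (intro maximalideal.I_maximal[OF m]) (auto simp: fc[symmetric])
      then show "K = J \<or> K = carrier R"
        using inj[OF K(1) IK J] inj[OF K(1) IK oneideal] fc ideal_subset_carrier[OF I] by auto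
    qed
  next
    assume m: "maximalideal J R"
    show "maximalideal (?f J) (R Quot I)"
    proof (rule maximalidealI[OF img[OF J]])
      show "carrier (R Quot I) \<noteq> ?f J"
        using maximalideal.I_notcarr[OF m] inj[OF oneideal ideal_subset_carrier[OF I] J] fc by auto
      fix K assume K: "ideal K (R Quot I)" "?f J \<subseteq> K" "K \<subseteq> carrier (R Quot I)"
      obtain L where L: "ideal L R" "I \<subseteq> L" "K = ?f L" using surj[OF K(1)] by blast
      have "J \<subseteq> L" using K(2) le[OF J L(1,2)] L(3) by simp
      then have "L = J \<or> L = carrier R"
        using maximalideal.I_maximal[OF m L(1)] ideal_subset_carrier[OF L(1)] by blast
      then show "K = ?f J \<or> K = carrier (R Quot I)" using L fc by auto
    qed
  qed
  show ?thesis unfolding bij_betw_def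
  proof
    show "inj_on ?f {M. maximalideal M R \<and> I \<subseteq> M}"
      using inj maximal_is_ideal by (auto simp: inj_on_def)
    show "?f ` {M. maximalideal M R \<and> I \<subseteq> M} = {M. maximalideal M (R Quot I)}"
    proof
      show "?f ` {M. maximalideal M R \<and> I \<subseteq> M} \<subseteq> {M. maximalideal M (R Quot I)}"
        using max maximal_is_ideal by auto
      show "{M. maximalideal M (R Quot I)} \<subseteq> ?f ` {M. maximalideal M R \<and> I \<subseteq> M}"
      proof
        fix K assume "K \<in> {M. maximalideal M (R Quot I)}"
        then have K: "maximalideal K (R Quot I)" by simp
        obtain L where L: "ideal L R" "I \<subseteq> L" "K = ?f L" using surj maximalideal.axioms(1)[OF K] by blast
        then show "K \<in> ?f ` {M. maximalideal M R \<and> I \<subseteq> M}" using max[OF L(1,2)] K by blast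
      qed
    qed
  qed
qed

lemma semilocal_quot_iff:
  "ideal I R \<Longrightarrow> semilocal_cring (R Quot I) \<longleftrightarrow> finite {M. maximalideal M R \<and> I \<subseteq> M}"
  using bij_betw_finite[OF bij_betw_maximal_quot] ideal.quotient_is_cring is_cring
  by (auto simp: semilocal_cring_def)

lemma local_quot_iff:
  assumes I: "ideal I R"
  shows "local_cring (R Quot I) \<longleftrightarrow> (\<exists>!M. maximalideal M R \<and> I \<subseteq> M)"
proof -
  have c: "cring (R Quot I)" using I is_cring by (rule ideal.quotient_is_cring)
  have "card {M. maximalideal M R \<and> I \<subseteq> M} = card {M. maximalideal M (R Quot I)}"
    by (rule bij_betw_same_card[OF bij_betw_maximal_quot[OF I]])
  then show ?thesis using c ex1_iff_card_1[of "{M. maximalideal M R \<and> I \<subseteq> M}"]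
      ex1_iff_card_1[of "{M. maximalideal M (R Quot I)}"]
    by (simp add: local_cring_def)
qed

end

section \<open>Invertible ideals\<close>

context domain
begin

lemma fraction_embed_mult:
  assumes "r \<in> carrier R" "a \<in> carrier R" "d \<in> carrier R - {\<zero>}"
  shows "fraction_embed R r \<otimes>\<^bsub>fraction_field R\<^esub> frac_class R a d = frac_class R (r \<otimes> a) d"
  unfolding fraction_embed_def using assms by (simp add: frac_mult)

lemma frac_add_same_denom:
  assumes "a \<in> carrier R" "b \<in> carrier R" "d \<in> carrier R - {\<zero>}"
  shows "frac_class R a d \<oplus>\<^bsub>fraction_field R\<^esub> frac_class R b d = frac_class R (a \<oplus> b) d"
proof -
  have "(a \<otimes> d \<oplus> b \<otimes> d) \<otimes> d = (a \<oplus> b) \<otimes> (d \<otimes> d)" using assms by (simp add: l_distr r_distr m_ac)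
  then show ?thesis using assms by (simp add: frac_add frac_eq_iff integral_iff)
qed

lemma frac_zero: "d \<in> carrier R - {\<zero>} \<Longrightarrow> frac_class R \<zero> d = \<zero>\<^bsub>fraction_field R\<^esub>"
  by (simp add: fraction_field_zero frac_eq_iff)

lemma frac_eq_embed_iff:
  assumes "a \<in> carrier R" "d \<in> carrier R - {\<zero>}" "r \<in> carrier R"
  shows "frac_class R a d = fraction_embed R r \<longleftrightarrow> a = r \<otimes> d"
  unfolding fraction_embed_def using assms by (simp add: frac_eq_iff)

text \<open>With \<open>d\<close> a common denominator, a fractional ideal has the form
  \<open>(1/d) J'\<close>, and the condition on the inverse becomes an equation between ideals of
  \<open>R\<close>. From here on the fraction field no longer occurs.\<close>

lemma invertible_ideal_iff:
  "invertible_ideal R J \<longleftrightarrow>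
    ideal J R \<and> (\<exists>d\<in>carrier R - {\<zero>}. \<exists>J'. ideal J' R \<and> J \<cdot> J' = PIdl d)"
proof
  let ?K = "fraction_field R" and ?e = "fraction_embed R"
  interpret K: field ?K by (rule fraction_field_is_field)
  assume "invertible_ideal R J"
  then obtain F where J: "ideal J R" and F: "fractional_ideal R F"
    and prod: "ideal_prod ?K (?e ` J) F = ?e ` carrier R"
    by (auto simp: invertible_ideal_def)
  have Fsub: "subgroup F (add_monoid ?K)"
    and Fmult: "\<And>a x. \<lbrakk>a \<in> carrier R; x \<in> F\<rbrakk> \<Longrightarrow> ?e a \<otimes>\<^bsub>?K\<^esub> x \<in> F"
    using F by (auto simp: fractional_ideal_def)
  obtain d where d: "d \<in> carrier R - {\<zero>}" and dF: "\<And>x. x \<in> F \<Longrightarrow> ?e d \<otimes>\<^bsub>?K\<^esub> x \<in> ?e ` carrier R"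
    using F unfolding fractional_ideal_def by blast
  define J' where "J' = {a \<in> carrier R. frac_class R a d \<in> F}"
  have Fadd: "x \<oplus>\<^bsub>?K\<^esub> y \<in> F" if "x \<in> F" "y \<in> F" for x y
    using subgroup.m_closed[OF Fsub that] by simp
  have F0: "\<zero>\<^bsub>?K\<^esub> \<in> F" using subgroup.one_closed[OF Fsub] by simp
  have J': "ideal J' R"
  proof (rule cring_idealI)
    show "J' \<subseteq> carrier R" by (auto simp: J'_def)
    show "\<zero> \<in> J'" using F0 d by (simp add: J'_def frac_zero)
    show "x \<oplus> y \<in> J'" if "x \<in> J'" "y \<in> J'" for x y
      using that Fadd[of "frac_class R x d" "frac_class R y d"] d
      by (auto simp: J'_def frac_add_same_denom)
    show "r \<otimes> x \<in> J'" if "r \<in> carrier R" "x \<in> J'" for r x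
      using that Fmult[of r "frac_class R x d"] d by (auto simp: J'_def fraction_embed_mult)
  qed
  have Fform: "\<exists>a\<in>J'. x = frac_class R a d" if x: "x \<in> F" for x
  proof -
    have xK: "x \<in> carrier ?K" using subgroup.mem_carrier[OF Fsub x] by simp
    then obtain p q where pq: "p \<in> carrier R" "q \<in> carrier R - {\<zero>}" "x = frac_class R p q"
      by (rule fraction_fieldE)
    obtain a where a: "a \<in> carrier R" "?e d \<otimes>\<^bsub>?K\<^esub> x = ?e a" using dF[OF x] by auto
    have "frac_class R (d \<otimes> p) q = ?e a" using a d pq by (simp add: fraction_embed_mult)
    then have "d \<otimes> p = a \<otimes> q" using a d pq by (simp add: frac_eq_embed_iff)
    then have "x = frac_class R a d" using a d pq by (simp add: frac_eq_iff m_comm)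
    then show ?thesis using a x by (auto simp: J'_def)
  qed
  have "J \<cdot> J' = PIdl d"
  proof
    show "J \<cdot> J' \<subseteq> PIdl d"
    proof (rule ideal_prod_subsetI)
      show "ideal (PIdl d) R" using d by (simp add: cgenideal_ideal)
      fix j a assume j: "j \<in> J" and a: "a \<in> J'"
      have jc: "j \<in> carrier R" using j J ideal.Icarr by fast
      have "?e j \<otimes>\<^bsub>?K\<^esub> frac_class R a d \<in> ?e ` carrier R"
        unfolding prod[symmetric] using j a by (intro ideal_prod.prod) (auto simp: J'_def)
      then obtain r where "r \<in> carrier R" "frac_class R (j \<otimes> a) d = ?e r"
        using a d jc by (auto simp: J'_def fraction_embed_mult)
      then show "j \<otimes> a \<in> PIdl d"
        using a d jc by (auto simp: J'_def frac_eq_embed_iff PIdl_iff)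
    qed
    have JJ': "ideal (J \<cdot> J') R" using J J' by (rule ideal_prod_is_ideal)
    have "\<exists>y\<in>J \<cdot> J'. z = frac_class R y d" if "z \<in> ideal_prod ?K (?e ` J) F" for z
      using that
    proof induct
      case (prod i x)
      then obtain j a where ja: "j \<in> J" "i = ?e j" "a \<in> J'" "x = frac_class R a d" using Fform by blast
      have "j \<in> carrier R" "a \<in> carrier R" using ja J J' ideal.Icarr by fast+
      then have "i \<otimes>\<^bsub>?K\<^esub> x = frac_class R (j \<otimes> a) d" using ja d by (simp add: fraction_embed_mult)
      then show ?case using ja by (auto intro: ideal_prod.prod)
    next
      case (sum x y)
      then obtain a b where ab: "a \<in> J \<cdot> J'" "b \<in> J \<cdot> J'" "x = frac_class R a d" "y = frac_class R b d" by blast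
      then have "x \<oplus>\<^bsub>?K\<^esub> y = frac_class R (a \<oplus> b) d"
        using d ideal.Icarr[OF JJ'] by (simp add: frac_add_same_denom)
      then show ?case using ab ideal_add_mem[OF JJ'] by blast
    qed
    \<comment> \<open>Reading the unit as a fraction over \<open>d\<close> shows that its numerator,
      \<open>d\<close> itself, lies in \<open>J \<cdot> J'\<close>.\<close>
    moreover have "?e \<one> \<in> ideal_prod ?K (?e ` J) F" unfolding prod by simp
    ultimately obtain y where y: "y \<in> J \<cdot> J'" "?e \<one> = frac_class R y d" by blast
    have "y \<in> carrier R" using y(1) ideal.Icarr[OF JJ'] by simp
    then have "y = \<one> \<otimes> d" using frac_eq_embed_iff[of y d \<one>] y(2) d by simp
    then show "PIdl d \<subseteq> J \<cdot> J'" using y d PIdl_subset_iff[OF JJ', of d] by simp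
  qed
  then show "ideal J R \<and> (\<exists>d\<in>carrier R - {\<zero>}. \<exists>J'. ideal J' R \<and> J \<cdot> J' = PIdl d)"
    using J J' d by blast
next
  let ?K = "fraction_field R" and ?e = "fraction_embed R"
  interpret K: field ?K by (rule fraction_field_is_field)
  assume "ideal J R \<and> (\<exists>d\<in>carrier R - {\<zero>}. \<exists>J'. ideal J' R \<and> J \<cdot> J' = PIdl d)"
  then obtain d J' where J: "ideal J R" and d: "d \<in> carrier R - {\<zero>}" and J': "ideal J' R"
    and JJ: "J \<cdot> J' = PIdl d" by blast
  have Jc: "\<And>x. x \<in> J \<Longrightarrow> x \<in> carrier R" and J'c: "\<And>x. x \<in> J' \<Longrightarrow> x \<in> carrier R"
    using J J' ideal.Icarr by fast+
  define F where "F = (\<lambda>a. frac_class R a d) ` J'"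
  have sub: "subgroup F (add_monoid ?K)"
  proof (rule K.add.subgroupI)
    show "F \<subseteq> carrier ?K" using J'c d by (auto simp: F_def)
    show "F \<noteq> {}" using ideal_zero_mem[OF J'] by (auto simp: F_def)
    fix x assume "x \<in> F"
    then obtain a where a: "a \<in> J'" "x = frac_class R a d" by (auto simp: F_def)
    have "frac_class R (\<ominus> a) d \<oplus>\<^bsub>?K\<^esub> x = \<zero>\<^bsub>?K\<^esub>"
      using a d J'c by (simp add: frac_add_same_denom l_neg frac_zero)
    then have "\<ominus>\<^bsub>?K\<^esub> x = frac_class R (\<ominus> a) d"
      using a d J'c by (intro K.minus_equality) (simp_all add: frac_in_fraction_field)
    then show "\<ominus>\<^bsub>?K\<^esub> x \<in> F" using a ideal_uminus_mem[OF J'] by (auto simp: F_def)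
  next
    fix x y assume "x \<in> F" "y \<in> F"
    then show "x \<oplus>\<^bsub>?K\<^esub> y \<in> F"
      using d J'c ideal_add_mem[OF J'] by (auto simp: F_def frac_add_same_denom)
  qed
  have frac: "fractional_ideal R F"
    unfolding fractional_ideal_def
  proof (intro conjI sub ballI)
    fix a x assume "a \<in> carrier R" "x \<in> F"
    then show "?e a \<otimes>\<^bsub>?K\<^esub> x \<in> F"
      using d J'c ideal.I_l_closed[OF J'] by (auto simp: F_def fraction_embed_mult)
  next
    have "?e d \<otimes>\<^bsub>?K\<^esub> frac_class R a d = ?e a" if "a \<in> J'" for a
      using d J'c[OF that] by (simp add: fraction_embed_mult frac_eq_embed_iff m_comm)
    then show "\<exists>d\<in>carrier R - {\<zero>}. \<forall>x\<in>F. ?e d \<otimes>\<^bsub>?K\<^esub> x \<in> ?e ` carrier R"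
      using d J'c by (intro bexI[of _ d]) (auto simp: F_def)
  qed
  have JJc: "\<And>x. x \<in> J \<cdot> J' \<Longrightarrow> x \<in> carrier R" using ideal_prod_in_carrier[OF J J'] by blast
  have "ideal_prod ?K (?e ` J) F = ?e ` carrier R"
  proof
    show "ideal_prod ?K (?e ` J) F \<subseteq> ?e ` carrier R"
    proof
      fix z assume "z \<in> ideal_prod ?K (?e ` J) F"
      then show "z \<in> ?e ` carrier R"
      proof induct
        case (prod i x)
        then obtain j a where ja: "j \<in> J" "i = ?e j" "a \<in> J'" "x = frac_class R a d" by (auto simp: F_def)
        have "j \<otimes> a \<in> PIdl d" unfolding JJ[symmetric] using ja by (auto intro: ideal_prod.prod)
        then obtain r where "r \<in> carrier R" "j \<otimes> a = r \<otimes> d" by (auto simp: PIdl_iff)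
        then have "i \<otimes>\<^bsub>?K\<^esub> x = ?e r" using ja Jc J'c d
          by (simp add: fraction_embed_mult frac_eq_embed_iff)
        then show ?case using \<open>r \<in> carrier R\<close> by blast
      next
        case (sum x y)
        then obtain r s where "r \<in> carrier R" "s \<in> carrier R" "x = ?e r" "y = ?e s" by blast
        then have "x \<oplus>\<^bsub>?K\<^esub> y = ?e (r \<oplus> s)" "r \<oplus> s \<in> carrier R"
          using fraction_embed_hom by (auto simp: ring_hom_def)
        then show ?case by blast
      qed
    qed
    have gen: "frac_class R y d \<in> ideal_prod ?K (?e ` J) F" if "y \<in> J \<cdot> J'" for y
      using that
    proof induct
      case (prod j a)
      have "?e j \<otimes>\<^bsub>?K\<^esub> frac_class R a d \<in> ideal_prod ?K (?e ` J) F"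
        using prod by (intro ideal_prod.prod) (auto simp: F_def)
      then show ?case using prod Jc J'c d by (simp add: fraction_embed_mult)
    next
      case (sum x y)
      have "frac_class R x d \<oplus>\<^bsub>?K\<^esub> frac_class R y d \<in> ideal_prod ?K (?e ` J) F"
        using sum by (intro ideal_prod.sum)
      then show ?case using sum JJc d by (simp add: frac_add_same_denom)
    qed
    show "?e ` carrier R \<subseteq> ideal_prod ?K (?e ` J) F"
    proof
      fix z assume "z \<in> ?e ` carrier R"
      then obtain r where r: "r \<in> carrier R" "z = ?e r" by blast
      have "r \<otimes> d \<in> J \<cdot> J'" unfolding JJ using r by (auto simp: PIdl_iff)
      moreover have "frac_class R (r \<otimes> d) d = z" using r d by (simp add: frac_eq_embed_iff)
      ultimately show "z \<in> ideal_prod ?K (?e ` J) F" using gen by metis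
    qed
  qed
  then show "invertible_ideal R J" using J frac by (auto simp: invertible_ideal_def)
qed

lemma invertible_is_ideal: "invertible_ideal R J \<Longrightarrow> ideal J R"
  by (simp add: invertible_ideal_def)

text \<open>Multiplication by the complementary ideal \<open>J'\<close> replaces \<open>J\<close> by
  \<open>(d)\<close>, and the nonzero \<open>d\<close> cancels elementwise.\<close>

lemma invertible_cancel:
  assumes J: "invertible_ideal R J" and A: "ideal A R" and B: "ideal B R" and sub: "J \<cdot> A \<subseteq> J \<cdot> B"
  shows "A \<subseteq> B"
proof
  fix x assume x: "x \<in> A"
  note Ji = invertible_is_ideal[OF J]
  obtain d J' where d: "d \<in> carrier R" "d \<noteq> \<zero>" and J': "ideal J' R" and JJ: "J \<cdot> J' = PIdl d"
    using J by (auto simp: invertible_ideal_iff)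
  have re: "J' \<cdot> (J \<cdot> C) = C \<cdot> (PIdl d)" if C: "ideal C R" for C
  proof -
    have "J' \<cdot> (J \<cdot> C) = (J \<cdot> J') \<cdot> C" using C Ji J' by (metis ideal_prod_assoc ideal_prod_commute)
    then show ?thesis unfolding JJ using C d by (simp add: ideal_prod_commute cgenideal_ideal)
  qed
  have "J' \<cdot> (J \<cdot> A) \<subseteq> J' \<cdot> (J \<cdot> B)"
    by (rule ideal_prod_mono[OF subset_refl sub J' ideal_prod_is_ideal[OF Ji B]])
  then have "A \<cdot> (PIdl d) \<subseteq> B \<cdot> (PIdl d)" unfolding re[OF A] re[OF B] .
  then have "x \<otimes> d \<in> B \<cdot> (PIdl d)" using x mem_prod_PIdl[OF A d(1)] by blast
  then obtain y where y: "y \<in> B" "x \<otimes> d = y \<otimes> d" using mem_prod_PIdl[OF B d(1)] by blast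
  moreover have "x \<in> carrier R" "y \<in> carrier R" using x y A B ideal.Icarr by fast+
  ultimately have "x = y" using m_rcancel[of d x y] d by simp
  then show "x \<in> B" using y by simp
qed

lemma invertible_prod:
  assumes "invertible_ideal R I" "invertible_ideal R J" shows "invertible_ideal R (I \<cdot> J)"
proof -
  obtain d I' where d: "d \<in> carrier R" "d \<noteq> \<zero>" and I: "ideal I R" "ideal I' R" "I \<cdot> I' = PIdl d"
    using assms(1) by (auto simp: invertible_ideal_iff)
  obtain e J' where e: "e \<in> carrier R" "e \<noteq> \<zero>" and J: "ideal J R" "ideal J' R" "J \<cdot> J' = PIdl e"
    using assms(2) by (auto simp: invertible_ideal_iff)
  have "(I \<cdot> J) \<cdot> (I' \<cdot> J') = (I \<cdot> I') \<cdot> (J \<cdot> J')"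
  proof -
    have "(I \<cdot> J) \<cdot> (I' \<cdot> J') = I \<cdot> (J \<cdot> (I' \<cdot> J'))"
      using I J by (intro ideal_prod_assoc ideal_prod_is_ideal)
    also have "J \<cdot> (I' \<cdot> J') = (I' \<cdot> J') \<cdot> J" using I J by (intro ideal_prod_commute ideal_prod_is_ideal)
    also have "\<dots> = I' \<cdot> (J' \<cdot> J)" using I J by (intro ideal_prod_assoc)
    also have "J' \<cdot> J = J \<cdot> J'" using J by (intro ideal_prod_commute)
    also have "I \<cdot> (I' \<cdot> (J \<cdot> J')) = (I \<cdot> I') \<cdot> (J \<cdot> J')"
      using I J by (intro ideal_prod_assoc[symmetric] ideal_prod_is_ideal)
    finally show ?thesis .
  qed
  also have "\<dots> = PIdl (d \<otimes> e)" using I(3) J(3) d e by (simp add: PIdl_prod)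
  finally show ?thesis
    unfolding invertible_ideal_iff using I J d e
    by (auto simp: ideal_prod_is_ideal integral_iff intro!: bexI[of _ "d \<otimes> e"] exI[of _ "I' \<cdot> J'"])
qed

lemma invertible_carrier: "invertible_ideal R (carrier R)"
proof -
  have "carrier R \<cdot> carrier R = PIdl \<one>"
    by (simp add: carrier_ideal_prod oneideal cgenideal_eq_genideal genideal_one)
  then show ?thesis unfolding invertible_ideal_iff
    by (intro conjI oneideal bexI[of _ \<one>] exI[of _ "carrier R"]) auto
qed

lemma invertible_list_prod:
  "(\<And>J. J \<in> set Js \<Longrightarrow> invertible_ideal R J) \<Longrightarrow> invertible_ideal R (ideal_list_prod R Js)"
  by (induct Js) (auto intro: invertible_prod invertible_carrier)

text \<open>If no product of elements generated locally, the whole product would lie in \<open>P\<close> times the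
  local generator; this avoids handling finite sums.\<close>

lemma factor_locally_principal:
  assumes P: "primeideal P R" and I: "ideal I R" and J: "ideal J R" and x: "x \<in> carrier R" "x \<noteq> \<zero>"
    and le: "I \<cdot> J \<subseteq> sat P (PIdl x)" and mem: "x \<in> sat P (I \<cdot> J)"
  obtains i where "i \<in> I" "I \<subseteq> sat P (PIdl i)"
proof -
  note Pi = prime_is_ideal[OF P]
  define K where "K = sat P (P \<cdot> (PIdl x))"
  have Px: "ideal (P \<cdot> (PIdl x)) R" using Pi x by (intro ideal_prod_is_ideal cgenideal_ideal)
  have K: "ideal K R" unfolding K_def by (rule sat_ideal[OF P Px])
  have "\<exists>i\<in>I. \<exists>j\<in>J. i \<otimes> j \<notin> K"
  proof (rule ccontr)
    assume "\<not> ?thesis"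
    then have "I \<cdot> J \<subseteq> K" using K by (intro ideal_prod_subsetI) auto
    then have "x \<in> K" using mem sat_least[OF P Px] unfolding K_def by blast
    then obtain s where s: "s \<in> carrier R - P" "s \<otimes> x \<in> P \<cdot> (PIdl x)" unfolding K_def by (rule satE)
    then obtain p where p: "p \<in> P" "s \<otimes> x = p \<otimes> x" using mem_prod_PIdl[OF Pi x(1)] by blast
    have "p \<in> carrier R" "s \<in> carrier R" using p(1) s(1) ideal.Icarr[OF Pi] by auto
    then have "s = p" using m_rcancel[OF x(2,1)] p(2) by blast
    then show False using s p by simp
  qed
  then obtain i0 j0 where ij: "i0 \<in> I" "j0 \<in> J" "i0 \<otimes> j0 \<notin> K" by blast
  have c: "i0 \<in> carrier R" "j0 \<in> carrier R" using ij I J ideal.Icarr by fast+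
  have "i0 \<otimes> j0 \<in> sat P (PIdl x)" using le ij by (auto intro: ideal_prod.prod)
  then obtain s r where sr: "s \<in> carrier R - P" "r \<in> carrier R" "s \<otimes> (i0 \<otimes> j0) = r \<otimes> x"
    unfolding mem_sat_PIdl by blast
  have rP: "r \<notin> P"
  proof
    assume "r \<in> P"
    then have "s \<otimes> (i0 \<otimes> j0) \<in> P \<cdot> (PIdl x)" using mem_prod_PIdl[OF Pi x(1)] sr by blast
    then have "i0 \<otimes> j0 \<in> K" unfolding K_def using sr c by (intro satI[of s]) auto
    then show False using ij by simp
  qed
  have "s \<otimes> (i0 \<otimes> j0) \<noteq> \<zero>"
    using sr x rP ideal_zero_mem[OF Pi] integral_iff[of r x] by auto
  then have j0: "j0 \<noteq> \<zero>" using c sr by auto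
  \<comment> \<open>Up to elements outside \<open>P\<close>, \<open>i0 \<otimes> j0\<close> is
    \<open>x\<close>. So \<open>i \<otimes> j0\<close> is locally a multiple of
    \<open>i0 \<otimes> j0\<close>, and \<open>j0\<close> cancels.\<close>
  have "i \<in> sat P (PIdl i0)" if i: "i \<in> I" for i
  proof -
    have ic: "i \<in> carrier R" using i I ideal.Icarr by fast
    have "i \<otimes> j0 \<in> sat P (PIdl x)" using le i ij by (auto intro: ideal_prod.prod)
    then obtain t q where tq: "t \<in> carrier R - P" "q \<in> carrier R" "t \<otimes> (i \<otimes> j0) = q \<otimes> x"
      unfolding mem_sat_PIdl by blast
    have "j0 \<otimes> ((r \<otimes> t) \<otimes> i) = r \<otimes> (t \<otimes> (i \<otimes> j0))" using tq(1,2) sr(1,2) c ic by (simp add: m_ac)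
    also have "\<dots> = q \<otimes> (r \<otimes> x)" unfolding tq(3) using tq(1,2) sr(1,2) x(1) by (simp add: m_ac)
    also have "\<dots> = j0 \<otimes> ((q \<otimes> s) \<otimes> i0)" unfolding sr(3)[symmetric] using tq(1,2) sr(1,2) c by (simp add: m_ac)
    finally have "(r \<otimes> t) \<otimes> i = (q \<otimes> s) \<otimes> i0"
      using m_lcancel[of j0 "(r \<otimes> t) \<otimes> i" "(q \<otimes> s) \<otimes> i0"] j0 tq sr c ic by simp
    moreover have "r \<otimes> t \<in> carrier R - P" using prime_mult_compl[OF P, of r t] sr tq rP by blast
    ultimately show ?thesis unfolding mem_sat_PIdl using ic tq sr by blast
  qed
  then show thesis using that ij by blast
qed

text \<open>Some product \<open>i \<otimes> j\<close> equals \<open>r \<otimes> d\<close> with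
  \<open>r\<close> outside \<open>P\<close>; then \<open>r x d = (x j) i\<close>, and
  \<open>x j\<close> is a multiple of \<open>d\<close>, so \<open>r\<close> takes all of
  \<open>J\<close> into \<open>(i)\<close>. A single multiplier for the whole ideal is more than
  being locally principal, where the denominator may vary with \<open>x\<close>.\<close>

lemma invertible_common_multiplier:
  assumes J: "invertible_ideal R J" and P: "primeideal P R"
  obtains a s where "a \<in> J" "s \<in> carrier R - P" "\<And>x. x \<in> J \<Longrightarrow> s \<otimes> x \<in> PIdl a"
proof -
  note Ji = invertible_is_ideal[OF J]
  note Pi = prime_is_ideal[OF P]
  obtain d J' where d: "d \<in> carrier R" "d \<noteq> \<zero>" and J': "ideal J' R" and JJ: "J \<cdot> J' = PIdl d"
    using J by (auto simp: invertible_ideal_iff)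
  have di: "ideal (PIdl d) R" using d by (intro cgenideal_ideal)
  have Jc: "\<And>x. x \<in> J \<Longrightarrow> x \<in> carrier R" and J'c: "\<And>x. x \<in> J' \<Longrightarrow> x \<in> carrier R"
    using ideal.Icarr[OF Ji] ideal.Icarr[OF J'] by blast+
  have prod: "\<exists>r\<in>carrier R. i \<otimes> j = r \<otimes> d" if "i \<in> J" "j \<in> J'" for i j
  proof -
    have "i \<otimes> j \<in> PIdl d" unfolding JJ[symmetric] using that by (rule ideal_prod.prod)
    then show ?thesis by (simp add: PIdl_iff)
  qed
  have "\<exists>i\<in>J. \<exists>j\<in>J'. i \<otimes> j \<notin> P \<cdot> (PIdl d)"
  proof (rule ccontr)
    assume "\<not> ?thesis"
    then have "J \<cdot> J' \<subseteq> P \<cdot> (PIdl d)" by (intro ideal_prod_subsetI ideal_prod_is_ideal Pi di) auto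
    then have "d \<in> P \<cdot> (PIdl d)" unfolding JJ using cgenideal_self[OF d(1)] by blast
    then obtain p where p: "p \<in> P" "d = p \<otimes> d" using mem_prod_PIdl[OF Pi d(1)] by blast
    note pc = ideal.Icarr[OF Pi p(1)]
    have "\<one> \<otimes> d = p \<otimes> d" using p(2) d(1) by simp
    then have "\<one> = p" using m_rcancel[OF d(2,1) one_closed pc] by blast
    then show False using p(1) prime_one_notin[OF P] by blast
  qed
  then obtain i j where ij: "i \<in> J" "j \<in> J'" "i \<otimes> j \<notin> P \<cdot> (PIdl d)" by blast
  obtain r where r: "r \<in> carrier R" "i \<otimes> j = r \<otimes> d" using prod[OF ij(1,2)] by blast
  have "r \<notin> P" using ij(3) r mem_prod_PIdl[OF Pi d(1)] by metis
  moreover have "r \<otimes> x \<in> PIdl i" if x: "x \<in> J" for x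
  proof -
    obtain c where c: "c \<in> carrier R" "x \<otimes> j = c \<otimes> d" using prod[OF x ij(2)] by blast
    have "d \<otimes> (r \<otimes> x) = (r \<otimes> d) \<otimes> x" using r(1) d(1) Jc[OF x] by (simp add: m_ac)
    also have "\<dots> = (x \<otimes> j) \<otimes> i" unfolding r(2)[symmetric] using Jc[OF x] Jc[OF ij(1)] J'c[OF ij(2)] by (simp add: m_ac)
    also have "\<dots> = d \<otimes> (c \<otimes> i)" unfolding c(2) using c(1) d(1) Jc[OF ij(1)] by (simp add: m_ac)
    finally have "r \<otimes> x = c \<otimes> i"
      using m_lcancel[of d "r \<otimes> x" "c \<otimes> i"] d r(1) c(1) Jc[OF x] Jc[OF ij(1)] by simp
    then show ?thesis using c(1) by (auto simp: PIdl_iff)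
  qed
  ultimately show thesis using that[of i r] ij(1) r(1) by blast
qed

lemma invertible_locally_principal:
  assumes J: "invertible_ideal R J" and P: "primeideal P R"
  obtains a where "a \<in> J" "J \<subseteq> sat P (PIdl a)"
proof -
  obtain a s where as: "a \<in> J" "s \<in> carrier R - P" "\<And>x. x \<in> J \<Longrightarrow> s \<otimes> x \<in> PIdl a"
    using invertible_common_multiplier[OF J P] by blast
  have "J \<subseteq> sat P (PIdl a)"
    using as(2,3) ideal.Icarr[OF invertible_is_ideal[OF J]] by (auto intro: satI)
  then show thesis using that as(1) by blast
qed

text \<open>The complementary ideal is the conductor of \<open>I\<close> into \<open>(d)\<close>,
  for any nonzero \<open>d\<close> in \<open>I\<close>. The multiplier \<open>s\<close>, the same
  for all \<open>x\<close>, puts \<open>d\<close> locally into the product.\<close>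

lemma locally_principal_invertible:
  assumes I: "ideal I R" "I \<noteq> {\<zero>}"
    and loc: "\<And>M. maximalideal M R \<Longrightarrow> \<exists>a\<in>I. \<exists>s\<in>carrier R - M. \<forall>x\<in>I. s \<otimes> x \<in> PIdl a"
  shows "invertible_ideal R I"
proof -
  obtain d where d: "d \<in> I" "d \<noteq> \<zero>" using I ideal_zero_mem by blast
  have dc: "d \<in> carrier R" using d I ideal.Icarr by fast
  define C where "C = {z \<in> carrier R. \<forall>x\<in>I. z \<otimes> x \<in> PIdl d}"
  note D = cgenideal_ideal[OF dc]
  have Ic: "\<And>x. x \<in> I \<Longrightarrow> x \<in> carrier R" using I ideal.Icarr by fast
  have C: "ideal C R"
  proof (rule cring_idealI)
    show "r \<otimes> x \<in> C" if "r \<in> carrier R" "x \<in> C" for r x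
      using that Ic ideal.I_l_closed[OF D] by (auto simp: C_def m_assoc)
  qed (use Ic ideal_zero_mem[OF D] ideal_add_mem[OF D] in \<open>auto simp: C_def l_distr\<close>)
  have IC: "ideal (I \<cdot> C) R" using I C by (intro ideal_prod_is_ideal)
  have "I \<cdot> C = PIdl d"
  proof
    show "I \<cdot> C \<subseteq> PIdl d"
      using Ic by (intro ideal_prod_subsetI[OF D]) (auto simp: C_def m_comm)
    show "PIdl d \<subseteq> I \<cdot> C"
    proof (rule ideal_subset_local[OF D IC])
      fix M assume M: "maximalideal M R"
      obtain a s where as: "a \<in> I" "s \<in> carrier R - M" "\<And>x. x \<in> I \<Longrightarrow> s \<otimes> x \<in> PIdl a"
        using loc[OF M] by blast
      have ac: "a \<in> carrier R" using as Ic by simp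
      obtain c where c: "c \<in> carrier R" "s \<otimes> d = c \<otimes> a" using as(3)[OF d(1)] by (auto simp: PIdl_iff)
      \<comment> \<open>Up to \<open>s\<close>, the element \<open>c\<close> is the quotient of
        \<open>d\<close> by the local generator \<open>a\<close>; hence \<open>x = t a\<close> turns
        into \<open>c x = t d\<close>.\<close>
      have "c \<in> C"
        unfolding C_def
      proof (intro CollectI conjI ballI c(1))
        fix x assume x: "x \<in> I"
        obtain t where t: "t \<in> carrier R" "s \<otimes> x = t \<otimes> a" using as(3)[OF x] by (auto simp: PIdl_iff)
        have s0: "s \<noteq> \<zero>" using as(2) ideal_zero_mem[OF maximal_is_ideal[OF M]] by blast
        have "s \<otimes> (c \<otimes> x) = c \<otimes> (s \<otimes> x)" using as(2) c(1) Ic[OF x] by (simp add: m_ac)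
        also have "\<dots> = t \<otimes> (c \<otimes> a)" unfolding t(2) using c(1) t(1) ac by (simp add: m_ac)
        also have "\<dots> = s \<otimes> (t \<otimes> d)" unfolding c(2)[symmetric] using as(2) t(1) dc by (simp add: m_ac)
        finally have "c \<otimes> x = t \<otimes> d"
          using m_lcancel[of s "c \<otimes> x" "t \<otimes> d"] s0 as c t dc Ic[OF x] by simp
        then show "c \<otimes> x \<in> PIdl d" using t by (auto simp: PIdl_iff)
      qed
      then have "a \<otimes> c \<in> I \<cdot> C" using as by (intro ideal_prod.prod)
      then have "s \<otimes> d \<in> I \<cdot> C" using c ac by (simp add: m_comm)
      then have "d \<in> sat M (I \<cdot> C)" using as dc by (auto intro: satI)
      then show "PIdl d \<subseteq> sat M (I \<cdot> C)"
        using PIdl_subset_iff[OF sat_ideal[OF maximalideal_prime[OF M] IC] dc] by simp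
    qed
  qed
  then show ?thesis unfolding invertible_ideal_iff using I C d dc by blast
qed

text \<open>Nakayama's argument: locally \<open>x = r a\<close> and \<open>y = q a\<close>, while
  \<open>a\<close> is a combination of \<open>x\<close> and \<open>y\<close>. Cancelling
  \<open>a\<close> expresses a unit through \<open>r\<close> and \<open>q\<close>, so one of these
  is a unit, and the corresponding element divides the other.\<close>

lemma two_generated_sat_cases:
  assumes P: "primeideal P R" and xy: "x \<in> carrier R" "y \<in> carrier R" and x0: "x \<noteq> \<zero>"
    and a: "a \<in> sat P (PIdl x <+> PIdl y)" and xa: "x \<in> sat P (PIdl a)" and ya: "y \<in> sat P (PIdl a)"
  shows "x \<in> sat P (PIdl y) \<or> y \<in> sat P (PIdl x)"
proof -
  obtain s r where s: "s \<in> carrier R - P" "r \<in> carrier R" "s \<otimes> x = r \<otimes> a"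
    using xa unfolding mem_sat_PIdl by blast
  obtain t q where t: "t \<in> carrier R - P" "q \<in> carrier R" "t \<otimes> y = q \<otimes> a"
    using ya unfolding mem_sat_PIdl by blast
  obtain w where w: "w \<in> carrier R - P" "a \<in> carrier R" "w \<otimes> a \<in> PIdl x <+> PIdl y"
    using a by (rule satE)
  obtain i v where iv: "i \<in> PIdl x" "v \<in> carrier R" "w \<otimes> a = i \<oplus> v \<otimes> y" by (rule add_PIdlE[OF w(3)])
  obtain u where u: "u \<in> carrier R" "i = u \<otimes> x" using iv(1) by (auto simp: PIdl_iff)
  note Pi = prime_is_ideal[OF P]
  have a0: "a \<noteq> \<zero>"
  proof
    assume "a = \<zero>"
    then have "s \<otimes> x = \<zero>" using s by simp
    then have "s = \<zero>" using x0 s xy integral by blast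
    then show False using s ideal_zero_mem[OF Pi] by simp
  qed
  have rq: "r \<notin> P \<or> q \<notin> P"
  proof (rule ccontr)
    assume "\<not> ?thesis"
    then have rq: "r \<in> P" "q \<in> P" by auto
    have "a \<otimes> (s \<otimes> (t \<otimes> w)) = (s \<otimes> t) \<otimes> (u \<otimes> x \<oplus> v \<otimes> y)"
      unfolding u(2)[symmetric] iv(3)[symmetric] using s(1,2) t(1,2) w(1,2) by (simp add: m_ac)
    also have "\<dots> = (u \<otimes> t) \<otimes> (s \<otimes> x) \<oplus> (v \<otimes> s) \<otimes> (t \<otimes> y)"
      using s(1,2) t(1,2) u(1) iv(2) xy by (simp add: r_distr m_ac)
    also have "\<dots> = a \<otimes> ((u \<otimes> t) \<otimes> r \<oplus> (v \<otimes> s) \<otimes> q)"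
      unfolding s(3) t(3) using s(1,2) t(1,2) u(1) iv(2) w(1,2) by (simp add: r_distr m_ac)
    finally have "s \<otimes> (t \<otimes> w) = (u \<otimes> t) \<otimes> r \<oplus> (v \<otimes> s) \<otimes> q"
      using m_lcancel[of a "s \<otimes> (t \<otimes> w)" "(u \<otimes> t) \<otimes> r \<oplus> (v \<otimes> s) \<otimes> q"] a0 s t u iv w by simp
    also have "\<dots> \<in> P"
      using rq s t u iv by (intro ideal_add_mem[OF Pi] ideal.I_l_closed[OF Pi]) auto
    finally show False
      using prime_mult_compl[OF P s(1) prime_mult_compl[OF P t(1) w(1)]] by simp
  qed
  have half: "y \<in> sat P (PIdl x)"
    if s: "s \<in> carrier R" "r \<in> carrier R - P" "s \<otimes> x = r \<otimes> a" and x: "x \<in> carrier R"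
      and t: "t \<in> carrier R - P" "q \<in> carrier R" "t \<otimes> y = q \<otimes> a" and y: "y \<in> carrier R" for x y s t r q
  proof -
    have "(r \<otimes> t) \<otimes> y = r \<otimes> (t \<otimes> y)" using s(2) t(1) y by (simp add: m_ac)
    also have "\<dots> = q \<otimes> (r \<otimes> a)" unfolding t(3) using s(2) t(2) w(2) by (simp add: m_ac)
    also have "\<dots> = (q \<otimes> s) \<otimes> x" unfolding s(3)[symmetric] using s(1) t(2) x by (simp add: m_ac)
    finally show ?thesis
      unfolding mem_sat_PIdl using prime_mult_compl[OF P s(2) t(1)] s(1) t(2) y by blast
  qed
  from rq show ?thesis
  proof
    assume "r \<notin> P"
    then show ?thesis using half[OF _ _ s(3) xy(1) t xy(2)] s by blast
  next
    assume "q \<notin> P"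
    then show ?thesis using half[OF _ _ t(3) xy(2) s xy(1)] t by blast
  qed
qed

text \<open>If \<open>z\<close> in \<open>N\<close> is locally \<open>r \<otimes> s\<close>,
  primeness moves the quotient \<open>r\<close> back into \<open>N\<close>.\<close>

lemma subprime_subset_sat_prod:
  assumes N: "primeideal N R" and s: "s \<in> carrier R - N" and sub: "N \<subseteq> sat P (PIdl s)"
  shows "N \<subseteq> sat P (N \<cdot> (PIdl s))"
proof
  fix z assume z: "z \<in> N"
  note Ni = prime_is_ideal[OF N]
  have "z \<in> sat P (PIdl s)" using sub z by blast
  then obtain t r where t: "t \<in> carrier R - P" "r \<in> carrier R" "t \<otimes> z = r \<otimes> s" "z \<in> carrier R"
    unfolding mem_sat_PIdl by blast
  have "r \<otimes> s \<in> N" unfolding t(3)[symmetric] using t(1) z ideal.I_l_closed[OF Ni] by blast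
  then have "r \<in> N" using primeideal.I_prime[OF N t(2)] s by blast
  then have "t \<otimes> z \<in> N \<cdot> (PIdl s)" using t(3) mem_prod_PIdl[OF Ni] s by blast
  then show "z \<in> sat P (N \<cdot> (PIdl s))" using t(1,4) by (auto intro: satI)
qed

end

section \<open>Localizations of Pruefer domains\<close>

context pruefer_domain
begin

text \<open>The ideal \<open>(x, y)\<close> is invertible, hence locally principal, so the argument
  for two generators applies: the localization at \<open>P\<close> is a valuation domain.\<close>

lemma pruefer_sat_cases:
  assumes P: "primeideal P R" and xy: "x \<in> carrier R" "y \<in> carrier R"
  shows "x \<in> sat P (PIdl y) \<or> y \<in> sat P (PIdl x)"
proof (cases "x = \<zero>")
  case True
  have "ideal (sat P (PIdl y)) R" using xy by (intro sat_ideal P cgenideal_ideal)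
  then show ?thesis using True ideal_zero_mem by blast
next
  case False
  let ?I = "PIdl x <+> PIdl y"
  have id: "ideal (PIdl x) R" "ideal (PIdl y) R" using xy by (auto intro: cgenideal_ideal)
  have x: "x \<in> ?I" using id xy cgenideal_self by (intro add_ideal_mem1) auto
  have y: "y \<in> ?I" using id xy cgenideal_self by (intro add_ideal_mem2) auto
  have "?I \<noteq> {\<zero>}" using x False by auto
  moreover have "fg_ideal R ?I" using xy by (intro fg_ideal_add fg_ideal_PIdl)
  ultimately have "invertible_ideal R ?I" by (intro fg_invertible)
  then obtain a where a: "a \<in> ?I" "?I \<subseteq> sat P (PIdl a)"
    using invertible_locally_principal[OF _ P] by blast
  have "a \<in> sat P ?I" using a(1) subset_sat[OF P add_ideals[OF id]] by blast
  then show ?thesis using two_generated_sat_cases[OF P xy False] a x y by blast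
qed

end

section \<open>ISP-domains are strongly discrete Pruefer domains\<close>

context cring
begin

text \<open>Used in contrapositive form: an element outside \<open>P\<close> stays outside when an
  element of \<open>P\<close> is subtracted. This replaces the fact that \<open>1 - q\<close> is a
  unit for \<open>q\<close> in the maximal ideal of a local ring.\<close>

lemma ideal_minus_memD:
  assumes I: "ideal I R" and y: "y \<in> I" and x: "x \<in> carrier R" and xy: "x \<ominus> y \<in> I"
  shows "x \<in> I"
proof -
  have "y \<in> carrier R" using y I ideal.Icarr by fast
  then have "(x \<ominus> y) \<oplus> y = x" using x by (simp add: a_minus_def a_assoc l_neg)
  then show ?thesis using ideal_add_mem[OF I xy y] by simp
qed

lemma radical_is_ideal: "radical_ideal R I \<Longrightarrow> ideal I R"
  by (simp add: radical_ideal_def)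

lemma radical_idealD:
  assumes I: "radical_ideal R I" and x: "x \<in> carrier R" and k: "x [^] (k::nat) \<in> I"
  shows "x \<in> I"
proof -
  \<comment> \<open>\<open>ideal_radical\<close> asks for a positive exponent; passing to
    \<open>Suc k\<close> covers \<open>k = 0\<close> as well.\<close>
  have "x [^] Suc k \<in> I"
    using k x ideal.I_r_closed[OF radical_is_ideal[OF I]] by simp
  then have "x \<in> ideal_radical R I" using x unfolding ideal_radical_def by blast
  then show ?thesis using I by (simp add: radical_ideal_def)
qed

lemma radical_idealI:
  assumes I: "ideal I R" and "\<And>x k. \<lbrakk>x \<in> carrier R; x [^] (k::nat) \<in> I\<rbrakk> \<Longrightarrow> x \<in> I"
  shows "radical_ideal R I"
proof -
  have "x \<in> ideal_radical R I" if x: "x \<in> I" for x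
  proof -
    have "x \<in> carrier R" using x I ideal.Icarr by fast
    then have "x [^] (1::nat) \<in> I" using x by simp
    then show ?thesis using \<open>x \<in> carrier R\<close> unfolding ideal_radical_def by (blast intro: zero_less_one)
  qed
  moreover have "ideal_radical R I \<subseteq> I" using assms(2) by (auto simp: ideal_radical_def)
  ultimately show ?thesis using I by (auto simp: radical_ideal_def)
qed

lemma prime_radical: "primeideal P R \<Longrightarrow> radical_ideal R P"
  by (rule radical_idealI) (auto intro: prime_is_ideal prime_pow_mem)

lemma sat_radical:
  assumes P: "primeideal P R" and I: "radical_ideal R I" shows "radical_ideal R (sat P I)"
proof (rule radical_idealI)
  note Ii = radical_is_ideal[OF I]
  show "ideal (sat P I) R" by (rule sat_ideal[OF P Ii])
  fix x k assume x: "x \<in> carrier R" "x [^] (k::nat) \<in> sat P I"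
  obtain s where s: "s \<in> carrier R - P" "s \<otimes> x [^] k \<in> I" using x(2) by (rule satE)
  \<comment> \<open>With the exponent \<open>Suc k\<close> the factor
    \<open>s \<otimes> x [^] k\<close> can be split off even for \<open>k = 0\<close>.\<close>
  have "(s \<otimes> x) [^] Suc k = (s [^] k \<otimes> x) \<otimes> (s \<otimes> x [^] k)"
    using s x by (simp add: nat_pow_distrib m_ac)
  also have "\<dots> \<in> I" using s x ideal.I_l_closed[OF Ii] by simp
  finally have "s \<otimes> x \<in> I" using radical_idealD[OF I] s x by blast
  then show "x \<in> sat P I" using s x by (auto intro: satI)
qed

text \<open>Together the inclusions say that the two products agree locally at \<open>P\<close>. The
  factors of a saturated ideal need be neither saturated nor below \<open>P\<close>; this is how
  they are brought into that shape.\<close>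

lemma list_prod_sat_filter:
  assumes P: "primeideal P R" and Qs: "\<And>Q. Q \<in> set Qs \<Longrightarrow> ideal Q R"
  defines "Qs' \<equiv> map (sat P) (filter (\<lambda>Q. Q \<subseteq> P) Qs)"
  shows "ideal_list_prod R Qs' \<subseteq> sat P (ideal_list_prod R Qs)"
    and "ideal_list_prod R Qs \<subseteq> ideal_list_prod R Qs'"
proof -
  have "ideal_list_prod R (map (sat P) (filter (\<lambda>Q. Q \<subseteq> P) Qs)) \<subseteq> sat P (ideal_list_prod R Qs) \<and>
    ideal_list_prod R Qs \<subseteq> ideal_list_prod R (map (sat P) (filter (\<lambda>Q. Q \<subseteq> P) Qs))"
    using Qs
  proof (induct Qs)
    case Nil
    then show ?case using subset_sat[OF P oneideal] by simp
  next
    case (Cons Q Qs)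
    let ?A = "ideal_list_prod R Qs" and ?B = "ideal_list_prod R (map (sat P) (filter (\<lambda>Q. Q \<subseteq> P) Qs))"
    have Q: "ideal Q R" using Cons by simp
    have A: "ideal ?A R" using Cons by (intro list_prod_ideal) auto
    have B: "ideal ?B R" using Cons P by (intro list_prod_ideal) (auto intro: sat_ideal)
    have IH: "?B \<subseteq> sat P ?A" "?A \<subseteq> ?B" using Cons by auto
    show ?case
    proof (cases "Q \<subseteq> P")
      case True
      have "sat P Q \<cdot> ?B \<subseteq> sat P (Q \<cdot> ?A)"
        using IH sat_ideal[OF P Q] B Q A by (intro sat_prod_subset[OF P]) auto
      moreover have "Q \<cdot> ?A \<subseteq> sat P Q \<cdot> ?B"
        using IH subset_sat[OF P Q] sat_ideal[OF P Q] B by (intro ideal_prod_mono)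
      ultimately show ?thesis using True by simp
    next
      case False
      have "?A \<subseteq> sat P (?A \<cdot> Q)" by (rule subset_sat_prod[OF A Q False])
      then have "sat P ?A \<subseteq> sat P (Q \<cdot> ?A)"
        using sat_least[OF P ideal_prod_is_ideal[OF Q A]] ideal_prod_commute[OF A Q] by simp
      then show ?thesis using False IH ideal_prod_subset_right[OF Q A] by auto
    qed
  qed
  then show "ideal_list_prod R Qs' \<subseteq> sat P (ideal_list_prod R Qs)"
    and "ideal_list_prod R Qs \<subseteq> ideal_list_prod R Qs'" by (simp_all add: Qs'_def)
qed

lemma list_prod_split:
  assumes "\<And>I. I \<in> set Is \<Longrightarrow> ideal I R" "I \<in> set Is"
  shows "\<exists>B. ideal B R \<and> ideal_list_prod R Is = I \<cdot> B"
  using assms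
proof (induct Is)
  case (Cons J Is)
  have J: "ideal J R" and Is: "ideal (ideal_list_prod R Is) R" using Cons by (auto intro: list_prod_ideal)
  show ?case
  proof (cases "I = J")
    case True
    then show ?thesis using Is by auto
  next
    case False
    then obtain B where B: "ideal B R" "ideal_list_prod R Is = I \<cdot> B" using Cons by auto
    have I: "ideal I R" using Cons by auto
    have "J \<cdot> (I \<cdot> B) = (J \<cdot> I) \<cdot> B" by (rule ideal_prod_assoc[OF J I B(1), symmetric])
    also have "\<dots> = (I \<cdot> J) \<cdot> B" by (simp only: ideal_prod_commute[OF J I])
    also have "\<dots> = I \<cdot> (J \<cdot> B)" by (rule ideal_prod_assoc[OF I J B(1)])
    finally show ?thesis using B ideal_prod_is_ideal[OF J B(1)] by auto
  qed
qed simp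

text \<open>The denominator hidden in \<open>sat\<close> may depend on the element of
  \<open>I\<close>, unlike in \<open>invertible_common_multiplier\<close>.\<close>

definition locally_principal :: "'a set \<Rightarrow> 'a set \<Rightarrow> bool" where
  "locally_principal P I \<longleftrightarrow> (\<exists>a\<in>I. I \<subseteq> sat P (PIdl a))"

lemma locally_principal_prod:
  assumes P: "primeideal P R" and I: "ideal I R" "locally_principal P I"
    and J: "ideal J R" "locally_principal P J"
  shows "locally_principal P (I \<cdot> J)"
proof -
  obtain a where a: "a \<in> I" "I \<subseteq> sat P (PIdl a)" using I by (auto simp: locally_principal_def)
  obtain b where b: "b \<in> J" "J \<subseteq> sat P (PIdl b)" using J by (auto simp: locally_principal_def)
  have c: "a \<in> carrier R" "b \<in> carrier R" using a b I J ideal.Icarr by fast+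
  have "I \<cdot> J \<subseteq> sat P ((PIdl a) \<cdot> (PIdl b))"
    using P I J a b c by (intro sat_prod_subset cgenideal_ideal)
  then have "I \<cdot> J \<subseteq> sat P (PIdl (a \<otimes> b))" using c by (simp add: PIdl_prod)
  then show ?thesis unfolding locally_principal_def using a b by (auto intro: ideal_prod.prod)
qed

lemma locally_principal_list_prod:
  assumes P: "primeideal P R" and "\<And>I. I \<in> set Is \<Longrightarrow> ideal I R \<and> locally_principal P I"
  shows "locally_principal P (ideal_list_prod R Is)"
  using assms(2)
proof (induct Is)
  case Nil
  have "x \<in> sat P (PIdl \<one>)" if "x \<in> carrier R" for x
    using that P by (auto simp: mem_sat_PIdl prime_one_notin intro!: bexI[of _ \<one>])
  then show ?case by (auto simp: locally_principal_def)
next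
  case (Cons I Is)
  then show ?case by (auto intro!: locally_principal_prod P list_prod_ideal)
qed

end

section \<open>Prime ideals of ISP-domains that are locally principal\<close>

context ISP_domain
begin

text \<open>Replacing the radical factors by the saturations of those below \<open>P\<close>
  squeezes the new product between \<open>sat P B\<close> and its saturation, which is
  \<open>sat P B\<close> again.\<close>

lemma ISP_local:
  assumes P: "primeideal P R" and B: "ideal B R" "B \<noteq> {\<zero>}" "B \<subseteq> P"
  obtains J Qs where "invertible_ideal R J" "ideal J R" "Qs \<noteq> []" "sat P B = J \<cdot> ideal_list_prod R Qs"
    "\<And>Q. Q \<in> set Qs \<Longrightarrow> radical_ideal R Q \<and> ideal Q R \<and> sat P Q = Q \<and> sat P B \<subseteq> Q \<and> Q \<subseteq> P"
proof -
  define I where "I = sat P B"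
  have I: "ideal I R" "I \<subseteq> P" "sat P I = I"
    unfolding I_def using sat_ideal[OF P B(1)] sat_subset_prime[OF P subset_refl B(3)] sat_idem[OF P B(1)] by auto
  have I0: "I \<noteq> {\<zero>}"
    unfolding I_def using subset_sat[OF P B(1)] B(2) ideal_zero_mem[OF B(1)] by blast
  have Ic: "I \<noteq> carrier R" using I(2) prime_one_notin[OF P] by auto
  obtain J Qs where J: "invertible_ideal R J" and Qs: "Qs \<noteq> []"
    and rad: "\<And>Q. Q \<in> set Qs \<Longrightarrow> radical_ideal R Q \<and> Q \<noteq> carrier R"
    and eq: "I = J \<cdot> ideal_list_prod R Qs"
    using ISP[OF I(1) I0 Ic] by blast
  define Qs' where "Qs' = map (sat P) (filter (\<lambda>Q. Q \<subseteq> P) Qs)"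
  note Ji = invertible_is_ideal[OF J]
  have Qi: "\<And>Q. Q \<in> set Qs \<Longrightarrow> ideal Q R" using rad radical_is_ideal by blast
  let ?A = "ideal_list_prod R Qs" and ?C = "ideal_list_prod R Qs'"
  have A: "ideal ?A R" using Qi by (rule list_prod_ideal)
  have Q'i: "\<And>Q. Q \<in> set Qs' \<Longrightarrow> ideal Q R" using Qi P by (auto simp: Qs'_def intro: sat_ideal)
  then have C: "ideal ?C R" by (rule list_prod_ideal)
  have sub: "?C \<subseteq> sat P ?A" "?A \<subseteq> ?C"
    unfolding Qs'_def using list_prod_sat_filter[OF P Qi] by auto
  have "J \<cdot> ?C \<subseteq> sat P (J \<cdot> ?A)"
    using subset_sat[OF P Ji] sub Ji A C by (intro sat_prod_subset[OF P])
  then have "J \<cdot> ?C \<subseteq> I" using eq I by simp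
  moreover have "J \<cdot> ?A \<subseteq> J \<cdot> ?C" by (rule ideal_prod_mono[OF subset_refl sub(2) Ji C])
  ultimately have eq': "I = J \<cdot> ?C" using eq by simp
  \<comment> \<open>Without factors below \<open>P\<close> the ideal would equal \<open>J\<close>,
    and cancelling \<open>J\<close> would make a product of proper ideals the whole ring.\<close>
  have "Qs' \<noteq> []"
  proof
    assume "Qs' = []"
    then have "J \<cdot> carrier R \<subseteq> J \<cdot> ?A" using eq eq' by simp
    then have "carrier R \<subseteq> ?A" by (rule invertible_cancel[OF J oneideal A])
    moreover have "?A \<subseteq> hd Qs" using Qs Qi by (intro list_prod_subset_mem) auto
    ultimately show False using rad[of "hd Qs"] Qs ideal_subset_carrier[OF Qi[of "hd Qs"]] by auto
  qed
  moreover have "radical_ideal R Q \<and> ideal Q R \<and> sat P Q = Q \<and> I \<subseteq> Q \<and> Q \<subseteq> P" if Q: "Q \<in> set Qs'" for Q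
  proof -
    obtain T where T: "T \<in> set Qs" "T \<subseteq> P" "Q = sat P T" using Q by (auto simp: Qs'_def)
    have "I \<subseteq> ?C" unfolding eq' by (rule ideal_prod_subset_right[OF Ji C])
    also have "\<dots> \<subseteq> Q" using Q'i Q by (rule list_prod_subset_mem)
    finally show ?thesis
      using T rad Q'i[OF Q] sat_radical[OF P, of T] sat_idem[OF P Qi[OF T(1)]]
        sat_subset_prime[OF P subset_refl T(2)] by auto
  qed
  ultimately show thesis using that[OF J Ji] eq' unfolding I_def by blast
qed

text \<open>An ideal containing an element outside \<open>P\<^sup>2\<close> locally admits only a single radical factor.
  Applied to \<open>(p\<^sup>2, \<pi>)\<close> this gives \<open>p \<in> (p\<^sup>2, \<pi>)\<close>, and hence \<open>p \<in> (\<pi>)\<close>, locally at \<open>P\<close>.\<close>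

lemma prime_principal_of_not_square:
  assumes P: "primeideal P R" and pi: "\<pi> \<in> P" "\<pi> \<notin> sat P (P \<cdot> P)"
  shows "P = sat P (PIdl \<pi>)"
proof
  note Pi = prime_is_ideal[OF P]
  have pic: "\<pi> \<in> carrier R" using pi Pi ideal.Icarr by fast
  have PP: "ideal (P \<cdot> P) R" using Pi by (intro ideal_prod_is_ideal)
  show "sat P (PIdl \<pi>) \<subseteq> P"
    using pi pic Pi by (intro sat_subset_prime[OF P]) (auto simp: PIdl_subset_iff)
  show "P \<subseteq> sat P (PIdl \<pi>)"
  proof
    fix p assume p: "p \<in> P"
    then have pc: "p \<in> carrier R" using Pi ideal.Icarr by fast
    let ?B = "PIdl (p \<otimes> p) <+> PIdl \<pi>"
    have gi: "ideal (PIdl (p \<otimes> p)) R" "ideal (PIdl \<pi>) R" using pc pic by (auto intro: cgenideal_ideal)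
    then have Bi: "ideal ?B R" by (rule add_ideals)
    have mB: "p \<otimes> p \<in> ?B" "\<pi> \<in> ?B"
      using gi pc pic cgenideal_self by (auto intro: add_ideal_mem1 add_ideal_mem2)
    have BP: "?B \<subseteq> P"
    proof (rule add_ideal_subset[OF Pi])
      show "PIdl (p \<otimes> p) \<subseteq> P" using p pc Pi by (simp add: PIdl_subset_iff ideal.I_l_closed)
      show "PIdl \<pi> \<subseteq> P" using pi pic Pi by (simp add: PIdl_subset_iff)
    qed
    define I where "I = sat P ?B"
    have mI: "p \<otimes> p \<in> I" "\<pi> \<in> I" using mB subset_sat[OF P Bi] by (auto simp: I_def)
    have piPP: "\<pi> \<notin> P \<cdot> P" using pi subset_sat[OF P PP] by auto
    have B0: "?B \<noteq> {\<zero>}" using mB piPP ideal_zero_mem[OF PP] by auto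
    obtain J Qs where Ji: "ideal J R" and ne: "Qs \<noteq> []" and eq: "I = J \<cdot> ideal_list_prod R Qs"
      and Qs: "\<And>Q. Q \<in> set Qs \<Longrightarrow> radical_ideal R Q \<and> ideal Q R \<and> sat P Q = Q \<and> I \<subseteq> Q \<and> Q \<subseteq> P"
      using ISP_local[OF P Bi B0 BP] unfolding I_def by metis
    obtain Q Qr where Qr: "Qs = Q # Qr" using ne by (cases Qs) auto
    have Q: "radical_ideal R Q" "ideal Q R" "sat P Q = Q" "I \<subseteq> Q" "Q \<subseteq> P" using Qs[of Q] Qr by auto
    have sub: "ideal_list_prod R Qs \<subseteq> Q" unfolding Qr using Qs Qr by (intro list_prod_subset_mem) auto
    have Li: "ideal (ideal_list_prod R Qs) R" using Qs by (intro list_prod_ideal) auto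
    have nJ: "\<not> J \<subseteq> P"
    proof
      assume "J \<subseteq> P"
      then have "I \<subseteq> P \<cdot> P" unfolding eq using sub Q(5) Pi by (intro ideal_prod_mono) auto
      then show False using mI piPP by blast
    qed
    have "Qr = []"
    proof (rule ccontr)
      assume "Qr \<noteq> []"
      then have "ideal_list_prod R Qr \<subseteq> hd Qr" using Qs Qr by (intro list_prod_subset_mem) auto
      also have "\<dots> \<subseteq> P" using Qs[of "hd Qr"] Qr \<open>Qr \<noteq> []\<close> by auto
      finally have "ideal_list_prod R Qs \<subseteq> P \<cdot> P"
        unfolding Qr using Q(5) Pi by (simp add: ideal_prod_mono)
      moreover have "I \<subseteq> ideal_list_prod R Qs" unfolding eq by (rule ideal_prod_subset_right[OF Ji Li])
      ultimately show False using mI piPP by blast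
    qed
    then have IJQ: "I = J \<cdot> Q" using eq Qr ideal_prod_one[OF Q(2)] by simp
    have "Q \<subseteq> sat P (Q \<cdot> J)" by (rule subset_sat_prod[OF Q(2) Ji nJ])
    then have "Q \<subseteq> I" using IJQ sat_idem[OF P Bi] I_def ideal_prod_commute[OF Q(2) Ji] by simp
    then have "p [^] (2::nat) \<in> Q" using mI(1) Q(4) pc by (auto simp: numeral_2_eq_2)
    then have "p \<in> I" using radical_idealD[OF Q(1) pc] \<open>Q \<subseteq> I\<close> by blast
    then obtain s where s: "s \<in> carrier R - P" "s \<otimes> p \<in> ?B" unfolding I_def by (rule satE)
    obtain i v where iv: "i \<in> PIdl (p \<otimes> p)" "v \<in> carrier R" "s \<otimes> p = i \<oplus> v \<otimes> \<pi>"
      by (rule add_PIdlE[OF s(2)])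
    obtain r where r: "r \<in> carrier R" "i = r \<otimes> (p \<otimes> p)" using iv(1) by (auto simp: PIdl_iff)
    \<comment> \<open>Collecting the multiples of \<open>p\<close> leaves the coefficient
      \<open>s \<ominus> r \<otimes> p\<close>, which is outside \<open>P\<close> because
      \<open>s\<close> is.\<close>
    have "(s \<ominus> r \<otimes> p) \<otimes> p = v \<otimes> \<pi>"
    proof -
      have "(s \<ominus> r \<otimes> p) \<otimes> p = s \<otimes> p \<ominus> r \<otimes> (p \<otimes> p)"
        using s(1) r(1) pc by (simp add: a_minus_def l_distr r_distr l_minus r_minus m_ac)
      also have "\<dots> = v \<otimes> \<pi> \<oplus> (i \<oplus> \<ominus> i)"
        unfolding iv(3) r(2)[symmetric] using iv(2) pic r pc by (simp add: a_minus_def a_ac)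
      also have "\<dots> = v \<otimes> \<pi>" using iv(2) pic r pc by (simp add: r_neg)
      finally show ?thesis .
    qed
    moreover have "s \<ominus> r \<otimes> p \<in> carrier R - P"
    proof -
      have rp: "r \<otimes> p \<in> P" using r p ideal.I_l_closed[OF Pi] by blast
      then have "s \<ominus> r \<otimes> p \<notin> P" using ideal_minus_memD[OF Pi rp] s(1) by blast
      then show ?thesis using s r pc by simp
    qed
    ultimately show "p \<in> sat P (PIdl \<pi>)" unfolding mem_sat_PIdl using pc iv by blast
  qed
qed

text \<open>Suppose \<open>P\<close> were idempotent locally. By minimality every radical factor of
  the saturation \<open>I\<close> of \<open>N + (x)\<close> is \<open>P\<close>, and extra factors
  \<open>P\<close> cost nothing, so \<open>I = I P\<close> locally. Modulo \<open>N\<close> the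
  single generator is \<open>x\<close>, so Nakayama's argument would put \<open>x\<close> into
  \<open>N\<close>. Hence some \<open>\<pi>\<close> lies outside the local square of
  \<open>P\<close>.\<close>

lemma minimal_over_prime_principal:
  assumes N: "primeideal N R" and x: "x \<in> carrier R" "x \<notin> N"
    and P: "P \<in> minimal_primes R (N <+> PIdl x)"
  obtains \<pi> where "\<pi> \<in> P" "P = sat P (PIdl \<pi>)"
proof -
  note Pp = minimal_primesD(1)[OF P]
  note Pi = prime_is_ideal[OF Pp] and Ni = prime_is_ideal[OF N]
  have xi: "ideal (PIdl x) R" using x by (intro cgenideal_ideal)
  let ?B = "N <+> PIdl x"
  have Bi: "ideal ?B R" by (rule add_ideals[OF Ni xi])
  have BP: "?B \<subseteq> P" by (rule minimal_primesD(2)[OF P])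
  have NB: "N \<subseteq> ?B" and xB: "x \<in> ?B"
    using Ni xi x cgenideal_self by (auto intro: add_ideal_mem1 add_ideal_mem2)
  have "\<not> P \<subseteq> sat P (P \<cdot> P)"
  proof
    assume idem: "P \<subseteq> sat P (P \<cdot> P)"
    define I where "I = sat P ?B"
    have BI: "?B \<subseteq> I" unfolding I_def by (rule subset_sat[OF Pp Bi])
    have xI: "x \<in> I" using xB BI by blast
    have B0: "?B \<noteq> {\<zero>}" using xB x ideal_zero_mem[OF Ni] by auto
    obtain J Qs where Ji: "ideal J R" and ne: "Qs \<noteq> []" and eq: "I = J \<cdot> ideal_list_prod R Qs"
      and Qs: "\<And>Q. Q \<in> set Qs \<Longrightarrow> radical_ideal R Q \<and> ideal Q R \<and> sat P Q = Q \<and> I \<subseteq> Q \<and> Q \<subseteq> P"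
      using ISP_local[OF Pp Bi B0 BP] unfolding I_def by metis
    have QP: "Q = P" if Q: "Q \<in> set Qs" for Q
    proof
      show "Q \<subseteq> P" using Qs[OF Q] by simp
      show "P \<subseteq> Q"
      proof
        fix p assume p: "p \<in> P"
        then have pc: "p \<in> carrier R" using Pi ideal.Icarr by fast
        obtain s k where s: "s \<in> carrier R - P" "s \<otimes> p [^] (k::nat) \<in> ?B"
          by (rule minimal_prime_power[OF P Bi p])
        then have "s \<otimes> p [^] k \<in> Q" using BI Qs[OF Q] by blast
        then have "p [^] k \<in> sat P Q" using s(1) pc by (auto intro: satI)
        then show "p \<in> Q" using Qs[OF Q] radical_idealD[OF _ pc] by auto
      qed
    qed
    \<comment> \<open>By idempotence a nonempty product of copies of \<open>P\<close> is locally
      \<open>P\<close> itself.\<close>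
    have pow: "P \<subseteq> sat P (ideal_list_prod R Qs)"
      using ne QP
    proof (induct Qs rule: list_nonempty_induct)
      case (single Q)
      then show ?case using subset_sat[OF Pp Pi] ideal_prod_one[OF Pi] by simp
    next
      case (cons Q Qs)
      then have Q: "Q = P" and Li: "ideal (ideal_list_prod R Qs) R"
        using Pi by (auto intro!: list_prod_ideal)
      have "P \<cdot> P \<subseteq> sat P (P \<cdot> ideal_list_prod R Qs)"
        using cons Pi Li subset_sat[OF Pp Pi] by (intro sat_prod_subset[OF Pp]) auto
      then have "sat P (P \<cdot> P) \<subseteq> sat P (P \<cdot> ideal_list_prod R Qs)"
        by (rule sat_least[OF Pp ideal_prod_is_ideal[OF Pi Li]])
      then show ?case using idem Q by simp
    qed
    have Li: "ideal (ideal_list_prod R Qs) R" using Qs by (intro list_prod_ideal) auto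
    have JP: "J \<cdot> P \<subseteq> I"
    proof -
      have "J \<cdot> P \<subseteq> sat P (J \<cdot> ideal_list_prod R Qs)"
        by (rule sat_prod_subset[OF Pp Ji Pi Ji Li subset_sat[OF Pp Ji] pow])
      then show ?thesis using eq sat_idem[OF Pp Bi] I_def by simp
    qed
    let ?D = "N <+> P \<cdot> (PIdl x)"
    have Pxi: "ideal (P \<cdot> (PIdl x)) R" by (rule ideal_prod_is_ideal[OF Pi xi])
    have Di: "ideal ?D R" by (rule add_ideals[OF Ni Pxi])
    have PP: "ideal (P \<cdot> P) R" and JPi: "ideal (J \<cdot> P) R" and BPi: "ideal (?B \<cdot> P) R"
      using Ji Pi Bi by (auto intro: ideal_prod_is_ideal)
    \<comment> \<open>Locally, \<open>I \<subseteq> J P = J P P \<subseteq> (N + (x)) P \<subseteq>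
      N + P x\<close>.\<close>
    have "I \<subseteq> J \<cdot> P"
      unfolding eq
    proof (rule ideal_prod_mono[OF subset_refl _ Ji Pi])
      show "ideal_list_prod R Qs \<subseteq> P"
        using list_prod_subset_mem[of Qs "hd Qs"] Qs ne QP[of "hd Qs"] by auto
    qed
    also have "J \<cdot> P \<subseteq> sat P (J \<cdot> (P \<cdot> P))"
      by (rule sat_prod_subset[OF Pp Ji Pi Ji PP subset_sat[OF Pp Ji] idem])
    also have "J \<cdot> (P \<cdot> P) = (J \<cdot> P) \<cdot> P" by (rule ideal_prod_assoc[OF Ji Pi Pi, symmetric])
    also have "sat P \<dots> \<subseteq> sat P (?B \<cdot> P)"
      using JP unfolding I_def by (intro sat_least[OF Pp BPi] sat_prod_subset[OF Pp JPi Pi Bi Pi _ subset_sat[OF Pp Pi]])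
    also have "?B \<cdot> P = N \<cdot> P <+> (PIdl x) \<cdot> P" by (rule ideal_prod_distr(2)[OF Pi Ni xi])
    also have "sat P \<dots> \<subseteq> sat P ?D"
      using add_ideal_mem1[OF Ni Pxi] add_ideal_mem2[OF Ni Pxi] ideal_prod_subset_left[OF Ni Pi]
        ideal_prod_commute[OF xi Pi] by (intro sat_mono add_ideal_subset[OF Di]) auto
    finally have "x \<in> sat P ?D" using xI by blast
    then obtain w where w: "w \<in> carrier R - P" "w \<otimes> x \<in> ?D" by (rule satE)
    obtain n y where ny: "n \<in> N" "y \<in> P \<cdot> (PIdl x)" "w \<otimes> x = n \<oplus> y" by (rule add_idealE[OF w(2)])
    obtain q where q: "q \<in> P" "y = q \<otimes> x" using ny(2) mem_prod_PIdl[OF Pi x(1)] by blast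
    have qc: "q \<in> carrier R" and nc: "n \<in> carrier R" using q ny Pi Ni ideal.Icarr by fast+
    have wc: "w \<in> carrier R" using w by simp
    have "(w \<ominus> q) \<otimes> x = w \<otimes> x \<ominus> y"
      unfolding q(2) using wc qc x(1) by (simp add: a_minus_def l_distr l_minus)
    also have "\<dots> = n \<oplus> (y \<oplus> \<ominus> y)"
      unfolding ny(3) using nc q(2) qc x(1) by (simp add: a_minus_def a_assoc)
    also have "\<dots> = n" using nc q(2) qc x(1) by (simp add: r_neg)
    finally have "(w \<ominus> q) \<otimes> x \<in> N" using ny(1) by simp
    then have "w \<ominus> q \<in> N" using primeideal.I_prime[OF N, of "w \<ominus> q" x] wc qc x by auto
    then have "w \<ominus> q \<in> P" using NB BP by blast
    then have "w \<in> P" using ideal_minus_memD[OF Pi q(1) wc] by blast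
    then show False using w by simp
  qed
  then obtain \<pi> where "\<pi> \<in> P" "\<pi> \<notin> sat P (P \<cdot> P)" by blast
  then show thesis using that prime_principal_of_not_square[OF Pp] by blast
qed

text \<open>Otherwise take a prime \<open>N1\<close> over \<open>Q\<close> missing some
  \<open>y\<close> in \<open>P\<close>, and a prime \<open>N\<close> minimal over
  \<open>N1 + (y)\<close>, with local generator \<open>\<pi>\<close>. At \<open>N\<close> one has
  \<open>q = r \<pi>\<close>, and \<open>r\<close> lies in \<open>N1\<close> since
  \<open>\<pi>\<close> does not. Every prime below \<open>N\<close> that contains \<open>q\<close>
  contains \<open>r\<close>: it contains \<open>r\<close> or \<open>\<pi>\<close>, and in the second
  case all of \<open>N\<close>. As \<open>Q\<close> is radical, \<open>r\<close> is therefore a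
  multiple of \<open>q\<close>, and \<open>\<pi>\<close> would be a unit at
  \<open>N\<close>.\<close>

lemma radical_locally_principal_eq:
  assumes P: "primeideal P R" and Q: "radical_ideal R Q" "Q \<subseteq> P" and q: "q \<in> carrier R" "q \<noteq> \<zero>"
    and eq: "Q = sat P (PIdl q)"
  shows "Q = P"
proof (rule ccontr)
  assume "Q \<noteq> P"
  then obtain y where y: "y \<in> P" "y \<notin> Q" using Q by blast
  note Pi = prime_is_ideal[OF P] and Qi = radical_is_ideal[OF Q(1)]
  have qi: "ideal (PIdl q) R" using q by (intro cgenideal_ideal)
  have yc: "y \<in> carrier R" using y Pi ideal.Icarr by fast
  have no: "s \<otimes> y [^] (k::nat) \<notin> Q" if s: "s \<in> carrier R - P" for s k
  proof
    assume "s \<otimes> y [^] k \<in> Q"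
    then have "y [^] k \<in> sat P Q" using s yc by (auto intro: satI)
    then have "y [^] k \<in> Q" unfolding eq using sat_idem[OF P qi] by simp
    then show False using radical_idealD[OF Q(1) yc] y by blast
  qed
  obtain N1 where N1: "primeideal N1 R" "Q \<subseteq> N1" "N1 \<subseteq> P" "y \<notin> N1"
    using prime_ge_notin[OF P Qi yc no] by metis
  note N1i = prime_is_ideal[OF N1(1)]
  note yi = cgenideal_ideal[OF yc]
  have "N1 <+> PIdl y \<subseteq> P" using N1 y yc Pi by (intro add_ideal_subset) (auto simp: PIdl_subset_iff)
  then obtain N where N: "N \<in> minimal_primes R (N1 <+> PIdl y)" "N \<subseteq> P" using minimal_prime_le[OF P] by blast
  note Np = minimal_primesD(1)[OF N(1)]
  note Ni = prime_is_ideal[OF Np]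
  obtain \<pi> where pi: "\<pi> \<in> N" "N = sat N (PIdl \<pi>)"
    using minimal_over_prime_principal[OF N1(1) yc N1(4) N(1)] by blast
  have pic: "\<pi> \<in> carrier R" using pi(1) Ni ideal.Icarr by fast
  have N1N: "N1 \<subseteq> N" and yN: "y \<in> N"
    using minimal_primesD(2)[OF N(1)] add_ideal_mem1[OF N1i yi] add_ideal_mem2[OF N1i yi cgenideal_self[OF yc]]
    by auto
  have NL: "N \<subseteq> L" if "primeideal L R" "L \<subseteq> N" "\<pi> \<in> L" for L
  proof -
    have "PIdl \<pi> \<subseteq> L" using that pic prime_is_ideal by (simp add: PIdl_subset_iff)
    then show ?thesis using pi(2) sat_subset_prime[OF that(1,2)] by blast
  qed
  have qQ: "q \<in> Q" unfolding eq using subset_sat[OF P qi] cgenideal_self[OF q(1)] by blast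
  have "q \<in> sat N (PIdl \<pi>)" using qQ N1 N1N pi(2) by blast
  then obtain s r where sr: "s \<in> carrier R - N" "r \<in> carrier R" "s \<otimes> q = r \<otimes> \<pi>"
    unfolding mem_sat_PIdl by blast
  have "r \<otimes> \<pi> \<in> N1" unfolding sr(3)[symmetric] using sr(1) qQ N1(2) ideal.I_l_closed[OF N1i] by auto
  then have rN1: "r \<in> N1"
    using primeideal.I_prime[OF N1(1), of r \<pi>] sr(2) pic NL[OF N1(1) N1N] yN N1(4) by blast
  have "\<exists>s k. s \<in> carrier R - N \<and> s \<otimes> r [^] (k::nat) \<in> PIdl q"
  proof (rule ccontr)
    assume "\<not> ?thesis"
    then have no: "\<And>s k. s \<in> carrier R - N \<Longrightarrow> s \<otimes> r [^] (k::nat) \<notin> PIdl q" by blast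
    obtain L where L: "primeideal L R" "PIdl q \<subseteq> L" "L \<subseteq> N" "r \<notin> L"
      using prime_ge_notin[OF Np qi sr(2) no] by metis
    have "q \<in> L" using L(2) cgenideal_self[OF q(1)] by blast
    then have "r \<otimes> \<pi> \<in> L"
      unfolding sr(3)[symmetric] using sr(1) ideal.I_l_closed[OF prime_is_ideal[OF L(1)]] by auto
    then have "\<pi> \<in> L" using primeideal.I_prime[OF L(1), of r \<pi>] sr(2) pic L(4) by blast
    then show False using NL[OF L(1,3)] rN1 N1N L(4) by blast
  qed
  then obtain s' k where s': "s' \<in> carrier R - N" "s' \<otimes> r [^] (k::nat) \<in> PIdl q" by blast
  have "s' \<otimes> r [^] k \<in> Q" using s'(2) subset_sat[OF P qi] unfolding eq by blast
  then have "r [^] k \<in> sat N Q" using s'(1) sr(2) by (auto intro: satI)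
  then have "r \<in> sat N Q" by (rule radical_idealD[OF sat_radical[OF Np Q(1)] sr(2)])
  then have "r \<in> sat N (PIdl q)" unfolding eq using sat_sat[OF P Np N(2) qi] by simp
  then obtain t w where tw: "t \<in> carrier R - N" "w \<in> carrier R" "t \<otimes> r = w \<otimes> q"
    unfolding mem_sat_PIdl by blast
  have "q \<otimes> (t \<otimes> s) = t \<otimes> (s \<otimes> q)" using tw(1) sr(1) q(1) by (simp add: m_ac)
  also have "\<dots> = (t \<otimes> r) \<otimes> \<pi>" unfolding sr(3) using tw(1) sr(2) pic by (simp add: m_ac)
  also have "\<dots> = q \<otimes> (w \<otimes> \<pi>)" unfolding tw(3) using tw(2) q(1) pic by (simp add: m_ac)
  finally have "t \<otimes> s = w \<otimes> \<pi>"
    using m_lcancel[of q "t \<otimes> s" "w \<otimes> \<pi>"] q tw(1,2) sr(1) pic by simp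
  also have "\<dots> \<in> N" using tw(2) pi(1) ideal.I_l_closed[OF Ni] by blast
  finally show False using prime_mult_compl[OF Np tw(1) sr(1)] by simp
qed

end

section \<open>Local divisibility and a local criterion for Pruefer domains\<close>

context domain
begin

lemma nat_pow_nonzero: "\<lbrakk>a \<in> carrier R; a \<noteq> \<zero>\<rbrakk> \<Longrightarrow> a [^] (k::nat) \<noteq> \<zero>"
  by (induct k) (auto simp: integral_iff)

lemma mem_sat_zero: "\<lbrakk>primeideal P R; x \<in> sat P (PIdl \<zero>)\<rbrakk> \<Longrightarrow> x = \<zero>"
  using ideal_zero_mem[OF prime_is_ideal] by (auto simp: mem_sat_PIdl integral_iff)

text \<open>A prime strictly below \<open>N\<close> misses the generator \<open>\<pi>\<close>, so
  quotients by \<open>\<pi>\<close> of its elements stay in it and the division can be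
  repeated.\<close>

lemma strict_subprime_divisible:
  assumes N: "primeideal N R" and pi: "\<pi> \<in> N" "N = sat N (PIdl \<pi>)"
    and L: "primeideal L R" "L \<subseteq> N" "L \<noteq> N" and x: "x \<in> L"
  shows "\<exists>t\<in>carrier R - N. \<exists>y\<in>L. t \<otimes> x = y \<otimes> \<pi> [^] (k::nat)"
proof -
  note Li = prime_is_ideal[OF L(1)]
  have pic: "\<pi> \<in> carrier R" using pi(1) ideal.Icarr[OF prime_is_ideal[OF N]] by blast
  note xc = ideal.Icarr[OF Li x]
  have piL: "\<pi> \<notin> L"
  proof
    assume "\<pi> \<in> L"
    then have "sat N (PIdl \<pi>) \<subseteq> L" using pic Li L by (intro sat_subset_prime) (auto simp: PIdl_subset_iff)
    then show False using pi(2) L by blast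
  qed
  show ?thesis
  proof (induct k)
    case 0
    then show ?case using x xc prime_one_compl[OF N] by (intro bexI[of _ \<one>] bexI[of _ x]) auto
  next
    case (Suc k)
    then obtain t y where t: "t \<in> carrier R - N" "y \<in> L" "t \<otimes> x = y \<otimes> \<pi> [^] k" by blast
    note yc = ideal.Icarr[OF Li t(2)]
    have "y \<in> sat N (PIdl \<pi>)" using t(2) L(2) pi(2) by blast
    then obtain s r where s: "s \<in> carrier R - N" "r \<in> carrier R" "s \<otimes> y = r \<otimes> \<pi>"
      unfolding mem_sat_PIdl by blast
    have "r \<otimes> \<pi> \<in> L" unfolding s(3)[symmetric] using s(1) t(2) ideal.I_l_closed[OF Li] by auto
    then have r: "r \<in> L" using primeideal.I_prime[OF L(1), of r \<pi>] s(2) pic piL by blast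
    have "(s \<otimes> t) \<otimes> x = s \<otimes> (t \<otimes> x)" using s(1) t(1) xc by (simp add: m_ac)
    also have "\<dots> = (s \<otimes> y) \<otimes> \<pi> [^] k" unfolding t(3) using s(1) yc pic by (simp add: m_ac)
    also have "\<dots> = r \<otimes> \<pi> [^] Suc k" unfolding s(3) using s(2) pic by (simp add: m_ac)
    finally show ?case using r prime_mult_compl[OF N s(1) t(1)] by blast
  qed
qed

text \<open>Local divisibility is a total preorder here, so finitely many elements include one that
  divides them all.\<close>

lemma finite_sat_maximum:
  assumes P: "primeideal P R" and cases: "\<And>x y. \<lbrakk>x \<in> carrier R; y \<in> carrier R\<rbrakk> \<Longrightarrow>
      x \<in> sat P (PIdl y) \<or> y \<in> sat P (PIdl x)"
    and S: "finite S" "S \<noteq> {}" "S \<subseteq> carrier R"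
  shows "\<exists>a\<in>S. S \<subseteq> sat P (PIdl a)"
  using S
proof (induct rule: finite_ne_induct)
  case (singleton x)
  then show ?case using subset_sat[OF P cgenideal_ideal, of x] cgenideal_self[of x] by auto
next
  case (insert x S)
  then obtain a where a: "a \<in> S" "S \<subseteq> sat P (PIdl a)" by auto
  have c: "a \<in> carrier R" "x \<in> carrier R" using a insert by auto
  have self: "x \<in> sat P (PIdl x)" using subset_sat[OF P cgenideal_ideal, of x] cgenideal_self[of x] c by auto
  show ?case
  proof (cases "x \<in> sat P (PIdl a)")
    case True
    then show ?thesis using a by auto
  next
    case False
    then have "a \<in> sat P (PIdl x)" using cases c by blast
    then have "PIdl a \<subseteq> sat P (PIdl x)"
      using c PIdl_subset_iff[OF sat_ideal[OF P cgenideal_ideal]] by blast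
    then have "sat P (PIdl a) \<subseteq> sat P (PIdl x)" by (rule sat_least[OF P cgenideal_ideal[OF c(2)]])
    then show ?thesis using a self by auto
  qed
qed

text \<open>At each maximal ideal one generator divides the others, and finite generation provides
  the uniform multiplier that \<open>locally_principal_invertible\<close> asks for.\<close>

lemma pruefer_domainI:
  assumes cases: "\<And>P x y. \<lbrakk>primeideal P R; x \<in> carrier R; y \<in> carrier R\<rbrakk> \<Longrightarrow>
      x \<in> sat P (PIdl y) \<or> y \<in> sat P (PIdl x)"
  shows "pruefer_domain R"
proof
  fix I assume fg: "fg_ideal R I" and I0: "I \<noteq> {\<zero>}"
  obtain S where S: "finite S" "S \<subseteq> carrier R" "I = Idl S" using fg by (auto simp: fg_ideal_def)
  have Ii: "ideal I R" by (rule fg_ideal_is_ideal[OF fg])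
  have "S \<noteq> {}"
  proof
    assume "S = {}"
    then have "I \<subseteq> {\<zero>}" unfolding S(3) using zeroideal by (intro genideal_minimal) auto
    then show False using I0 ideal_zero_mem[OF Ii] by blast
  qed
  show "invertible_ideal R I"
  proof (rule locally_principal_invertible[OF Ii I0])
    fix M assume M: "maximalideal M R"
    note P = maximalideal_prime[OF M]
    obtain a where a: "a \<in> S" "S \<subseteq> sat M (PIdl a)"
      using finite_sat_maximum[OF P cases[OF P] S(1) \<open>S \<noteq> {}\<close> S(2)] by blast
    have ac: "a \<in> carrier R" using a S by blast
    have sub: "I \<subseteq> sat M (PIdl a)"
      unfolding S(3) by (rule genideal_minimal[OF sat_ideal[OF P cgenideal_ideal[OF ac]] a(2)])
    obtain s where "s \<in> carrier R - M" "\<And>x. x \<in> I \<Longrightarrow> s \<otimes> x \<in> PIdl a"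
      using fg_ideal_sat_common[OF fg P cgenideal_ideal[OF ac] sub] by metis
    moreover have "a \<in> I" using a S genideal_self by blast
    ultimately show "\<exists>a\<in>I. \<exists>s\<in>carrier R - M. \<forall>x\<in>I. s \<otimes> x \<in> PIdl a" by blast
  qed
qed

end

section \<open>ISP-domains are locally valuation domains\<close>

context ISP_domain
begin

text \<open>A factor of a nonzero principal ideal is locally principal. Applied to a radical factor
  of the saturation of \<open>(x)\<close>, this meets the hypothesis of
  \<open>radical_locally_principal_eq\<close>.\<close>

lemma prime_locally_principal:
  assumes P: "primeideal P R" "P \<noteq> {\<zero>}"
  obtains \<pi> where "\<pi> \<in> P" "P = sat P (PIdl \<pi>)" "\<pi> \<noteq> \<zero>"
proof -
  note Pi = prime_is_ideal[OF P(1)]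
  obtain x where x: "x \<in> P" "x \<noteq> \<zero>" using P ideal_zero_mem[OF Pi] by blast
  note xc = ideal.Icarr[OF Pi x(1)]
  note xi = cgenideal_ideal[OF xc]
  define I where "I = sat P (PIdl x)"
  have xI: "x \<in> I" unfolding I_def using subset_sat[OF P(1) xi] cgenideal_self[OF xc] by blast
  have xP: "PIdl x \<subseteq> P" using x xc Pi by (simp add: PIdl_subset_iff)
  have x0: "PIdl x \<noteq> {\<zero>}" using cgenideal_self[OF xc] x(2) by (metis singletonD)
  obtain J Qs where Ji: "ideal J R" and ne: "Qs \<noteq> []" and eq: "I = J \<cdot> ideal_list_prod R Qs"
    and Qs: "\<And>Q. Q \<in> set Qs \<Longrightarrow> radical_ideal R Q \<and> ideal Q R \<and> sat P Q = Q \<and> I \<subseteq> Q \<and> Q \<subseteq> P"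
    using ISP_local[OF P(1) xi x0 xP] unfolding I_def by metis
  define Q where "Q = hd Qs"
  have QQ: "Q \<in> set Qs" using ne by (simp add: Q_def)
  note Q = Qs[OF QQ]
  obtain B where B: "ideal B R" "ideal_list_prod R Qs = Q \<cdot> B"
    using list_prod_split[OF _ QQ] Qs by metis
  have Qi: "ideal Q R" using Q by blast
  have eq': "I = Q \<cdot> (J \<cdot> B)"
    unfolding eq B(2) using ideal_prod_assoc[OF Ji Qi B(1)] ideal_prod_assoc[OF Qi Ji B(1)]
      ideal_prod_commute[OF Ji Qi] by simp
  have "x \<in> sat P (Q \<cdot> (J \<cdot> B))" using xI eq' sat_idem[OF P(1) xi] I_def by simp
  moreover have "Q \<cdot> (J \<cdot> B) \<subseteq> sat P (PIdl x)" using eq' I_def by simp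
  ultimately obtain q where q: "q \<in> Q" "Q \<subseteq> sat P (PIdl q)"
    using factor_locally_principal[OF P(1) Qi ideal_prod_is_ideal[OF Ji B(1)] xc x(2)] by metis
  note qc = ideal.Icarr[OF Qi q(1)]
  have q0: "q \<noteq> \<zero>" using mem_sat_zero[OF P(1), of x] q(2) Q xI x(2) by blast
  have "sat P (PIdl q) \<subseteq> sat P Q" using q qc Qi by (intro sat_mono) (simp add: PIdl_subset_iff)
  then have "Q = sat P (PIdl q)" using q Q by blast
  then have "Q = P" using radical_locally_principal_eq[OF P(1) _ _ qc q0] Q by blast
  then show thesis using that[of q] q q0 \<open>Q = sat P (PIdl q)\<close> by blast
qed

text \<open>Incomparable \<open>N1\<close> and \<open>N2\<close> lie strictly below a prime
  \<open>N\<close> minimal over their sum. Some power \<open>k\<close> of its local generator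
  \<open>\<pi>\<close> lies in the sum, while all elements of \<open>N1\<close> and
  \<open>N2\<close> are divisible by the power \<open>Suc k\<close>; cancelling would make
  \<open>\<pi>\<close> a unit.\<close>

lemma primes_comparable:
  assumes P: "primeideal P R" and N1: "primeideal N1 R" "N1 \<subseteq> P" and N2: "primeideal N2 R" "N2 \<subseteq> P"
  shows "N1 \<subseteq> N2 \<or> N2 \<subseteq> N1"
proof (rule ccontr)
  assume nc: "\<not> (N1 \<subseteq> N2 \<or> N2 \<subseteq> N1)"
  note i1 = prime_is_ideal[OF N1(1)] and i2 = prime_is_ideal[OF N2(1)]
  have "N1 <+> N2 \<subseteq> P" using N1 N2 prime_is_ideal[OF P] by (intro add_ideal_subset)
  then obtain N where N: "N \<in> minimal_primes R (N1 <+> N2)" using minimal_prime_le[OF P] by blast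
  note Np = minimal_primesD(1)[OF N]
  note Ni = prime_is_ideal[OF Np]
  have sub: "N1 \<subseteq> N" "N2 \<subseteq> N"
    using minimal_primesD(2)[OF N] add_ideal_mem1[OF i1 i2] add_ideal_mem2[OF i1 i2] by auto
  have ne: "N1 \<noteq> N" "N2 \<noteq> N" using nc sub by auto
  have "N \<noteq> {\<zero>}" using sub ne ideal_zero_mem[OF i1] by blast
  then obtain \<pi> where pi: "\<pi> \<in> N" "N = sat N (PIdl \<pi>)" and pi0: "\<pi> \<noteq> \<zero>" using prime_locally_principal[OF Np] by blast
  note pic = ideal.Icarr[OF Ni pi(1)]
  obtain s k where s: "s \<in> carrier R - N" "s \<otimes> \<pi> [^] (k::nat) \<in> N1 <+> N2"
    by (rule minimal_prime_power[OF N add_ideals[OF i1 i2] pi(1)])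
  obtain n1 n2 where n: "n1 \<in> N1" "n2 \<in> N2" "s \<otimes> \<pi> [^] k = n1 \<oplus> n2" by (rule add_idealE[OF s(2)])
  obtain t1 m1 where t1: "t1 \<in> carrier R - N" "m1 \<in> N1" "t1 \<otimes> n1 = m1 \<otimes> \<pi> [^] Suc k"
    using strict_subprime_divisible[OF Np pi N1(1) sub(1) ne(1) n(1)] by blast
  obtain t2 m2 where t2: "t2 \<in> carrier R - N" "m2 \<in> N2" "t2 \<otimes> n2 = m2 \<otimes> \<pi> [^] Suc k"
    using strict_subprime_divisible[OF Np pi N2(1) sub(2) ne(2) n(2)] by blast
  have c: "n1 \<in> carrier R" "n2 \<in> carrier R" "m1 \<in> carrier R" "m2 \<in> carrier R"
    using n t1 t2 ideal.Icarr[OF i1] ideal.Icarr[OF i2] by blast+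
  have "\<pi> [^] k \<otimes> (t1 \<otimes> (t2 \<otimes> s)) = (t1 \<otimes> t2) \<otimes> (s \<otimes> \<pi> [^] k)"
    using t1(1) t2(1) s(1) pic by (simp add: m_ac)
  also have "\<dots> = t2 \<otimes> (t1 \<otimes> n1) \<oplus> t1 \<otimes> (t2 \<otimes> n2)"
    unfolding n(3) using t1(1) t2(1) c by (simp add: r_distr m_ac)
  also have "\<dots> = \<pi> [^] k \<otimes> ((t2 \<otimes> m1 \<oplus> t1 \<otimes> m2) \<otimes> \<pi>)"
    unfolding t1(3) t2(3) using t1(1) t2(1) c pic by (simp add: l_distr r_distr m_ac)
  finally have "t1 \<otimes> (t2 \<otimes> s) = (t2 \<otimes> m1 \<oplus> t1 \<otimes> m2) \<otimes> \<pi>"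
    using m_lcancel[of "\<pi> [^] k" "t1 \<otimes> (t2 \<otimes> s)" "(t2 \<otimes> m1 \<oplus> t1 \<otimes> m2) \<otimes> \<pi>"]
      t1(1) t2(1) s(1) c pic pi0 by (simp add: nat_pow_nonzero)
  also have "\<dots> \<in> N" using pi(1) t1(1) t2(1) c ideal.I_l_closed[OF Ni] by simp
  finally show False using prime_mult_compl[OF Np t1(1) prime_mult_compl[OF Np t2(1) s(1)]] by simp
qed

text \<open>If \<open>s\<close> did not divide \<open>n\<close> in \<open>N\<close>, the conductor
  \<open>C\<close> of \<open>n\<close> into \<open>(s)\<close> would lie in \<open>P\<close> and
  have a minimal prime \<open>L\<close> below \<open>P\<close>. It contains \<open>s\<close>, so it
  is strictly above \<open>N\<close>, and some power of its generator \<open>\<pi>\<close> is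
  locally in \<open>C\<close>: \<open>n \<pi>^k = u s\<close> with \<open>u\<close> in
  \<open>N\<close>. But \<open>u\<close> is divisible by \<open>\<pi>^k\<close>, and cancelling
  yields an element of \<open>C\<close> outside \<open>L\<close>.\<close>

lemma subprime_subset_sat:
  assumes P: "primeideal P R" and N: "primeideal N R" "N \<subseteq> P" and s: "s \<in> P" "s \<notin> N"
  shows "N \<subseteq> sat P (N \<cdot> (PIdl s))"
proof (rule subprime_subset_sat_prod[OF N(1)])
  show "s \<in> carrier R - N" using s ideal.Icarr[OF prime_is_ideal[OF P]] by blast
  show "N \<subseteq> sat P (PIdl s)"
  proof
    fix n assume n: "n \<in> N"
    note Pi = prime_is_ideal[OF P] and Ni = prime_is_ideal[OF N(1)]
    have sc: "s \<in> carrier R" and nc: "n \<in> carrier R" using s n ideal.Icarr[OF Pi] ideal.Icarr[OF Ni] by blast+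
    note si = cgenideal_ideal[OF sc]
    define K where "K = sat P (PIdl s)"
    have Ki: "ideal K R" unfolding K_def by (rule sat_ideal[OF P si])
    show "n \<in> sat P (PIdl s)"
    proof (rule ccontr)
      assume nK: "n \<notin> sat P (PIdl s)"
      define C where "C = {z \<in> carrier R. n \<otimes> z \<in> K}"
      have Ci: "ideal C R" unfolding C_def by (rule colon_ideal[OF Ki nc])
      have CP: "C \<subseteq> P"
      proof (rule ccontr)
        assume "\<not> C \<subseteq> P"
        then obtain t where "t \<in> carrier R - P" "n \<otimes> t \<in> K" by (auto simp: C_def)
        then have "n \<in> sat P K" using nc by (auto intro!: satI[of t] simp: m_comm)
        then show False using nK unfolding K_def by (simp add: sat_idem[OF P si])
      qed
      then obtain L where L: "L \<in> minimal_primes R C" "L \<subseteq> P" using minimal_prime_le[OF P] by blast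
      note Lp = minimal_primesD(1)[OF L(1)]
      note Li = prime_is_ideal[OF Lp]
      have "n \<otimes> s \<in> PIdl s" using nc by (auto simp: PIdl_iff)
      then have "s \<in> C" unfolding C_def K_def using subset_sat[OF P si] sc by blast
      then have sL: "s \<in> L" using minimal_primesD(2)[OF L(1)] by blast
      have NL: "N \<subseteq> L" "N \<noteq> L" using primes_comparable[OF P N Lp L(2)] sL s by auto
      have "L \<noteq> {\<zero>}" using sL s ideal_zero_mem[OF Ni] by auto
      then obtain \<pi> where pi: "\<pi> \<in> L" "L = sat L (PIdl \<pi>)" and pi0: "\<pi> \<noteq> \<zero>"
        using prime_locally_principal[OF Lp] by blast
      note pic = ideal.Icarr[OF Li pi(1)]
      obtain r k where r: "r \<in> carrier R - L" "r \<otimes> \<pi> [^] (k::nat) \<in> C"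
        by (rule minimal_prime_power[OF L(1) Ci pi(1)])
      have "n \<otimes> (r \<otimes> \<pi> [^] k) \<in> K" using r(2) by (simp add: C_def)
      then obtain r' u where r': "r' \<in> carrier R - P" "u \<in> carrier R" "r' \<otimes> (n \<otimes> (r \<otimes> \<pi> [^] k)) = u \<otimes> s"
        unfolding K_def mem_sat_PIdl by blast
      have "u \<otimes> s \<in> N"
        unfolding r'(3)[symmetric] using r'(1) r(1) pic n
        by (intro ideal.I_l_closed[OF Ni] ideal.I_r_closed[OF Ni]) auto
      then have uN: "u \<in> N" using primeideal.I_prime[OF N(1), of u s] r'(2) sc s by blast
      obtain t v where t: "t \<in> carrier R - L" "v \<in> N" "t \<otimes> u = v \<otimes> \<pi> [^] k"
        using strict_subprime_divisible[OF Lp pi N(1) NL uN] by blast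
      note vc = ideal.Icarr[OF Ni t(2)]
      have "\<pi> [^] k \<otimes> (n \<otimes> (t \<otimes> (r' \<otimes> r))) = t \<otimes> (r' \<otimes> (n \<otimes> (r \<otimes> \<pi> [^] k)))"
        using t(1) r'(1) r(1) nc pic by (simp add: m_ac)
      also have "\<dots> = (t \<otimes> u) \<otimes> s" unfolding r'(3) using t(1) r'(2) sc by (simp add: m_ac)
      also have "\<dots> = \<pi> [^] k \<otimes> (v \<otimes> s)" unfolding t(3) using vc pic sc by (simp add: m_ac)
      finally have eq: "n \<otimes> (t \<otimes> (r' \<otimes> r)) = v \<otimes> s"
        using m_lcancel[of "\<pi> [^] k" "n \<otimes> (t \<otimes> (r' \<otimes> r))" "v \<otimes> s"]
          t(1) r'(1) r(1) nc vc sc pic pi0 by (simp add: nat_pow_nonzero)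
      have "v \<otimes> s \<in> PIdl s" using vc by (auto simp: PIdl_iff)
      then have "n \<otimes> (t \<otimes> (r' \<otimes> r)) \<in> K" unfolding eq K_def using subset_sat[OF P si] by blast
      then have "t \<otimes> (r' \<otimes> r) \<in> L"
        using minimal_primesD(2)[OF L(1)] t(1) r'(1) r(1) by (auto simp: C_def)
      moreover have "r' \<in> carrier R - L" using r' L by auto
      ultimately show False
        using prime_mult_compl[OF Lp t(1) prime_mult_compl[OF Lp _ r(1)]] by blast
    qed
  qed
qed

text \<open>Such a \<open>Q\<close> is the intersection of the primes between \<open>Q\<close> and
  \<open>P\<close>, and these form a chain.\<close>

lemma saturated_radical_prime:
  assumes P: "primeideal P R" and Q: "radical_ideal R Q" "sat P Q = Q" "Q \<subseteq> P"
  shows "primeideal Q R"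
proof (rule primeidealI[OF radical_is_ideal[OF Q(1)] is_cring])
  note Qi = radical_is_ideal[OF Q(1)]
  show "carrier R \<noteq> Q" using Q(3) prime_one_notin[OF P] by auto
  fix a b assume ab: "a \<in> carrier R" "b \<in> carrier R" "a \<otimes> b \<in> Q"
  have avoid: "\<exists>N. primeideal N R \<and> Q \<subseteq> N \<and> N \<subseteq> P \<and> x \<notin> N" if x: "x \<in> carrier R" "x \<notin> Q" for x
  proof -
    have "s \<otimes> x [^] (k::nat) \<notin> Q" if s: "s \<in> carrier R - P" for s k
    proof
      assume "s \<otimes> x [^] k \<in> Q"
      then have "x [^] k \<in> sat P Q" using s x by (auto intro: satI)
      then show False using radical_idealD[OF Q(1) x(1)] x(2) Q(2) by auto
    qed
    then show ?thesis using prime_ge_notin[OF P Qi x(1)] by metis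
  qed
  show "a \<in> Q \<or> b \<in> Q"
  proof (rule ccontr)
    assume "\<not> (a \<in> Q \<or> b \<in> Q)"
    then obtain N1 N2 where N1: "primeideal N1 R" "Q \<subseteq> N1" "N1 \<subseteq> P" "a \<notin> N1"
      and N2: "primeideal N2 R" "Q \<subseteq> N2" "N2 \<subseteq> P" "b \<notin> N2" using avoid ab by meson
    show False
      using primes_comparable[OF P N1(1,3) N2(1,3)] N1 N2 ab
        primeideal.I_prime[OF N1(1) ab(1,2)] primeideal.I_prime[OF N2(1) ab(1,2)] by blast
  qed
qed

text \<open>Factor \<open>(x, y)\<close> at \<open>P\<close>. If all radical factors are
  \<open>P\<close>, then it is locally principal, and the argument for two generators applies.
  Otherwise a factor \<open>Q\<close> is a prime strictly below \<open>P\<close>, and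
  \<open>Q = Q s\<close> locally for \<open>s\<close> in \<open>P\<close> outside \<open>Q\<close>;
  so \<open>(x, y) = s (x, y)\<close>, and solving for \<open>x\<close> shows that \<open>y\<close>
  divides it.\<close>

lemma ISP_sat_cases:
  assumes P: "primeideal P R" and xy: "x \<in> carrier R" "y \<in> carrier R"
  shows "x \<in> sat P (PIdl y) \<or> y \<in> sat P (PIdl x)"
proof -
  note Pi = prime_is_ideal[OF P]
  have id: "ideal (PIdl x) R" "ideal (PIdl y) R" using xy by (auto intro: cgenideal_ideal)
  consider "x = \<zero>" | "x \<notin> P" | "y \<notin> P" | "x \<noteq> \<zero>" "x \<in> P" "y \<in> P" by blast
  then show ?thesis
  proof cases
    case 1
    then show ?thesis using ideal_zero_mem[OF sat_ideal[OF P id(2)]] by simp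
  next
    case 2
    have "x \<otimes> y = y \<otimes> x" using xy by (rule m_comm)
    then show ?thesis using 2 xy unfolding mem_sat_PIdl by blast
  next
    case 3
    have "y \<otimes> x = x \<otimes> y" using xy(2,1) by (rule m_comm)
    then show ?thesis using 3 xy unfolding mem_sat_PIdl by blast
  next
    case 4
    let ?B = "PIdl x <+> PIdl y"
    have Bi: "ideal ?B R" by (rule add_ideals[OF id])
    have mB: "x \<in> ?B" "y \<in> ?B"
      using id xy cgenideal_self by (auto intro: add_ideal_mem1 add_ideal_mem2)
    have BP: "?B \<subseteq> P"
      using 4 xy Pi by (intro add_ideal_subset) (auto simp: PIdl_subset_iff)
    define I where "I = sat P ?B"
    have mI: "x \<in> I" "y \<in> I" using mB subset_sat[OF P Bi] by (auto simp: I_def)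
    have B0: "?B \<noteq> {\<zero>}" using mB(1) 4(1) by (metis singletonD)
    obtain J Qs where J: "invertible_ideal R J" and Ji: "ideal J R" and eq: "I = J \<cdot> ideal_list_prod R Qs"
      and Qs: "\<And>Q. Q \<in> set Qs \<Longrightarrow> radical_ideal R Q \<and> ideal Q R \<and> sat P Q = Q \<and> I \<subseteq> Q \<and> Q \<subseteq> P"
      using ISP_local[OF P Bi B0 BP] unfolding I_def by metis
    show ?thesis
    proof (cases "\<forall>Q\<in>set Qs. Q = P")
      case True
      have P0: "P \<noteq> {\<zero>}" using 4 by auto
      have lpP: "locally_principal P P"
      proof -
        obtain \<pi> where "\<pi> \<in> P" "P = sat P (PIdl \<pi>)" by (rule prime_locally_principal[OF P P0])
        then show ?thesis unfolding locally_principal_def using equalityD1 by blast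
      qed
      have "locally_principal P I"
        unfolding eq
      proof (intro locally_principal_prod P Ji locally_principal_list_prod list_prod_ideal)
        show "locally_principal P J"
          using invertible_locally_principal[OF J P] unfolding locally_principal_def by blast
      qed (use True Pi lpP in auto)
      then obtain a where a: "a \<in> I" "I \<subseteq> sat P (PIdl a)" unfolding locally_principal_def by blast
      then show ?thesis
        using two_generated_sat_cases[OF P xy 4(1), of a] mI by (auto simp: I_def)
    next
      case False
      then obtain Q where QQ: "Q \<in> set Qs" "Q \<noteq> P" by blast
      note Q = Qs[OF QQ(1)]
      have Qi: "ideal Q R" using Q by blast
      have Qp: "primeideal Q R" using saturated_radical_prime[OF P] Q by blast
      obtain s where s: "s \<in> P" "s \<notin> Q" using Q QQ by blast
      note sc = ideal.Icarr[OF Pi s(1)]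
      note si = cgenideal_ideal[OF sc]
      have "Q \<subseteq> sat P (Q \<cdot> (PIdl s))" using subprime_subset_sat[OF P Qp _ s] Q by blast
      moreover obtain C where C: "ideal C R" "ideal_list_prod R Qs = Q \<cdot> C"
        using list_prod_split[OF _ QQ(1)] Qs by metis
      have JC: "ideal (J \<cdot> C) R" by (rule ideal_prod_is_ideal[OF Ji C(1)])
      have eq': "I = (J \<cdot> C) \<cdot> Q"
        unfolding eq C(2) using ideal_prod_assoc[OF Ji C(1) Qi] ideal_prod_commute[OF Qi C(1)] by simp
      ultimately have "(J \<cdot> C) \<cdot> Q \<subseteq> sat P ((J \<cdot> C) \<cdot> (Q \<cdot> (PIdl s)))"
        by (intro sat_prod_subset[OF P JC Qi JC ideal_prod_is_ideal[OF Qi si] subset_sat[OF P JC]])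
      then have "I \<subseteq> sat P (I \<cdot> (PIdl s))"
        unfolding eq' using ideal_prod_assoc[OF JC Qi si] by simp
      moreover have "I \<cdot> (PIdl s) \<subseteq> sat P (?B \<cdot> (PIdl s))"
        unfolding I_def by (rule sat_prod_subset[OF P sat_ideal[OF P Bi] si Bi si subset_refl subset_sat[OF P si]])
      then have "sat P (I \<cdot> (PIdl s)) \<subseteq> sat P (?B \<cdot> (PIdl s))"
        by (rule sat_least[OF P ideal_prod_is_ideal[OF Bi si]])
      ultimately have "x \<in> sat P (?B \<cdot> (PIdl s))" using mI by blast
      then obtain t where t: "t \<in> carrier R - P" "t \<otimes> x \<in> ?B \<cdot> (PIdl s)" by (rule satE)
      obtain b where b: "b \<in> ?B" "t \<otimes> x = b \<otimes> s" using t(2) mem_prod_PIdl[OF Bi sc] by blast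
      obtain i v where iv: "i \<in> PIdl x" "v \<in> carrier R" "b = i \<oplus> v \<otimes> y" by (rule add_PIdlE[OF b(1)])
      obtain u where u: "u \<in> carrier R" "i = u \<otimes> x" using iv(1) by (auto simp: PIdl_iff)
      have us: "u \<otimes> s \<in> P" using s u ideal.I_l_closed[OF Pi] by blast
      have tc: "t \<in> carrier R" using t by simp
      have "(t \<ominus> u \<otimes> s) \<otimes> x = t \<otimes> x \<ominus> (u \<otimes> s) \<otimes> x"
        using tc u(1) sc xy(1) by (simp add: a_minus_def l_distr l_minus)
      also have "\<dots> = (v \<otimes> s) \<otimes> y \<oplus> ((u \<otimes> s) \<otimes> x \<oplus> \<ominus> ((u \<otimes> s) \<otimes> x))"
        unfolding b(2) iv(3) u(2) using u(1) sc xy iv(2) by (simp add: a_minus_def l_distr r_distr m_ac a_ac)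
      also have "\<dots> = (v \<otimes> s) \<otimes> y" using u(1) sc xy iv(2) by (simp add: r_neg)
      finally have "(t \<ominus> u \<otimes> s) \<otimes> x = (v \<otimes> s) \<otimes> y" .
      moreover have "t \<ominus> u \<otimes> s \<in> carrier R - P"
        using ideal_minus_memD[OF Pi us tc] t(1) u(1) sc by auto
      moreover have "v \<otimes> s \<in> carrier R" using iv(2) sc by simp
      ultimately show ?thesis unfolding mem_sat_PIdl using xy by blast
    qed
  qed
qed

lemma ISP_strongly_discrete_pruefer: "strongly_discrete_pruefer_domain R"
proof -
  interpret pruefer_domain R by (rule pruefer_domainI[OF ISP_sat_cases])
  show ?thesis
  proof
    fix P assume P: "primeideal P R" and idem: "P \<cdot> P = P"
    note Pi = prime_is_ideal[OF P]
    show "P = {\<zero>}"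
    proof (rule ccontr)
      assume "P \<noteq> {\<zero>}"
      then obtain \<pi> where pi: "\<pi> \<in> P" "P = sat P (PIdl \<pi>)" "\<pi> \<noteq> \<zero>"
        using prime_locally_principal[OF P] by blast
      note pic = ideal.Icarr[OF Pi pi(1)]
      note i = cgenideal_ideal[OF pic]
      have "P \<cdot> P \<subseteq> sat P (P \<cdot> (PIdl \<pi>))"
        by (rule sat_prod_subset[OF P Pi Pi Pi i subset_sat[OF P Pi] equalityD1[OF pi(2)]])
      then have "\<pi> \<in> sat P (P \<cdot> (PIdl \<pi>))" using pi(1) idem by blast
      then obtain s where s: "s \<in> carrier R - P" "s \<otimes> \<pi> \<in> P \<cdot> (PIdl \<pi>)" by (rule satE)
      then obtain p where p: "p \<in> P" "s \<otimes> \<pi> = p \<otimes> \<pi>" using mem_prod_PIdl[OF Pi pic] by blast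
      have "p \<in> carrier R" "s \<in> carrier R" using p(1) s(1) ideal.Icarr[OF Pi] by auto
      then have "s = p" using m_rcancel[OF pi(3) pic] p(2) by blast
      then show False using s p by simp
    qed
  qed
qed

end

section \<open>Maximal ideals of ISP-domains\<close>

context domain
begin

lemma h_local_domain_iff:
  "h_local_domain R \<longleftrightarrow>
    (\<forall>P. primeideal P R \<and> P \<noteq> {\<zero>} \<longrightarrow> (\<exists>!M. maximalideal M R \<and> P \<subseteq> M)) \<and>
    (\<forall>I. ideal I R \<and> I \<noteq> {\<zero>} \<longrightarrow> finite {M. maximalideal M R \<and> I \<subseteq> M})"
  unfolding h_local_domain_def h_local_domain_axioms_def
  using domain_axioms local_quot_iff[OF prime_is_ideal] semilocal_quot_iff
  by (simp cong: conj_cong imp_cong) (simp only: imp_conjL)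

lemma h_local_domainI:
  assumes uniq: "\<And>P M N. \<lbrakk>primeideal P R; P \<noteq> {\<zero>}; maximalideal M R; maximalideal N R; P \<subseteq> M; P \<subseteq> N\<rbrakk> \<Longrightarrow> M = N"
    and fin: "\<And>x. \<lbrakk>x \<in> carrier R; x \<noteq> \<zero>\<rbrakk> \<Longrightarrow> finite {M. maximalideal M R \<and> x \<in> M}"
  shows "h_local_domain R"
  unfolding h_local_domain_iff
proof (intro conjI allI impI)
  fix P assume P: "primeideal P R \<and> P \<noteq> {\<zero>}"
  then have "P \<noteq> carrier R" using primeideal.I_notcarr by blast
  then obtain M where "maximalideal M R" "P \<subseteq> M" using P maximal_ideal_ge prime_is_ideal by metis
  then show "\<exists>!M. maximalideal M R \<and> P \<subseteq> M" using P uniq by blast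
next
  fix I assume I: "ideal I R \<and> I \<noteq> {\<zero>}"
  then obtain x where x: "x \<in> I" "x \<noteq> \<zero>" using ideal_zero_mem by blast
  then have "finite {M. maximalideal M R \<and> x \<in> M}" using fin I ideal.Icarr by metis
  then show "finite {M. maximalideal M R \<and> I \<subseteq> M}" by (rule finite_subset[rotated]) (use x in auto)
qed

lemma h_local_unique:
  "\<lbrakk>h_local_domain R; primeideal P R; P \<noteq> {\<zero>}; maximalideal M R; maximalideal N R; P \<subseteq> M; P \<subseteq> N\<rbrakk> \<Longrightarrow> M = N"
  unfolding h_local_domain_iff by blast

lemma h_local_finite:
  assumes "h_local_domain R" "x \<in> carrier R" "x \<noteq> \<zero>"
  shows "finite {M. maximalideal M R \<and> x \<in> M}"
proof -
  have i: "ideal (PIdl x) R" using assms by (intro cgenideal_ideal)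
  have "x \<in> PIdl x" using assms(2) by (rule cgenideal_self)
  then have ne: "PIdl x \<noteq> {\<zero>}" using assms(3) by (metis singletonD)
  have "\<forall>I. ideal I R \<and> I \<noteq> {\<zero>} \<longrightarrow> finite {M. maximalideal M R \<and> I \<subseteq> M}"
    using assms(1) unfolding h_local_domain_iff by (rule conjunct2)
  then have "finite {M. maximalideal M R \<and> PIdl x \<subseteq> M}" using i ne by simp
  moreover have "{M. maximalideal M R \<and> x \<in> M} \<subseteq> {M. maximalideal M R \<and> PIdl x \<subseteq> M}"
    using PIdl_subset_iff[OF maximal_is_ideal assms(2)] by blast
  ultimately show ?thesis by (rule finite_subset[rotated])
qed

text \<open>The primes below both \<open>M\<close> and \<open>N\<close> are those disjoint from the
  set \<open>S\<close> of products \<open>u \<otimes> v\<close>. If none of them contains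
  \<open>t\<close>, then \<open>t\<close> becomes a unit once \<open>S\<close> is inverted, that is,
  \<open>t\<close> divides a member of \<open>S\<close>.\<close>

lemma common_subprime_or_product:
  assumes M: "primeideal M R" and N: "primeideal N R" and t: "t \<in> carrier R"
    and no: "\<not> (\<exists>L. primeideal L R \<and> t \<in> L \<and> L \<subseteq> M \<and> L \<subseteq> N)"
  obtains u v where "u \<in> carrier R - M" "v \<in> carrier R - N" "u \<otimes> v \<in> PIdl t"
proof (rule ccontr)
  assume "\<not> thesis"
  then have nt: "\<And>u v. \<lbrakk>u \<in> carrier R - M; v \<in> carrier R - N\<rbrakk> \<Longrightarrow> u \<otimes> v \<notin> PIdl t" using that by blast
  define S where "S = {u \<otimes> v | u v. u \<in> carrier R - M \<and> v \<in> carrier R - N}"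
  have SI: "u \<otimes> v \<in> S" if "u \<in> carrier R - M" "v \<in> carrier R - N" for u v
    using that unfolding S_def by blast
  have SM: "u \<in> S" if "u \<in> carrier R - M" for u
    using SI[OF that prime_one_compl[OF N]] that by simp
  have SN: "v \<in> S" if "v \<in> carrier R - N" for v
    using SI[OF prime_one_compl[OF M] that] that by simp
  obtain L where L: "primeideal L R" "PIdl t \<subseteq> L" "S \<inter> L = {}"
  proof (rule prime_avoiding_mult_set[of S "PIdl t"])
    show "S \<subseteq> carrier R" by (auto simp: S_def)
    show "\<one> \<in> S" using SM prime_one_compl[OF M] by blast
    show "a \<otimes> b \<in> S" if ab: "a \<in> S" "b \<in> S" for a b
    proof -
      obtain u v where uv: "u \<in> carrier R - M" "v \<in> carrier R - N" "a = u \<otimes> v" using ab(1) by (auto simp: S_def)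
      obtain w z where wz: "w \<in> carrier R - M" "z \<in> carrier R - N" "b = w \<otimes> z" using ab(2) by (auto simp: S_def)
      have "a \<otimes> b = (u \<otimes> w) \<otimes> (v \<otimes> z)" unfolding uv(3) wz(3) using uv(1,2) wz(1,2) by (simp add: m_ac)
      then show ?thesis
        using prime_mult_compl[OF M uv(1) wz(1)] prime_mult_compl[OF N uv(2) wz(2)] unfolding S_def by blast
    qed
    show "ideal (PIdl t) R" using t by (rule cgenideal_ideal)
    show "S \<inter> PIdl t = {}" using nt by (auto simp: S_def)
  qed
  have Lc: "L \<subseteq> carrier R" by (rule ideal_subset_carrier[OF prime_is_ideal[OF L(1)]])
  have "L \<subseteq> M" "L \<subseteq> N" using L(3) Lc SM SN by blast+
  moreover have "t \<in> L" using L(2) cgenideal_self[OF t] by blast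
  ultimately show False using no L(1) by blast
qed

text \<open>When \<open>M\<close> and \<open>N\<close> share no nonzero prime, \<open>c\<close>
  divides some \<open>u \<otimes> v\<close> with \<open>u\<close> outside \<open>N\<close> and
  \<open>v\<close> outside \<open>M\<close>; then \<open>u\<close> witnesses the claim. So
  \<open>sat M (PIdl c)\<close> is an ideal that is \<open>(c)\<close> at \<open>M\<close> and
  trivial at \<open>N\<close>.\<close>

lemma principal_saturation_not_le:
  assumes M: "primeideal M R" and N: "primeideal N R" and c: "c \<in> carrier R" "c \<noteq> \<zero>"
    and no: "\<And>L. \<lbrakk>primeideal L R; L \<noteq> {\<zero>}; L \<subseteq> N\<rbrakk> \<Longrightarrow> \<not> L \<subseteq> M"
  shows "\<not> sat M (PIdl c) \<subseteq> N"
proof -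
  have "\<not> (\<exists>L. primeideal L R \<and> c \<in> L \<and> L \<subseteq> N \<and> L \<subseteq> M)"
    using no c(2) by (metis singletonD)
  then obtain u v where uv: "u \<in> carrier R - N" "v \<in> carrier R - M" "u \<otimes> v \<in> PIdl c"
    using common_subprime_or_product[OF N M c(1)] by metis
  have "v \<otimes> u \<in> PIdl c" using uv m_comm[of u v] by auto
  then have "u \<in> sat M (PIdl c)" using uv(1,2) by (auto intro: satI)
  then show ?thesis using uv(1) by blast
qed

text \<open>Anderson's argument: if all minimal primes of \<open>I\<close> are radicals of finitely generated ideals
  \<open>F P\<close>, then some finite product of the \<open>F P\<close> lies in \<open>I\<close>, as a prime ideal avoiding all such
  products would contain a minimal prime.\<close>

lemma finite_minimal_primes:
  assumes I: "ideal I R"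
    and fg: "\<And>P. P \<in> minimal_primes R I \<Longrightarrow> \<exists>F. fg_ideal R F \<and> P = ideal_radical R F"
  shows "finite (minimal_primes R I)"
proof -
  obtain F where F: "\<And>P. P \<in> minimal_primes R I \<Longrightarrow> fg_ideal R (F P) \<and> P = ideal_radical R (F P)"
    using fg by metis
  have FP: "F P \<subseteq> P" if P: "P \<in> minimal_primes R I" for P
  proof
    fix x assume x: "x \<in> F P"
    then have "x \<in> carrier R" using F[OF P] fg_ideal_is_ideal ideal.Icarr by metis
    then have "x \<in> ideal_radical R (F P)"
      using x unfolding ideal_radical_def by (auto intro!: exI[of _ "1::nat"])
    then show "x \<in> P" using F[OF P] by blast
  qed
  have rad: "P \<subseteq> N" if "P \<in> minimal_primes R I" "primeideal N R" "F P \<subseteq> N" for P N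
  proof
    fix x assume "x \<in> P"
    then have "x \<in> ideal_radical R (F P)" using F[OF that(1)] by blast
    then obtain n where "x \<in> carrier R" "x [^] (n::nat) \<in> F P" by (auto simp: ideal_radical_def)
    then show "x \<in> N" using prime_pow_mem[OF that(2)] that(3) by blast
  qed
  have Fid: "ideal (F P) R" if "P \<in> minimal_primes R I" for P
    using F[OF that] fg_ideal_is_ideal by blast
  have append: "ideal_list_prod R (map F (Ps @ Qs)) = ideal_list_prod R (map F Ps) \<cdot> ideal_list_prod R (map F Qs)"
    if "set Ps \<subseteq> minimal_primes R I" "set Qs \<subseteq> minimal_primes R I" for Ps Qs
    using that
  proof (induct Ps)
    case Nil
    then have "ideal (ideal_list_prod R (map F Qs)) R" using Fid by (intro list_prod_ideal) auto
    then show ?case by (simp add: carrier_ideal_prod)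
  next
    case (Cons P Ps)
    have "ideal (F P) R" "ideal (ideal_list_prod R (map F Ps)) R" "ideal (ideal_list_prod R (map F Qs)) R"
      using Cons.prems by (auto intro!: list_prod_ideal Fid)
    then show ?case using Cons by (simp add: ideal_prod_assoc)
  qed
  define Fam where "Fam = {ideal_list_prod R (map F Ps) | Ps. set Ps \<subseteq> minimal_primes R I}"
  have "\<exists>X\<in>Fam. X \<subseteq> I"
  proof (rule ccontr)
    assume "\<not> ?thesis"
    then have av: "\<And>X. X \<in> Fam \<Longrightarrow> \<not> X \<subseteq> I" by blast
    obtain Q where Q: "primeideal Q R" "I \<subseteq> Q" "\<And>X. X \<in> Fam \<Longrightarrow> \<not> X \<subseteq> Q"
    proof (rule prime_avoiding_fg_family[of Fam I])
      show "fg_ideal R X" if X: "X \<in> Fam" for X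
      proof -
        obtain Ps where Ps: "set Ps \<subseteq> minimal_primes R I" "X = ideal_list_prod R (map F Ps)"
          using X by (auto simp: Fam_def)
        show ?thesis
          unfolding Ps(2) using Ps(1) by (induct Ps) (auto intro: fg_ideal_carrier fg_ideal_prod simp: F)
      qed
      show "carrier R \<in> Fam" by (auto simp: Fam_def intro!: exI[of _ "[]"])
      show "X \<cdot> Y \<in> Fam" if XY: "X \<in> Fam" "Y \<in> Fam" for X Y
      proof -
        obtain Ps Qs where "set Ps \<subseteq> minimal_primes R I" "X = ideal_list_prod R (map F Ps)"
          "set Qs \<subseteq> minimal_primes R I" "Y = ideal_list_prod R (map F Qs)"
          using XY by (auto simp: Fam_def)
        then show ?thesis using append[of Ps Qs] unfolding Fam_def
          by (intro CollectI exI[of _ "Ps @ Qs"]) auto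
      qed
    qed (use I av in auto)
    obtain P where P: "P \<in> minimal_primes R I" "P \<subseteq> Q" by (rule minimal_prime_le[OF Q(1,2)])
    have "F P = ideal_list_prod R (map F [P])" using F[OF P(1)] fg_ideal_is_ideal ideal_prod_one by auto
    then have "F P \<in> Fam" using P unfolding Fam_def by (intro CollectI exI[of _ "[P]"]) auto
    then show False using Q(3) FP[OF P(1)] P(2) by blast
  qed
  then obtain Ps where Ps: "set Ps \<subseteq> minimal_primes R I" "ideal_list_prod R (map F Ps) \<subseteq> I"
    by (auto simp: Fam_def)
  \<comment> \<open>A minimal prime contains the product, hence some \<open>F P\<close>, hence the
    radical \<open>P\<close> of it, and equals \<open>P\<close> by minimality.\<close>
  have "minimal_primes R I \<subseteq> set Ps"
  proof
    fix N assume N: "N \<in> minimal_primes R I"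
    note ND = minimal_primesD[OF N]
    have "\<exists>X\<in>set (map F Ps). X \<subseteq> N"
    proof (rule list_prod_subset_prime[OF ND(1)])
      show "ideal X R" if "X \<in> set (map F Ps)" for X using that Ps(1) F fg_ideal_is_ideal by auto
      show "ideal_list_prod R (map F Ps) \<subseteq> N" using Ps(2) ND(2) by blast
    qed
    then obtain P where P: "P \<in> set Ps" "F P \<subseteq> N" by auto
    then have Pm: "P \<in> minimal_primes R I" using Ps by blast
    then show "N \<in> set Ps" using ND(3)[OF minimal_primesD(1,2)[OF Pm] rad[OF Pm ND(1) P(2)]] P(1) by simp
  qed
  then show ?thesis by (rule finite_subset) simp
qed

end

lemma (in generalized_dedekind_domain) finite_minimal_primes_of_ideal:
  assumes I: "ideal I R" shows "finite (minimal_primes R I)"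
proof (cases "I = {\<zero>}")
  case True
  have "minimal_primes R I \<subseteq> {{\<zero>}}"
  proof
    fix P assume P: "P \<in> minimal_primes R I"
    have "{\<zero>} \<subseteq> P" using minimal_primesD(2)[OF P] True by simp
    then show "P \<in> {{\<zero>}}" using minimal_primesD(3)[OF P zeroprimeideal] True by simp
  qed
  then show ?thesis by (rule finite_subset) simp
next
  case False
  show ?thesis
  proof (rule finite_minimal_primes[OF I])
    fix P assume P: "P \<in> minimal_primes R I"
    have "P \<noteq> {\<zero>}" using minimal_primesD(2)[OF P] False ideal_zero_mem[OF I] by blast
    then show "\<exists>F. fg_ideal R F \<and> P = ideal_radical R F"
      by (rule prime_radical_fg[OF minimal_primesD(1)[OF P]])
  qed
qed

section \<open>Maximal ideals over a nonzero prime of an ISP-domain\<close>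

context ISP_domain
begin

text \<open>Enlarging \<open>P\<close> to be maximal among the primes below both \<open>M1\<close> and \<open>M2\<close>, the ideal that
  agrees with a local generator of \<open>P\<close> at \<open>M2\<close> and with \<open>P\<close> at \<open>M1\<close> has no ISP factorization.\<close>

lemma nonzero_prime_in_unique_maximal:
  assumes P0: "primeideal P0 R" "P0 \<noteq> {\<zero>}" and M1: "maximalideal M1 R" and M2: "maximalideal M2 R"
    and sub: "P0 \<subseteq> M1" "P0 \<subseteq> M2"
  shows "M1 = M2"
proof (rule ccontr)
  assume ne: "M1 \<noteq> M2"
  note p1 = maximalideal_prime[OF M1] and p2 = maximalideal_prime[OF M2]
  note i1 = maximal_is_ideal[OF M1]
  \<comment> \<open>The primes in \<open>D\<close> form a chain, so their union is prime. Any prime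
    below \<open>M1\<close> and \<open>M2\<close> is comparable with this union and therefore
    contained in it.\<close>
  define D where "D = {N. primeideal N R \<and> P0 \<subseteq> N \<and> N \<subseteq> M1 \<and> N \<subseteq> M2}"
  define P where "P = \<Union>D"
  have DP0: "P0 \<in> D" using P0 sub by (auto simp: D_def)
  have chain: "K \<subseteq> L \<or> L \<subseteq> K" if "K \<in> D" "L \<in> D" for K L
    using primes_comparable[OF p1] that by (simp add: D_def)
  have P: "primeideal P R"
  proof (rule primeidealI[OF _ is_cring])
    show "ideal P R"
      unfolding P_def using DP0 chain by (intro Union_chain_ideal) (auto simp: D_def prime_is_ideal)
    have "P \<subseteq> M1" by (auto simp: P_def D_def)
    then show "carrier R \<noteq> P" using prime_one_notin[OF p1] by auto
    fix a b assume ab: "a \<in> carrier R" "b \<in> carrier R" "a \<otimes> b \<in> P"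
    then obtain N where N: "N \<in> D" "a \<otimes> b \<in> N" by (auto simp: P_def)
    then have "a \<in> N \<or> b \<in> N" using primeideal.I_prime[of N R a b] ab by (auto simp: D_def)
    then show "a \<in> P \<or> b \<in> P" using N(1) by (auto simp: P_def)
  qed
  note Pi = prime_is_ideal[OF P]
  have PM: "P \<subseteq> M1" "P \<subseteq> M2" and P0P: "P0 \<subseteq> P" using DP0 by (auto simp: P_def D_def)
  have Pmax: "L \<subseteq> P" if L: "primeideal L R" "L \<subseteq> M1" "L \<subseteq> M2" for L
  proof -
    have "L \<subseteq> P \<or> P \<subseteq> L" by (rule primes_comparable[OF p1 L(1,2) P PM(1)])
    then show ?thesis
    proof
      assume "P \<subseteq> L"
      then have "L \<in> D" using L P0P by (auto simp: D_def)
      then show ?thesis by (auto simp: P_def)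
    qed
  qed
  have nle: "\<not> M1 \<subseteq> P" "\<not> M2 \<subseteq> P"
    using maximal_eqI[OF M1 p2] maximal_eqI[OF M2 p1] PM ne by blast+
  have "P \<noteq> {\<zero>}" using P0P P0(2) ideal_zero_mem[OF prime_is_ideal[OF P0(1)]] by blast
  then obtain b where b: "b \<in> P" "P = sat P (PIdl b)" and b0: "b \<noteq> \<zero>" using prime_locally_principal[OF P] by blast
  note bc = ideal.Icarr[OF Pi b(1)]
  note bi = cgenideal_ideal[OF bc]
  define B where "B = sat M2 (PIdl b)"
  have Bi: "ideal B R" unfolding B_def by (rule sat_ideal[OF p2 bi])
  define I where "I = B \<inter> P"
  have Ii: "ideal I R" unfolding I_def by (rule i_intersect[OF Bi Pi])
  have bI: "b \<in> I" unfolding I_def B_def using b(1) subset_sat[OF p2 bi] cgenideal_self[OF bc] by blast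
  have I0: "I \<noteq> {\<zero>}" using bI b0 by auto
  have Ic: "I \<noteq> carrier R" using prime_one_notin[OF P] by (auto simp: I_def)
  \<comment> \<open>Here \<open>t \<otimes> p\<close> is a multiple of \<open>b\<close> with
    \<open>t\<close> outside \<open>P\<close>. By maximality of \<open>P\<close> no prime below both
    \<open>M1\<close> and \<open>M2\<close> contains \<open>t\<close>, so \<open>t\<close> divides
    some \<open>u \<otimes> v\<close>; then \<open>u \<otimes> p\<close> is a multiple of
    \<open>b\<close> at \<open>M2\<close>, and \<open>u\<close> is an admissible denominator at
    \<open>M1\<close>.\<close>
  have P_le: "P \<subseteq> sat M1 I"
  proof
    fix p assume p: "p \<in> P"
    note pc = ideal.Icarr[OF Pi p]
    have "p \<in> sat P (PIdl b)" using p b(2) by blast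
    then obtain t r where t: "t \<in> carrier R - P" "r \<in> carrier R" "t \<otimes> p = r \<otimes> b"
      unfolding mem_sat_PIdl by blast
    have tc: "t \<in> carrier R" using t by simp
    have no: "\<not> (\<exists>L. primeideal L R \<and> t \<in> L \<and> L \<subseteq> M1 \<and> L \<subseteq> M2)"
      using Pmax t(1) by blast
    obtain u v where uv: "u \<in> carrier R - M1" "v \<in> carrier R - M2" "u \<otimes> v \<in> PIdl t"
      using common_subprime_or_product[OF p1 p2 tc no] by metis
    obtain w where w: "w \<in> carrier R" "u \<otimes> v = w \<otimes> t" using uv(3) by (auto simp: PIdl_iff)
    have "v \<otimes> (u \<otimes> p) = (u \<otimes> v) \<otimes> p" using uv(1,2) pc by (simp add: m_ac)
    also have "\<dots> = w \<otimes> (t \<otimes> p)" unfolding w(2) using w(1) tc pc by (simp add: m_ac)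
    also have "\<dots> = (w \<otimes> r) \<otimes> b" unfolding t(3) using w(1) t(2) bc by (simp add: m_ac)
    finally have "v \<otimes> (u \<otimes> p) = (w \<otimes> r) \<otimes> b" .
    moreover have "w \<otimes> r \<in> carrier R" "u \<otimes> p \<in> carrier R" using w t uv pc by auto
    ultimately have "u \<otimes> p \<in> B" unfolding B_def mem_sat_PIdl using uv(2) by blast
    moreover have "u \<otimes> p \<in> P" using p uv(1) ideal.I_l_closed[OF Pi] by blast
    ultimately show "p \<in> sat M1 I" using uv(1) pc by (auto simp: I_def intro: satI)
  qed
  obtain J Qs where J: "invertible_ideal R J"
    and rad: "\<And>Q. Q \<in> set Qs \<Longrightarrow> radical_ideal R Q" and eq: "I = J \<cdot> ideal_list_prod R Qs"
    using ISP[OF Ii I0 Ic] by blast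
  note Ji = invertible_is_ideal[OF J]
  have Qsi: "\<And>Q. Q \<in> set Qs \<Longrightarrow> ideal Q R" using rad radical_is_ideal by blast
  have Li: "ideal (ideal_list_prod R Qs) R" using Qsi by (rule list_prod_ideal)
  have "J \<cdot> ideal_list_prod R Qs \<subseteq> P" using eq by (auto simp: I_def)
  then have "J \<subseteq> P \<or> ideal_list_prod R Qs \<subseteq> P" by (rule primeideal_divides_ideal_prod[OF P Ji Li])
  then consider "J \<subseteq> P" | Q where "Q \<in> set Qs" "Q \<subseteq> P"
    using list_prod_subset_prime[OF P Qsi] by blast
  then show False
  proof cases
    case 1
    \<comment> \<open>At \<open>M1\<close> the prime \<open>P\<close> would be generated by
      \<open>a\<close>. Since \<open>P = P s\<close> there for \<open>s\<close> in \<open>M1\<close>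
      outside \<open>P\<close>, the generator satisfies \<open>a = r a s\<close> locally, and
      \<open>s\<close> would be a unit.\<close>
    obtain a where a: "a \<in> J" "J \<subseteq> sat M1 (PIdl a)"
      using invertible_locally_principal[OF J p1] by blast
    note ac = ideal.Icarr[OF Ji a(1)]
    have "I \<subseteq> sat M1 (PIdl a)" using a(2) ideal_prod_subset_left[OF Ji Li] eq by blast
    then have "sat M1 I \<subseteq> sat M1 (PIdl a)" by (rule sat_least[OF p1 cgenideal_ideal[OF ac]])
    then have Pa: "P \<subseteq> sat M1 (PIdl a)" using P_le by blast
    have a0: "a \<noteq> \<zero>" using mem_sat_zero[OF p1, of b] Pa b(1) b0 by blast
    obtain s where s: "s \<in> M1" "s \<notin> P" using nle by blast
    note sc = ideal.Icarr[OF i1 s(1)]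
    have aP: "a \<in> P" using a(1) 1 by blast
    have ai: "ideal (PIdl a) R" "ideal (PIdl s) R" using ac sc by (auto intro: cgenideal_ideal)
    have "P \<cdot> (PIdl s) \<subseteq> sat M1 ((PIdl a) \<cdot> (PIdl s))"
      by (rule sat_prod_subset[OF p1 Pi ai(2) ai Pa subset_sat[OF p1 ai(2)]])
    then have "sat M1 (P \<cdot> (PIdl s)) \<subseteq> sat M1 (PIdl (a \<otimes> s))"
      using sat_least[OF p1 ideal_prod_is_ideal[OF ai]] PIdl_prod[OF ac sc] by simp
    then have "a \<in> sat M1 (PIdl (a \<otimes> s))" using subprime_subset_sat[OF p1 P PM(1) s] aP by blast
    then obtain t r where t: "t \<in> carrier R - M1" "r \<in> carrier R" "t \<otimes> a = r \<otimes> (a \<otimes> s)"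
      unfolding mem_sat_PIdl by blast
    have "a \<otimes> t = t \<otimes> a" using ac t(1) by (intro m_comm) auto
    also have "\<dots> = a \<otimes> (r \<otimes> s)" unfolding t(3) using t(2) ac sc by (simp add: m_ac)
    finally have "t = r \<otimes> s" using m_lcancel[of a t "r \<otimes> s"] a0 ac t(1,2) sc by simp
    then have "t \<in> M1" using ideal.I_l_closed[OF i1 s(1) t(2)] by simp
    then show False using t(1) by blast
  next
    case 2
    \<comment> \<open>At \<open>M2\<close> the ideal \<open>I\<close> is generated by
      \<open>b\<close>, so its factor \<open>Q\<close> is principal there and, being radical, equals
      \<open>M2\<close>, although \<open>Q\<close> lies in the smaller prime
      \<open>P\<close>.\<close>
    note Qi = Qsi[OF 2(1)]
    obtain C where C: "ideal C R" "ideal_list_prod R Qs = Q \<cdot> C" using list_prod_split[OF Qsi 2(1)] by blast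
    have eq': "I = Q \<cdot> (J \<cdot> C)"
      unfolding eq C(2) using ideal_prod_assoc[OF Ji Qi C(1)] ideal_prod_assoc[OF Qi Ji C(1)]
        ideal_prod_commute[OF Ji Qi] by simp
    have "Q \<cdot> (J \<cdot> C) \<subseteq> sat M2 (PIdl b)" unfolding eq'[symmetric] by (auto simp: I_def B_def)
    moreover have "b \<in> sat M2 (Q \<cdot> (J \<cdot> C))" unfolding eq'[symmetric] using subset_sat[OF p2 Ii] bI by blast
    ultimately obtain q where q: "q \<in> Q" "Q \<subseteq> sat M2 (PIdl q)"
      using factor_locally_principal[OF p2 Qi ideal_prod_is_ideal[OF Ji C(1)] bc b0] by metis
    note qc = ideal.Icarr[OF Qi q(1)]
    have "b \<in> Q" using bI ideal_prod_subset_left[OF Qi ideal_prod_is_ideal[OF Ji C(1)]] eq' by blast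
    then have q0: "q \<noteq> \<zero>" using mem_sat_zero[OF p2, of b] q(2) b0 by blast
    have "PIdl q \<subseteq> Q" using q(1) qc PIdl_subset_iff[OF Qi] by blast
    then have eqQ: "sat M2 Q = sat M2 (PIdl q)"
      using sat_least[OF p2 cgenideal_ideal[OF qc] q(2)] sat_mono by blast
    have QP: "sat M2 Q \<subseteq> P" by (rule sat_subset_prime[OF P PM(2) 2(2)])
    then have "sat M2 Q = M2"
      using radical_locally_principal_eq[OF p2 sat_radical[OF p2 rad[OF 2(1)]] _ qc q0 eqQ] PM by blast
    then show False using QP nle by simp
  qed
qed

text \<open>Each maximal ideal containing \<open>x\<close> contains a minimal prime over
  \<open>(x)\<close>; that prime is nonzero and lies in no other maximal ideal.\<close>

lemma h_local_of_finite_minimal_primes: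
  assumes fin: "\<And>I. ideal I R \<Longrightarrow> finite (minimal_primes R I)"
  shows "h_local_domain R"
proof (rule h_local_domainI[OF nonzero_prime_in_unique_maximal])
  fix x assume x: "x \<in> carrier R" "x \<noteq> \<zero>"
  let ?m = "minimal_primes R (PIdl x)"
  have "{M. maximalideal M R \<and> x \<in> M} \<subseteq> (\<Union>N\<in>?m. {M. maximalideal M R \<and> N \<subseteq> M})"
  proof
    fix M assume "M \<in> {M. maximalideal M R \<and> x \<in> M}"
    then have M: "maximalideal M R" "x \<in> M" by auto
    have "PIdl x \<subseteq> M" using M x PIdl_subset_iff[OF maximal_is_ideal[OF M(1)]] by blast
    then obtain N where "N \<in> ?m" "N \<subseteq> M" using minimal_prime_le[OF maximalideal_prime[OF M(1)]] by blast
    then show "M \<in> (\<Union>N\<in>?m. {M. maximalideal M R \<and> N \<subseteq> M})" using M by blast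
  qed
  moreover have "finite (\<Union>N\<in>?m. {M. maximalideal M R \<and> N \<subseteq> M})"
  proof (rule finite_UN_I)
    show "finite ?m" using x by (intro fin cgenideal_ideal)
    fix N assume N: "N \<in> ?m"
    have "x \<in> N" using minimal_primesD(2)[OF N] cgenideal_self[OF x(1)] by blast
    then have "N \<noteq> {\<zero>}" using x by auto
    then have "\<And>M M'. \<lbrakk>M \<in> {M. maximalideal M R \<and> N \<subseteq> M}; M' \<in> {M. maximalideal M R \<and> N \<subseteq> M}\<rbrakk> \<Longrightarrow> M = M'"
      using nonzero_prime_in_unique_maximal[OF minimal_primesD(1)[OF N]] by blast
    then have "{M. maximalideal M R \<and> N \<subseteq> M} = {} \<or> (\<exists>M. {M. maximalideal M R \<and> N \<subseteq> M} = {M})" by blast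
    then show "finite {M. maximalideal M R \<and> N \<subseteq> M}" by (metis finite.emptyI finite.insertI)
  qed
  ultimately show "finite {M. maximalideal M R \<and> x \<in> M}" by (rule finite_subset)
qed

text \<open>Take a local generator \<open>\<pi>\<close> of \<open>P\<close> and, for each of the
  finitely many other maximal ideals containing \<open>\<pi>\<close>, an element of \<open>P\<close>
  outside it. A prime \<open>L\<close> over these lies in the maximal ideal \<open>M\<close> above
  \<open>P\<close>, so it is comparable with \<open>P\<close>; and if it is below \<open>P\<close>,
  it contains \<open>P\<close> because it contains \<open>\<pi>\<close>.\<close>

lemma generalized_dedekind_of_h_local:
  assumes hl: "h_local_domain R"
  shows "generalized_dedekind_domain R"
proof -
  interpret strongly_discrete_pruefer_domain R by (rule ISP_strongly_discrete_pruefer)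
  show ?thesis
  proof
    fix P assume P: "primeideal P R" "P \<noteq> {\<zero>}"
    note Pi = prime_is_ideal[OF P(1)]
    have Pc: "\<And>x. x \<in> P \<Longrightarrow> x \<in> carrier R" using ideal.Icarr[OF Pi] by blast
    obtain \<pi> where pi: "\<pi> \<in> P" "P = sat P (PIdl \<pi>)" and pi0: "\<pi> \<noteq> \<zero>"
      using prime_locally_principal[OF P] by blast
    have "P \<noteq> carrier R" using P primeideal.I_notcarr by blast
    then obtain M where M: "maximalideal M R" "P \<subseteq> M" using maximal_ideal_ge[OF Pi] by blast
    define X where "X = {N. maximalideal N R \<and> \<pi> \<in> N}"
    have finX: "finite X" unfolding X_def by (rule h_local_finite[OF hl Pc[OF pi(1)] pi0])
    have "\<exists>p. p \<in> P \<and> p \<notin> N" if "N \<in> X - {M}" for N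
      using h_local_unique[OF hl P M(1) _ M(2), of N] that by (auto simp: X_def)
    then obtain p where p: "\<And>N. N \<in> X - {M} \<Longrightarrow> p N \<in> P \<and> p N \<notin> N" by metis
    define S where "S = insert \<pi> (p ` (X - {M}))"
    have S: "finite S" "S \<subseteq> P" using finX p pi(1) by (auto simp: S_def)
    have Sc: "S \<subseteq> carrier R" using S(2) Pc by blast
    define F where "F = Idl S"
    have Fi: "ideal F R" unfolding F_def by (rule genideal_ideal[OF Sc])
    have FP: "F \<subseteq> P" unfolding F_def by (rule genideal_minimal[OF Pi S(2)])
    have SF: "S \<subseteq> F" unfolding F_def by (rule genideal_self[OF Sc])
    have "P = ideal_radical R F"
    proof
      show "ideal_radical R F \<subseteq> P"
        using FP prime_pow_mem[OF P(1)] by (auto simp: ideal_radical_def)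
      show "P \<subseteq> ideal_radical R F"
      proof (rule ccontr)
        assume "\<not> P \<subseteq> ideal_radical R F"
        then obtain y where y: "y \<in> P" "y \<notin> ideal_radical R F" by blast
        have yF: "y [^] (k::nat) \<notin> F" for k
        proof (cases "k = 0")
          case True
          then show ?thesis using FP prime_one_notin[OF P(1)] by auto
        next
          case False
          then have "0 < k" by simp
          then show ?thesis using y(2) Pc[OF y(1)] unfolding ideal_radical_def by blast
        qed
        obtain L where L: "primeideal L R" "F \<subseteq> L" "range (\<lambda>k::nat. y [^] k) \<inter> L = {}"
        proof (rule prime_avoiding_mult_set[of "range (\<lambda>k::nat. y [^] k)" F])
          show "range (\<lambda>k::nat. y [^] k) \<subseteq> carrier R" using y Pc by auto
          show "\<one> \<in> range (\<lambda>k::nat. y [^] k)" by (rule range_eqI[of _ _ 0]) simp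
          show "s \<otimes> t \<in> range (\<lambda>k::nat. y [^] k)"
            if st: "s \<in> range (\<lambda>k::nat. y [^] k)" "t \<in> range (\<lambda>k::nat. y [^] k)" for s t
          proof -
            obtain k l where "s = y [^] (k::nat)" "t = y [^] (l::nat)" using st by blast
            then have "s \<otimes> t = y [^] (k + l)" using y Pc by (simp add: nat_pow_mult)
            then show ?thesis by blast
          qed
        qed (use yF Fi in auto)
        have "y = y [^] (1::nat)" using y Pc by simp
        then have yL: "y \<notin> L" using L(3) by (metis IntI empty_iff rangeI)
        have "L \<noteq> carrier R" using L(1) primeideal.I_notcarr by blast
        then obtain N where N: "maximalideal N R" "L \<subseteq> N" using maximal_ideal_ge[OF prime_is_ideal[OF L(1)]] by blast
        have piL: "\<pi> \<in> L" using SF L(2) by (auto simp: S_def)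
        then have "N \<in> X" using N by (auto simp: X_def)
        have "N = M"
        proof (rule ccontr)
          assume "N \<noteq> M"
          then have "N \<in> X - {M}" using \<open>N \<in> X\<close> by simp
          then have "p N \<in> S" "p N \<notin> N" using p by (auto simp: S_def)
          then show False using SF L(2) N(2) by blast
        qed
        then have "P \<subseteq> L \<or> L \<subseteq> P"
          using primes_comparable[OF maximalideal_prime[OF M(1)] P(1) M(2) L(1)] N(2) by blast
        then have "L \<subseteq> P" using yL y(1) by blast
        moreover have "PIdl \<pi> \<subseteq> L" using piL PIdl_subset_iff[OF prime_is_ideal[OF L(1)] Pc[OF pi(1)]] by blast
        ultimately have "P \<subseteq> L" using sat_subset_prime[OF L(1)] pi(2) by blast
        then show False using yL y(1) by blast
      qed
    qed
    moreover have "fg_ideal R F" unfolding fg_ideal_def F_def using S Sc by blast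
    ultimately show "\<exists>F. fg_ideal R F \<and> P = ideal_radical R F" by blast
  qed
qed

end

section \<open>ZPUI-domains\<close>

context ZPUI_domain
begin

lemma ZPUI_ISP: "ISP_domain R"
proof
  fix I assume "ideal I R" "I \<noteq> {\<zero>}" "I \<noteq> carrier R"
  then obtain J Ps where "invertible_ideal R J" "Ps \<noteq> []" "\<forall>P\<in>set Ps. primeideal P R" "I = J \<cdot> ideal_list_prod R Ps"
    using ZPUI by meson
  moreover have "radical_ideal R P \<and> P \<noteq> carrier R" if "primeideal P R" for P
    using prime_radical[OF that] primeideal.I_notcarr[OF that] by simp
  ultimately show "\<exists>J Qs. invertible_ideal R J \<and> Qs \<noteq> [] \<and>
      (\<forall>Q\<in>set Qs. radical_ideal R Q \<and> Q \<noteq> carrier R) \<and> I = J \<cdot> ideal_list_prod R Qs" by blast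
qed

text \<open>The factorization \<open>J \<cdot> P\<close> of the ideal that is \<open>(x\<^sup>2)\<close> at \<open>M\<close> and trivial at all other
  maximal ideals has \<open>J \<subseteq> (x)\<close> locally at \<open>M\<close>. A multiplier \<open>e\<close> with \<open>e J \<subseteq> (x)\<close> then lies in
  every other maximal ideal containing \<open>x\<close>.\<close>

lemma isolating_element:
  assumes M: "maximalideal M R" and x: "x \<in> M" "x \<noteq> \<zero>"
  obtains e where "e \<in> carrier R - M" "\<And>N. \<lbrakk>maximalideal N R; x \<in> N; N \<noteq> M\<rbrakk> \<Longrightarrow> e \<in> N"
proof -
  interpret ISP_domain R by (rule ZPUI_ISP)
  note p = maximalideal_prime[OF M] and Mi = maximal_is_ideal[OF M]
  note xc = ideal.Icarr[OF Mi x(1)]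
  \<comment> \<open>The square leaves room for the prime factor: at \<open>M\<close> that factor
    takes one generator \<open>\<pi>\<close> out of \<open>(x\<^sup>2)\<close>, and since
    \<open>\<pi>\<close> divides \<open>x\<close> the rest still lies in \<open>(x)\<close>.\<close>
  let ?z = "x \<otimes> x"
  have zc: "?z \<in> carrier R" "?z \<noteq> \<zero>" "?z \<in> M"
    using xc x integral_iff ideal.I_l_closed[OF Mi] by auto
  note zi = cgenideal_ideal[OF zc(1)]
  define I where "I = sat M (PIdl ?z)"
  have Ii: "ideal I R" unfolding I_def by (rule sat_ideal[OF p zi])
  have zI: "?z \<in> I" unfolding I_def using subset_sat[OF p zi] cgenideal_self[OF zc(1)] by blast
  have IM: "I \<subseteq> M" unfolding I_def
    using zc PIdl_subset_iff[OF Mi zc(1)] by (intro sat_subset_prime[OF p]) auto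
  have I0: "I \<noteq> {\<zero>}" using zI zc(2) by auto
  have Ic: "I \<noteq> carrier R" using IM prime_one_notin[OF p] by auto
  have other: "\<not> I \<subseteq> N" if N: "maximalideal N R" "N \<noteq> M" for N
    unfolding I_def
    using principal_saturation_not_le[OF p maximalideal_prime[OF N(1)] zc(1,2)]
      nonzero_prime_in_unique_maximal[OF _ _ N(1) M] N(2) by blast
  obtain J Ps where J: "invertible_ideal R J" and ne: "Ps \<noteq> []"
    and Pp: "\<And>P. P \<in> set Ps \<Longrightarrow> primeideal P R"
    and com: "\<And>i j. \<lbrakk>i < length Ps; j < length Ps; i \<noteq> j\<rbrakk> \<Longrightarrow> comaximal R (Ps ! i) (Ps ! j)"
    and eq: "I = J \<cdot> ideal_list_prod R Ps"
    using ZPUI[OF Ii I0 Ic] by blast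
  note Ji = invertible_is_ideal[OF J]
  have Psi: "\<And>P. P \<in> set Ps \<Longrightarrow> ideal P R" using Pp prime_is_ideal by blast
  have Li: "ideal (ideal_list_prod R Ps) R" using Psi by (rule list_prod_ideal)
  have IJ: "I \<subseteq> J" unfolding eq by (rule ideal_prod_subset_left[OF Ji Li])
  have IL: "I \<subseteq> ideal_list_prod R Ps" unfolding eq by (rule ideal_prod_subset_right[OF Ji Li])
  have PM: "P \<subseteq> M" if P: "P \<in> set Ps" for P
  proof -
    have "P \<noteq> carrier R" using Pp[OF P] primeideal.I_notcarr by blast
    then obtain N where N: "maximalideal N R" "P \<subseteq> N" using maximal_ideal_ge[OF Psi[OF P]] by blast
    have "I \<subseteq> N" using IL list_prod_subset_mem[OF Psi P] N(2) by blast
    then show ?thesis using other[OF N(1)] N(2) by blast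
  qed
  obtain P Pr where Pr: "Ps = P # Pr" using ne by (cases Ps) auto
  \<comment> \<open>Two comaximal ideals cannot both lie in \<open>M\<close>.\<close>
  have "Pr = []"
  proof (rule ccontr)
    assume "Pr \<noteq> []"
    then obtain P' Pr' where Pr': "Pr = P' # Pr'" by (cases Pr) auto
    have "comaximal R P P'" using com[of 0 1] by (simp add: Pr Pr')
    moreover have "P <+> P' \<subseteq> M" using PM by (intro add_ideal_subset[OF Mi]) (auto simp: Pr Pr')
    ultimately show False using prime_one_notin[OF p] by (auto simp: comaximal_def)
  qed
  have P: "primeideal P R" "ideal P R" "P \<subseteq> M" using Pp Psi PM Pr by auto
  have IJP: "I = J \<cdot> P" using eq Pr \<open>Pr = []\<close> ideal_prod_one[OF P(2)] by simp
  have PJ: "P \<cdot> J = I" unfolding IJP by (rule ideal_prod_commute[OF P(2) Ji])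
  have "?z \<in> sat M (P \<cdot> J)" unfolding PJ using subset_sat[OF p Ii] zI by blast
  then obtain \<pi> where pi: "\<pi> \<in> P" "P \<subseteq> sat M (PIdl \<pi>)"
    using factor_locally_principal[OF p P(2) Ji zc(1,2)] PJ I_def by blast
  have pic: "\<pi> \<in> carrier R" using pi(1) ideal.Icarr[OF P(2)] by blast
  have zP: "?z \<in> P" using zI ideal_prod_subset_left[OF P(2) Ji] PJ by blast
  then have pi0: "\<pi> \<noteq> \<zero>" using mem_sat_zero[OF p, of ?z] pi(2) zc(2) by blast
  have "P = sat M (PIdl \<pi>)"
    using pi sat_subset_prime[OF P(1,3), of "PIdl \<pi>"] PIdl_subset_iff[OF P(2) pic] by blast
  then have PM': "P = M"
    by (rule radical_locally_principal_eq[OF p prime_radical[OF P(1)] P(3) pic pi0])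
  obtain y s where y: "y \<in> J" "s \<in> carrier R - M" "\<And>j. j \<in> J \<Longrightarrow> s \<otimes> j \<in> PIdl y"
    using invertible_common_multiplier[OF J p] by blast
  note yc = ideal.Icarr[OF Ji y(1)]
  have sc: "s \<in> carrier R" using y(2) by simp
  \<comment> \<open>Otherwise \<open>x = r y\<close> locally with \<open>r\<close> in
    \<open>M\<close>. From \<open>y \<pi> = q x x\<close> and \<open>x = c \<pi>\<close>, cancelling
    \<open>y \<pi>\<close> gives \<open>1 = q c r\<close> up to denominators, which is
    impossible.\<close>
  have "y \<in> sat M (PIdl x)"
  proof (rule ccontr)
    assume nin: "y \<notin> sat M (PIdl x)"
    then have "x \<in> sat M (PIdl y)" using ISP_sat_cases[OF p xc yc] by blast
    then obtain w r where w: "w \<in> carrier R - M" "r \<in> carrier R" "w \<otimes> x = r \<otimes> y"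
      unfolding mem_sat_PIdl by blast
    have wc: "w \<in> carrier R" using w by simp
    have rM: "r \<in> M"
    proof (rule ccontr)
      assume "r \<notin> M"
      then have "y \<in> sat M (PIdl x)" unfolding mem_sat_PIdl using w wc yc w(3)[symmetric] by blast
      then show False using nin by simp
    qed
    have y0: "y \<noteq> \<zero>" using nin ideal_zero_mem[OF sat_ideal[OF p cgenideal_ideal[OF xc]]] by blast
    have "y \<otimes> \<pi> \<in> I" unfolding IJP using y(1) pi(1) by (rule ideal_prod.prod)
    then obtain t q where t: "t \<in> carrier R - M" "q \<in> carrier R" "t \<otimes> (y \<otimes> \<pi>) = q \<otimes> ?z"
      unfolding I_def mem_sat_PIdl by blast
    have "x \<in> sat M (PIdl \<pi>)" using x(1) pi(2) PM' by blast
    then obtain u c where u: "u \<in> carrier R - M" "c \<in> carrier R" "u \<otimes> x = c \<otimes> \<pi>"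
      unfolding mem_sat_PIdl by blast
    have tc: "t \<in> carrier R" and uc: "u \<in> carrier R" using t u by auto
    have "(y \<otimes> \<pi>) \<otimes> (u \<otimes> (w \<otimes> t)) = u \<otimes> (w \<otimes> (t \<otimes> (y \<otimes> \<pi>)))"
      using tc uc wc yc pic by (simp add: m_ac)
    also have "\<dots> = q \<otimes> ((u \<otimes> x) \<otimes> (w \<otimes> x))" unfolding t(3) using t(2) uc wc xc by (simp add: m_ac)
    also have "\<dots> = (y \<otimes> \<pi>) \<otimes> (q \<otimes> c \<otimes> r)"
      unfolding u(3) w(3) using t(2) u(2) w(2) yc pic by (simp add: m_ac)
    finally have "u \<otimes> (w \<otimes> t) = q \<otimes> c \<otimes> r"
      using m_lcancel[of "y \<otimes> \<pi>" "u \<otimes> (w \<otimes> t)" "q \<otimes> c \<otimes> r"] y0 pi0 yc pic uc wc tc t(2) u(2) w(2)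
      by (simp add: integral_iff)
    then have "u \<otimes> (w \<otimes> t) \<in> M" using rM t(2) u(2) ideal.I_l_closed[OF Mi] by simp
    then show False using prime_mult_compl[OF p u(1) prime_mult_compl[OF p w(1) t(1)]] by blast
  qed
  then obtain t r where t: "t \<in> carrier R - M" "r \<in> carrier R" "t \<otimes> y = r \<otimes> x"
    unfolding mem_sat_PIdl by blast
  have tc: "t \<in> carrier R" using t(1) by simp
  have tsM: "t \<otimes> s \<in> carrier R - M" by (rule prime_mult_compl[OF p t(1) y(2)])
  have tsJ: "(t \<otimes> s) \<otimes> j \<in> PIdl x" if j: "j \<in> J" for j
  proof -
    note jc = ideal.Icarr[OF Ji j]
    obtain c where c: "c \<in> carrier R" "s \<otimes> j = c \<otimes> y" using y(3)[OF j] by (auto simp: PIdl_iff)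
    have "(t \<otimes> s) \<otimes> j = t \<otimes> (s \<otimes> j)" using tc sc jc by (simp add: m_assoc)
    also have "\<dots> = c \<otimes> (t \<otimes> y)" unfolding c(2) using c(1) tc yc by (simp add: m_ac)
    also have "\<dots> = (c \<otimes> r) \<otimes> x" unfolding t(3) using c(1) t(2) xc by (simp add: m_assoc)
    finally show ?thesis using c(1) t(2) by (auto simp: PIdl_iff)
  qed
  have "t \<otimes> s \<in> N" if N: "maximalideal N R" "x \<in> N" "N \<noteq> M" for N
  proof -
    obtain j where j: "j \<in> J" "j \<notin> N" using other[OF N(1,3)] IJ by blast
    note jc = ideal.Icarr[OF Ji j(1)]
    have "PIdl x \<subseteq> N" using N(2) PIdl_subset_iff[OF maximal_is_ideal[OF N(1)] xc] by blast
    then have "(t \<otimes> s) \<otimes> j \<in> N" using tsJ[OF j(1)] by blast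
    then show ?thesis using primeideal.I_prime[OF maximalideal_prime[OF N(1)], of "t \<otimes> s" j] tsM jc j(2) by blast
  qed
  then show thesis using that tsM by blast
qed

text \<open>The elements lying in all but finitely many of the maximal ideals that contain
  \<open>x\<close> form an ideal \<open>T\<close>. It contains \<open>x\<close> and an isolating
  element for each of these maximal ideals, so it is proper in none of them and contains
  \<open>\<one>\<close>, which lies in no maximal ideal.\<close>

lemma ZPUI_h_local: "h_local_domain R"
proof (rule h_local_domainI)
  show "M = N" if "primeideal P R" "P \<noteq> {\<zero>}" "maximalideal M R" "maximalideal N R" "P \<subseteq> M" "P \<subseteq> N" for P M N
    using ISP_domain.nonzero_prime_in_unique_maximal[OF ZPUI_ISP that] .
next
  fix x assume x: "x \<in> carrier R" "x \<noteq> \<zero>"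
  define X where "X = {M. maximalideal M R \<and> x \<in> M}"
  define T where "T = {z \<in> carrier R. \<exists>Y. finite Y \<and> (\<forall>N\<in>X - Y. z \<in> N)}"
  have T: "ideal T R"
  proof (rule cring_idealI)
    show "T \<subseteq> carrier R" by (auto simp: T_def)
    show "\<zero> \<in> T" using ideal_zero_mem[OF maximal_is_ideal] by (auto simp: T_def X_def intro!: exI[of _ "{}"])
    show "r \<otimes> z \<in> T" if rz: "r \<in> carrier R" "z \<in> T" for r z
    proof -
      obtain Y where "z \<in> carrier R" "finite Y" "\<forall>N\<in>X - Y. z \<in> N" using rz by (auto simp: T_def)
      moreover have "r \<otimes> z \<in> N" if "N \<in> X" "z \<in> N" for N
        using that rz(1) ideal.I_l_closed[OF maximal_is_ideal] by (auto simp: X_def)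
      ultimately show ?thesis using rz(1) by (auto simp: T_def)
    qed
    show "y \<oplus> z \<in> T" if yz: "y \<in> T" "z \<in> T" for y z
    proof -
      obtain Y where Y: "y \<in> carrier R" "finite Y" "\<forall>N\<in>X - Y. y \<in> N" using yz by (auto simp: T_def)
      obtain Z where Z: "z \<in> carrier R" "finite Z" "\<forall>N\<in>X - Z. z \<in> N" using yz by (auto simp: T_def)
      have "\<forall>N\<in>X - (Y \<union> Z). y \<oplus> z \<in> N"
        using Y(3) Z(3) ideal_add_mem[OF maximal_is_ideal] by (auto simp: X_def)
      moreover have "finite (Y \<union> Z)" using Y(2) Z(2) by simp
      ultimately show ?thesis unfolding T_def using Y(1) Z(1) by blast
    qed
  qed
  have "T = carrier R"
  proof (rule ccontr)
    assume "T \<noteq> carrier R"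
    then obtain M where M: "maximalideal M R" "T \<subseteq> M" using maximal_ideal_ge[OF T] by blast
    have "x \<in> T" using x(1) unfolding T_def X_def by (intro CollectI conjI exI[of _ "{}"]) auto
    then have xM: "x \<in> M" using M by blast
    obtain e where e: "e \<in> carrier R - M" "\<And>N. \<lbrakk>maximalideal N R; x \<in> N; N \<noteq> M\<rbrakk> \<Longrightarrow> e \<in> N"
      using isolating_element[OF M(1) xM x(2)] by blast
    have "e \<in> T" using e unfolding T_def X_def by (intro CollectI conjI exI[of _ "{M}"]) auto
    then show False using e M by blast
  qed
  then have "\<one> \<in> T" by simp
  then obtain Y where Y: "finite Y" "\<forall>N\<in>X - Y. \<one> \<in> N" by (auto simp: T_def)
  have "X \<subseteq> Y" using Y(2) prime_one_notin[OF maximalideal_prime] by (auto simp: X_def)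
  then have "finite X" using Y(1) by (rule finite_subset)
  then show "finite {M. maximalideal M R \<and> x \<in> M}" by (simp add: X_def)
qed

end

section \<open>Factorization in h-local strongly discrete Pruefer domains\<close>

lemma (in cring) list_prod_mult:
  assumes "\<And>x. x \<in> set xs \<Longrightarrow> ideal (f x) R \<and> ideal (g x) R"
  shows "ideal_list_prod R (map (\<lambda>x. f x \<cdot> g x) xs) = ideal_list_prod R (map f xs) \<cdot> ideal_list_prod R (map g xs)"
  using assms
proof (induct xs)
  case Nil
  then show ?case by (simp add: carrier_ideal_prod oneideal)
next
  case (Cons x xs)
  have i: "ideal (f x) R" "ideal (g x) R" "ideal (ideal_list_prod R (map f xs)) R" "ideal (ideal_list_prod R (map g xs)) R"
    using Cons.prems by (auto intro!: list_prod_ideal)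
  let ?F = "ideal_list_prod R (map f xs)" and ?G = "ideal_list_prod R (map g xs)"
  have "(f x \<cdot> g x) \<cdot> (?F \<cdot> ?G) = f x \<cdot> (g x \<cdot> (?F \<cdot> ?G))" using i by (intro ideal_prod_assoc ideal_prod_is_ideal)
  also have "g x \<cdot> (?F \<cdot> ?G) = (g x \<cdot> ?F) \<cdot> ?G" using i by (intro ideal_prod_assoc[symmetric])
  also have "g x \<cdot> ?F = ?F \<cdot> g x" using i by (intro ideal_prod_commute)
  also have "(?F \<cdot> g x) \<cdot> ?G = ?F \<cdot> (g x \<cdot> ?G)" using i by (intro ideal_prod_assoc)
  also have "f x \<cdot> (?F \<cdot> (g x \<cdot> ?G)) = (f x \<cdot> ?F) \<cdot> (g x \<cdot> ?G)"
    using i by (intro ideal_prod_assoc[symmetric] ideal_prod_is_ideal)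
  finally show ?case using Cons by simp
qed

context pruefer_domain
begin

text \<open>Being outside \<open>N\<close>, \<open>s\<close> is not a local multiple of any
  \<open>z\<close> in \<open>N\<close>; by comparability it divides \<open>z\<close>.\<close>

lemma pruefer_subprime_sat:
  assumes P: "primeideal P R" and N: "primeideal N R" "N \<subseteq> P" and s: "s \<in> carrier R - N"
  shows "N \<subseteq> sat P (N \<cdot> (PIdl s))"
proof (rule subprime_subset_sat_prod[OF N(1) s])
  show "N \<subseteq> sat P (PIdl s)"
  proof
    fix z assume z: "z \<in> N"
    note Ni = prime_is_ideal[OF N(1)]
    note zc = ideal.Icarr[OF Ni z]
    have sc: "s \<in> carrier R" using s by simp
    have "s \<notin> sat P (PIdl z)"
      using sat_subset_prime[OF N, of "PIdl z"] PIdl_subset_iff[OF Ni zc] z s by blast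
    then show "z \<in> sat P (PIdl s)" using pruefer_sat_cases[OF P zc sc] by blast
  qed
qed

text \<open>Multiples of \<open>N\<close> are already modules over the localization at \<open>N\<close>.\<close>

lemma pruefer_sat_subprime_prod:
  assumes P: "primeideal P R" and N: "primeideal N R" "N \<subseteq> P" and X: "ideal X R"
  shows "sat N (N \<cdot> X) = sat P (N \<cdot> X)"
proof
  note Ni = prime_is_ideal[OF N(1)]
  have NX: "ideal (N \<cdot> X) R" by (rule ideal_prod_is_ideal[OF Ni X])
  show "sat P (N \<cdot> X) \<subseteq> sat N (N \<cdot> X)" by (rule sat_antimono[OF N(2)])
  show "sat N (N \<cdot> X) \<subseteq> sat P (N \<cdot> X)"
  proof
    fix z assume "z \<in> sat N (N \<cdot> X)"
    then obtain s where s: "s \<in> carrier R - N" "z \<in> carrier R" "s \<otimes> z \<in> N \<cdot> X" by (rule satE)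
    have sc: "s \<in> carrier R" and s0: "s \<noteq> \<zero>" using s(1) ideal_zero_mem[OF Ni] by auto
    note si = cgenideal_ideal[OF sc]
    \<comment> \<open>As \<open>N\<close> is locally \<open>N s\<close>, a factor \<open>s\<close>
      can be split off from the product; it cancels the denominator.\<close>
    have "X \<cdot> N \<subseteq> sat P (X \<cdot> (N \<cdot> (PIdl s)))"
      by (rule sat_prod_subset[OF P X Ni X ideal_prod_is_ideal[OF Ni si] subset_sat[OF P X]
            pruefer_subprime_sat[OF P N s(1)]])
    then have "s \<otimes> z \<in> sat P ((N \<cdot> X) \<cdot> (PIdl s))"
      using s(3) ideal_prod_assoc[OF X Ni si] ideal_prod_commute[OF X Ni] by auto
    then obtain t where t: "t \<in> carrier R - P" "t \<otimes> (s \<otimes> z) \<in> (N \<cdot> X) \<cdot> (PIdl s)" by (rule satE)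
    then obtain w where w: "w \<in> N \<cdot> X" "t \<otimes> (s \<otimes> z) = w \<otimes> s" using mem_prod_PIdl[OF NX sc] by blast
    note wc = ideal.Icarr[OF NX w(1)]
    have tc: "t \<in> carrier R" using t(1) by simp
    have "s \<otimes> (t \<otimes> z) = t \<otimes> (s \<otimes> z)" using sc tc s(2) by (simp add: m_ac)
    also have "\<dots> = s \<otimes> w" unfolding w(2) using wc sc by (rule m_comm)
    finally have "t \<otimes> z = w" using m_lcancel[of s "t \<otimes> z" w] s0 sc tc s(2) wc by simp
    then show "z \<in> sat P (N \<cdot> X)" using w(1) t(1) s(2) by (auto intro: satI)
  qed
qed

end

context strongly_discrete_pruefer_domain
begin

text \<open>If \<open>P\<close> were idempotent at \<open>P\<close>, it would be so at every maximal
  ideal by \<open>pruefer_sat_subprime_prod\<close>, hence in the ring itself. An element outside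
  the local square then generates, because a proper divisor of it in \<open>P\<close> would put it
  into the square.\<close>

lemma strongly_discrete_prime_locally_principal:
  assumes P: "primeideal P R" "P \<noteq> {\<zero>}"
  obtains \<pi> where "\<pi> \<in> P" "P = sat P (PIdl \<pi>)"
proof -
  note Pi = prime_is_ideal[OF P(1)]
  have PP: "ideal (P \<cdot> P) R" by (rule ideal_prod_is_ideal[OF Pi Pi])
  have "\<not> P \<subseteq> sat P (P \<cdot> P)"
  proof
    assume idem: "P \<subseteq> sat P (P \<cdot> P)"
    have "P \<subseteq> P \<cdot> P"
    proof (rule ideal_subset_local[OF Pi PP])
      fix M assume M: "maximalideal M R"
      note p = maximalideal_prime[OF M]
      show "P \<subseteq> sat M (P \<cdot> P)"
      proof (cases "P \<subseteq> M")
        case False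
        then have "\<not> P \<cdot> P \<subseteq> M" using prime_inter_prod[OF p Pi Pi] by blast
        then show ?thesis using sat_eq_carrier[OF PP] ideal_subset_carrier[OF Pi] by simp
      next
        case True
        then show ?thesis using idem pruefer_sat_subprime_prod[OF p P(1) _ Pi] by simp
      qed
    qed
    then have "P \<cdot> P = P" using ideal_prod_subset_left[OF Pi Pi] by blast
    then show False using idempotent_prime[OF P(1)] P(2) by blast
  qed
  then obtain \<pi> where pi: "\<pi> \<in> P" "\<pi> \<notin> sat P (P \<cdot> P)" by blast
  note pic = ideal.Icarr[OF Pi pi(1)]
  have "P \<subseteq> sat P (PIdl \<pi>)"
  proof
    fix z assume z: "z \<in> P"
    note zc = ideal.Icarr[OF Pi z]
    show "z \<in> sat P (PIdl \<pi>)"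
    proof (rule ccontr)
      assume nin: "z \<notin> sat P (PIdl \<pi>)"
      then have "\<pi> \<in> sat P (PIdl z)" using pruefer_sat_cases[OF P(1) zc pic] by blast
      then obtain s r where s: "s \<in> carrier R - P" "r \<in> carrier R" "s \<otimes> \<pi> = r \<otimes> z"
        unfolding mem_sat_PIdl by blast
      have "r \<notin> P"
      proof
        assume "r \<in> P"
        then have "s \<otimes> \<pi> \<in> P \<cdot> P" unfolding s(3) using z by (rule ideal_prod.prod)
        then show False using pi(2) s(1) pic by (auto intro: satI)
      qed
      then have "z \<in> sat P (PIdl \<pi>)" unfolding mem_sat_PIdl using s s(3)[symmetric] zc by blast
      then show False using nin by simp
    qed
  qed
  moreover have "sat P (PIdl \<pi>) \<subseteq> P"
    using pi(1) PIdl_subset_iff[OF Pi pic] by (intro sat_subset_prime[OF P(1)]) auto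
  ultimately show thesis using that pi(1) by blast
qed

text \<open>In a strongly discrete valuation domain every nonzero proper ideal \<open>I\<close> is \<open>c P\<close>, where the
  prime ideal \<open>P\<close> consists of the elements \<open>r\<close> with \<open>r I \<noteq> I\<close>.\<close>

lemma local_ideal_form:
  assumes M: "primeideal M R" and I: "ideal I R" "I \<noteq> {\<zero>}" "I \<subseteq> M"
  obtains c P where "c \<in> carrier R" "c \<noteq> \<zero>" "primeideal P R" "P \<noteq> {\<zero>}" "P \<subseteq> M"
    "sat M I = sat M (P \<cdot> (PIdl c))"
proof -
  note Mi = prime_is_ideal[OF M]
  have Ic: "\<And>x. x \<in> I \<Longrightarrow> x \<in> carrier R" using ideal.Icarr[OF I(1)] by blast
  define S where "S = {r \<in> carrier R. I \<subseteq> sat M (I \<cdot> (PIdl r))}"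
  define P where "P = carrier R - S"
  have pid: "\<And>r. r \<in> carrier R \<Longrightarrow> ideal (PIdl r) R" by (rule cgenideal_ideal)
  have Ir: "\<And>r. r \<in> carrier R \<Longrightarrow> ideal (I \<cdot> (PIdl r)) R" using I(1) pid by (intro ideal_prod_is_ideal)
  have Smult: "a \<otimes> b \<in> S" if ab: "a \<in> S" "b \<in> S" for a b
  proof -
    have c: "a \<in> carrier R" "b \<in> carrier R" using ab by (auto simp: S_def)
    have "I \<cdot> (PIdl b) \<subseteq> sat M ((I \<cdot> (PIdl a)) \<cdot> (PIdl b))"
      using ab(1) by (intro sat_prod_subset[OF M I(1) pid[OF c(2)] Ir[OF c(1)] pid[OF c(2)] _ subset_sat[OF M pid[OF c(2)]]])
        (simp add: S_def)
    also have "(I \<cdot> (PIdl a)) \<cdot> (PIdl b) = I \<cdot> (PIdl (a \<otimes> b))"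
      using ideal_prod_assoc[OF I(1) pid[OF c(1)] pid[OF c(2)]] PIdl_prod[OF c] by simp
    finally have "sat M (I \<cdot> (PIdl b)) \<subseteq> sat M (I \<cdot> (PIdl (a \<otimes> b)))"
      using sat_least[OF M Ir] c by simp
    then show ?thesis using ab c by (auto simp: S_def)
  qed
  have Sdiv: "a \<in> S" if ab: "a \<in> carrier R" "b \<in> carrier R" "b \<otimes> a \<in> S" for a b
  proof -
    have "b \<otimes> a \<in> PIdl a" using ab by (auto simp: PIdl_iff)
    then have "PIdl (b \<otimes> a) \<subseteq> PIdl a" using PIdl_subset_iff[OF pid[OF ab(1)]] ab by simp
    then have "I \<cdot> (PIdl (b \<otimes> a)) \<subseteq> I \<cdot> (PIdl a)" by (rule ideal_prod_mono[OF subset_refl _ I(1) pid[OF ab(1)]])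
    then have "sat M (I \<cdot> (PIdl (b \<otimes> a))) \<subseteq> sat M (I \<cdot> (PIdl a))" by (rule sat_mono)
    then show ?thesis using ab by (auto simp: S_def)
  qed
  have Sunit: "t \<in> S" if t: "t \<in> carrier R - M" for t
  proof -
    have "\<not> PIdl t \<subseteq> M" using t PIdl_subset_iff[OF Mi] by blast
    then have "I \<subseteq> sat M (I \<cdot> (PIdl t))" using t by (intro subset_sat_prod[OF I(1) pid]) auto
    then show ?thesis using t by (simp add: S_def)
  qed
  have PM: "P \<subseteq> M" using Sunit by (auto simp: P_def)
  have IP: "I \<subseteq> P"
  proof
    fix r assume r: "r \<in> I"
    have "r \<notin> S"
    proof
      assume rS: "r \<in> S"
      obtain x where x: "x \<in> I" "x \<noteq> \<zero>" using I(2) ideal_zero_mem[OF I(1)] by blast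
      have xc: "x \<in> carrier R" using x(1) Ic by blast
      have r0: "r \<noteq> \<zero>"
      proof
        assume r0: "r = \<zero>"
        have "x \<in> sat M (I \<cdot> (PIdl \<zero>))" using rS x(1) r0 by (auto simp: S_def)
        then obtain s where s: "s \<in> carrier R - M" "s \<otimes> x \<in> I \<cdot> (PIdl \<zero>)" by (rule satE)
        then obtain i where "i \<in> I" "s \<otimes> x = i \<otimes> \<zero>" using mem_prod_PIdl[OF I(1) zero_closed] by blast
        then have "s \<otimes> x = \<zero>" using Ic by simp
        then have "s = \<zero>" using integral[of s x] s(1) xc x(2) by blast
        then show False using s(1) ideal_zero_mem[OF Mi] by simp
      qed
      have "r \<in> sat M (I \<cdot> (PIdl r))" using rS r by (auto simp: S_def)
      then obtain s where s: "s \<in> carrier R - M" "s \<otimes> r \<in> I \<cdot> (PIdl r)" by (rule satE)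
      obtain i where i: "i \<in> I" "s \<otimes> r = i \<otimes> r" using s(2) mem_prod_PIdl[OF I(1) Ic[OF r]] by blast
      have "s \<in> carrier R" using s by simp
      then have "s = i" using m_rcancel[OF r0 Ic[OF r] _ Ic[OF i(1)]] i(2) by blast
      then show False using s(1) i(1) I(3) by blast
    qed
    then show "r \<in> P" using Ic[OF r] by (simp add: P_def)
  qed
  \<comment> \<open>By comparability it suffices to treat \<open>b\<close> as a local multiple of
    \<open>a\<close>; then \<open>a \<oplus> b\<close> is one too, and a factor of an element of
    \<open>S\<close> belongs to \<open>S\<close>.\<close>
  have add: "a \<oplus> b \<in> P" if ab: "a \<in> P" "b \<in> P" and bs: "b \<in> sat M (PIdl a)" for a b
  proof -
    have c: "a \<in> carrier R" "b \<in> carrier R" using ab by (auto simp: P_def)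
    obtain t u where t: "t \<in> carrier R - M" "u \<in> carrier R" "t \<otimes> b = u \<otimes> a"
      using bs unfolding mem_sat_PIdl by blast
    have tc: "t \<in> carrier R" using t by simp
    have eq: "t \<otimes> (a \<oplus> b) = (t \<oplus> u) \<otimes> a" using tc t(2,3) c by (simp add: r_distr l_distr)
    have "a \<oplus> b \<notin> S"
    proof
      assume "a \<oplus> b \<in> S"
      then have "(t \<oplus> u) \<otimes> a \<in> S" using Smult[OF Sunit[OF t(1)]] eq by metis
      then have "a \<in> S" using Sdiv[OF c(1), of "t \<oplus> u"] tc t(2) by simp
      then show False using ab by (simp add: P_def)
    qed
    then show ?thesis using c by (simp add: P_def)
  qed
  have P: "primeideal P R"
  proof (rule primeidealI[OF _ is_cring])
    show "ideal P R"
    proof (rule cring_idealI)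
      show "P \<subseteq> carrier R" by (auto simp: P_def)
      show "\<zero> \<in> P" using IP ideal_zero_mem[OF I(1)] by blast
      show "a \<oplus> b \<in> P" if ab: "a \<in> P" "b \<in> P" for a b
      proof -
        have c: "a \<in> carrier R" "b \<in> carrier R" using ab by (auto simp: P_def)
        show ?thesis using pruefer_sat_cases[OF M c] add[OF ab] add[OF ab(2,1)] a_comm[OF c] by auto
      qed
      show "r \<otimes> a \<in> P" if "r \<in> carrier R" "a \<in> P" for r a using that Sdiv[of a r] by (auto simp: P_def)
    qed
    show "carrier R \<noteq> P" using PM prime_one_notin[OF M] by auto
    show "a \<in> P \<or> b \<in> P" if "a \<in> carrier R" "b \<in> carrier R" "a \<otimes> b \<in> P" for a b
      using that Smult by (auto simp: P_def)
  qed
  note Pi = prime_is_ideal[OF P]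
  have P0: "P \<noteq> {\<zero>}" using IP I(2) ideal_zero_mem[OF I(1)] by blast
  have compl: "s \<in> S" "s \<noteq> \<zero>" "s \<in> carrier R" if "s \<in> carrier R - P" for s
    using that ideal_zero_mem[OF Pi] by (auto simp: P_def)
  have absorb: "\<exists>t\<in>carrier R - M. \<exists>i\<in>I. t \<otimes> x = i \<otimes> s" if x: "x \<in> I" and s: "s \<in> carrier R - P" for x s
  proof -
    have "x \<in> sat M (I \<cdot> (PIdl s))" using compl(1)[OF s] x by (auto simp: S_def)
    then obtain t where "t \<in> carrier R - M" "t \<otimes> x \<in> I \<cdot> (PIdl s)" by (rule satE)
    then show ?thesis using mem_prod_PIdl[OF I(1) compl(3)[OF s]] by blast
  qed
  obtain \<pi> where pi: "\<pi> \<in> P" "P = sat P (PIdl \<pi>)" using strongly_discrete_prime_locally_principal[OF P P0] by blast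
  note pic = ideal.Icarr[OF Pi pi(1)]
  \<comment> \<open>Since \<open>\<pi>\<close> is in \<open>P\<close>, multiplying by it shrinks
    \<open>I\<close>; an element \<open>a\<close> that is lost generates \<open>I\<close> at
    \<open>P\<close>.\<close>
  have "\<not> I \<subseteq> sat M (I \<cdot> (PIdl \<pi>))" using pi(1) pic by (auto simp: P_def S_def)
  then obtain a where a: "a \<in> I" "a \<notin> sat M (I \<cdot> (PIdl \<pi>))" by blast
  have ac: "a \<in> carrier R" using a(1) Ic by blast
  have a0: "a \<noteq> \<zero>" using a(2) ideal_zero_mem[OF sat_ideal[OF M Ir[OF pic]]] by blast
  have ai: "ideal (PIdl a) R" using ac by (rule pid)
  have satMP: "sat M (sat P X) \<subseteq> sat P X" if "ideal X R" for X
    using sat_antimono[OF PM, of "sat P X"] sat_idem[OF P that] by simp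
  \<comment> \<open>If \<open>a\<close> did not divide \<open>b\<close> at \<open>P\<close>, then
    \<open>a = r b\<close> with \<open>r\<close> in \<open>P\<close>, hence a multiple of
    \<open>\<pi>\<close>. Denominators outside \<open>P\<close> are absorbed by \<open>I\<close>, so
    \<open>a\<close> would lie in \<open>I \<pi>\<close> at \<open>M\<close>.\<close>
  have I_le: "I \<subseteq> sat P (PIdl a)"
  proof
    fix b assume b: "b \<in> I"
    note bc = Ic[OF b]
    show "b \<in> sat P (PIdl a)"
    proof (rule ccontr)
      assume nin: "b \<notin> sat P (PIdl a)"
      then have "a \<in> sat P (PIdl b)" using pruefer_sat_cases[OF P bc ac] by blast
      then obtain s r where s: "s \<in> carrier R - P" "r \<in> carrier R" "s \<otimes> a = r \<otimes> b"
        unfolding mem_sat_PIdl by blast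
      have "r \<in> P"
      proof (rule ccontr)
        assume "r \<notin> P"
        then have "b \<in> sat P (PIdl a)" unfolding mem_sat_PIdl using s s(3)[symmetric] bc by blast
        then show False using nin by simp
      qed
      then have "r \<in> sat P (PIdl \<pi>)" using pi(2) by blast
      then obtain s' d where s': "s' \<in> carrier R - P" "d \<in> carrier R" "s' \<otimes> r = d \<otimes> \<pi>"
        unfolding mem_sat_PIdl by blast
      note w = prime_mult_compl[OF P s'(1) s(1)]
      note sc = compl(3)[OF s(1)] and sc' = compl(3)[OF s'(1)]
      have "d \<otimes> b \<in> I" using b s'(2) ideal.I_l_closed[OF I(1)] by blast
      then obtain t i where t: "t \<in> carrier R - M" "i \<in> I" "t \<otimes> (d \<otimes> b) = i \<otimes> (s' \<otimes> s)"
        using absorb[OF _ w] by blast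
      have tc: "t \<in> carrier R" using t by simp
      note ic = Ic[OF t(2)]
      have "(s' \<otimes> s) \<otimes> (t \<otimes> a) = t \<otimes> (s' \<otimes> (s \<otimes> a))" using sc sc' tc ac by (simp add: m_ac)
      also have "\<dots> = t \<otimes> ((s' \<otimes> r) \<otimes> b)" unfolding s(3) using sc' s(2) bc by (simp add: m_ac)
      also have "\<dots> = (t \<otimes> (d \<otimes> b)) \<otimes> \<pi>" unfolding s'(3) using tc s'(2) bc pic by (simp add: m_ac)
      also have "\<dots> = (s' \<otimes> s) \<otimes> (i \<otimes> \<pi>)" unfolding t(3) using ic sc sc' pic by (simp add: m_ac)
      finally have "t \<otimes> a = i \<otimes> \<pi>"
        using m_lcancel[of "s' \<otimes> s" "t \<otimes> a" "i \<otimes> \<pi>"] compl(2,3)[OF w] tc ac ic pic by simp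
      then have "t \<otimes> a \<in> I \<cdot> (PIdl \<pi>)" using t(2) mem_prod_PIdl[OF I(1) pic] by blast
      then show False using a(2) t(1) ac by (auto intro: satI)
    qed
  qed
  have le_I: "sat P (PIdl a) \<subseteq> sat M I"
  proof
    fix b assume "b \<in> sat P (PIdl a)"
    then obtain s r where b: "b \<in> carrier R" and s: "s \<in> carrier R - P" "r \<in> carrier R" "s \<otimes> b = r \<otimes> a"
      unfolding mem_sat_PIdl by blast
    have "r \<otimes> a \<in> I" using a(1) s(2) ideal.I_l_closed[OF I(1)] by blast
    then obtain t i where t: "t \<in> carrier R - M" "i \<in> I" "t \<otimes> (r \<otimes> a) = i \<otimes> s"
      using absorb[OF _ s(1)] by blast
    have tc: "t \<in> carrier R" using t by simp
    note ic = Ic[OF t(2)] and sc = compl(3)[OF s(1)]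
    have "s \<otimes> (t \<otimes> b) = t \<otimes> (s \<otimes> b)" using sc tc b by (simp add: m_ac)
    also have "\<dots> = s \<otimes> i" unfolding s(3) t(3) using ic sc by (rule m_comm)
    finally have "t \<otimes> b = i" using m_lcancel[of s "t \<otimes> b" i] compl(2)[OF s(1)] sc tc b ic by simp
    then show "b \<in> sat M I" using t b by (auto intro: satI)
  qed
  have eqI: "sat M I = sat P (PIdl a)"
    using le_I sat_mono[OF I_le, of M] satMP[OF ai] by blast
  \<comment> \<open>Writing \<open>a = c \<pi>\<close> at \<open>P\<close> turns \<open>(a)\<close>
    into \<open>c P\<close>; this is the origin of \<open>c\<close>.\<close>
  have "a \<in> sat P (PIdl \<pi>)" using a(1) IP pi(2) by blast
  then obtain s c where s: "s \<in> carrier R - P" "c \<in> carrier R" "s \<otimes> a = c \<otimes> \<pi>"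
    unfolding mem_sat_PIdl by blast
  note sc = compl(3)[OF s(1)]
  have c0: "c \<noteq> \<zero>"
  proof
    assume "c = \<zero>"
    then have "s \<otimes> a = \<zero>" using s(3) pic by simp
    then show False using integral[of s a] sc ac a0 compl(2)[OF s(1)] by blast
  qed
  have ci: "ideal (PIdl c) R" using s(2) by (rule pid)
  have "sat P (PIdl a) = sat P ((PIdl c) \<cdot> P)"
  proof
    have "s \<otimes> a \<in> (PIdl c) \<cdot> P"
      unfolding s(3) using cgenideal_self[OF s(2)] pi(1) by (rule ideal_prod.prod)
    then have "a \<in> sat P ((PIdl c) \<cdot> P)" using s(1) ac by (auto intro: satI)
    then have "PIdl a \<subseteq> sat P ((PIdl c) \<cdot> P)"
      using PIdl_subset_iff[OF sat_ideal[OF P ideal_prod_is_ideal[OF ci Pi]] ac] by blast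
    then show "sat P (PIdl a) \<subseteq> sat P ((PIdl c) \<cdot> P)"
      by (rule sat_least[OF P ideal_prod_is_ideal[OF ci Pi]])
    have "(PIdl c) \<cdot> P \<subseteq> sat P ((PIdl c) \<cdot> (PIdl \<pi>))"
      by (rule sat_prod_subset[OF P ci Pi ci pid[OF pic] subset_sat[OF P ci] equalityD1[OF pi(2)]])
    also have "\<dots> = sat P (PIdl (s \<otimes> a))" using PIdl_prod[OF s(2) pic] s(3) by simp
    also have "\<dots> \<subseteq> sat P (PIdl a)"
      using PIdl_subset_iff[OF ai] sc ac by (intro sat_mono) (auto simp: PIdl_iff)
    finally show "sat P ((PIdl c) \<cdot> P) \<subseteq> sat P (PIdl a)" by (rule sat_least[OF P ai])
  qed
  then have "sat M I = sat M (P \<cdot> (PIdl c))"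
    using eqI pruefer_sat_subprime_prod[OF M P PM ci] ideal_prod_commute[OF ci Pi] by simp
  then show thesis using that[OF s(2) c0 P P0 PM] by blast
qed

text \<open>The ideal \<open>sat M (PIdl c)\<close> is trivial at all other maximal ideals, and
  finitely many of these contain \<open>c\<close>. So \<open>c\<close> and one element of it outside
  each of them generate it locally everywhere, hence globally, and the Pruefer property makes it
  invertible.\<close>

lemma h_local_saturation_factor:
  assumes hl: "h_local_domain R" and M: "maximalideal M R" and I: "ideal I R" "I \<noteq> {\<zero>}" "I \<subseteq> M"
  obtains J P where "invertible_ideal R J" "primeideal P R" "sat M I = J \<cdot> P"
    "\<And>N. \<lbrakk>maximalideal N R; N \<noteq> M\<rbrakk> \<Longrightarrow> \<not> J \<subseteq> N \<and> \<not> P \<subseteq> N"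
proof -
  note p = maximalideal_prime[OF M]
  obtain c P where c: "c \<in> carrier R" "c \<noteq> \<zero>" and P: "primeideal P R" "P \<noteq> {\<zero>}" "P \<subseteq> M"
    and eq: "sat M I = sat M (P \<cdot> (PIdl c))" using local_ideal_form[OF p I] by blast
  note Pi = prime_is_ideal[OF P(1)]
  note ci = cgenideal_ideal[OF c(1)]
  define J where "J = sat M (PIdl c)"
  have Ji: "ideal J R" unfolding J_def by (rule sat_ideal[OF p ci])
  have Jc: "\<And>x. x \<in> J \<Longrightarrow> x \<in> carrier R" using ideal.Icarr[OF Ji] by blast
  have cJ: "PIdl c \<subseteq> J" unfolding J_def by (rule subset_sat[OF p ci])
  then have cJ': "c \<in> J" using cgenideal_self[OF c(1)] by blast
  have JN: "\<not> J \<subseteq> N" if N: "maximalideal N R" "N \<noteq> M" for N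
    unfolding J_def
    using principal_saturation_not_le[OF p maximalideal_prime[OF N(1)] c]
      h_local_unique[OF hl _ _ N(1) M] N(2) by blast
  have PN: "\<not> P \<subseteq> N" if N: "maximalideal N R" "N \<noteq> M" for N
    using h_local_unique[OF hl P(1,2) N(1) M _ P(3)] N(2) by blast
  define X where "X = {N. maximalideal N R \<and> c \<in> N} - {M}"
  have finX: "finite X" unfolding X_def using h_local_finite[OF hl c] by simp
  have "\<exists>e. e \<in> J \<and> e \<notin> N" if "N \<in> X" for N using JN that by (auto simp: X_def)
  then obtain e where e: "\<And>N. N \<in> X \<Longrightarrow> e N \<in> J \<and> e N \<notin> N" by metis
  define T where "T = insert c (e ` X)"
  have T: "finite T" "T \<subseteq> J" using finX e cJ' by (auto simp: T_def)
  have Tc: "T \<subseteq> carrier R" using T(2) Jc by blast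
  define F where "F = Idl T"
  have Fi: "ideal F R" unfolding F_def by (rule genideal_ideal[OF Tc])
  have TF: "T \<subseteq> F" unfolding F_def by (rule genideal_self[OF Tc])
  have FJ: "F \<subseteq> J" unfolding F_def by (rule genideal_minimal[OF Ji T(2)])
  have "J \<subseteq> F"
  proof (rule ideal_subset_local[OF Ji Fi])
    fix N assume N: "maximalideal N R"
    show "J \<subseteq> sat N F"
    proof (cases "N = M")
      case True
      have "PIdl c \<subseteq> F" using TF PIdl_subset_iff[OF Fi c(1)] by (auto simp: T_def)
      then show ?thesis unfolding True J_def by (rule sat_mono)
    next
      case False
      have "\<not> F \<subseteq> N"
      proof (cases "c \<in> N")
        case True
        then have "N \<in> X" using N False by (simp add: X_def)
        then have "e N \<in> F" "e N \<notin> N" using e TF by (auto simp: T_def)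
        then show ?thesis by blast
      next
        case False
        moreover have "c \<in> F" using TF by (auto simp: T_def)
        ultimately show ?thesis by blast
      qed
      then show ?thesis using sat_eq_carrier[OF Fi] ideal_subset_carrier[OF Ji] by simp
    qed
  qed
  then have "fg_ideal R J" unfolding fg_ideal_def using FJ T(1) Tc F_def by blast
  moreover have "J \<noteq> {\<zero>}" using cJ' c(2) by auto
  ultimately have Jinv: "invertible_ideal R J" by (rule fg_invertible)
  have JPi: "ideal (J \<cdot> P) R" by (rule ideal_prod_is_ideal[OF Ji Pi])
  have "J \<cdot> P \<subseteq> sat M ((PIdl c) \<cdot> P)"
    by (rule sat_prod_subset[OF p Ji Pi ci Pi _ subset_sat[OF p Pi]]) (simp add: J_def)
  then have le: "J \<cdot> P \<subseteq> sat M I" unfolding eq using ideal_prod_commute[OF ci Pi] by simp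
  have "sat M I \<subseteq> J \<cdot> P"
  proof (rule ideal_subset_local[OF sat_ideal[OF p I(1)] JPi])
    fix N assume N: "maximalideal N R"
    show "sat M I \<subseteq> sat N (J \<cdot> P)"
    proof (cases "N = M")
      case True
      have "P \<cdot> (PIdl c) \<subseteq> P \<cdot> J" by (rule ideal_prod_mono[OF subset_refl cJ Pi Ji])
      then show ?thesis unfolding True eq using ideal_prod_commute[OF Pi Ji] by (intro sat_mono) simp
    next
      case False
      then have "\<not> J \<cdot> P \<subseteq> N"
        using prime_inter_prod[OF maximalideal_prime[OF N] Ji Pi] JN[OF N] PN[OF N] by blast
      then show ?thesis using sat_eq_carrier[OF JPi] sat_subset_carrier[of M I] by simp
    qed
  qed
  then have "sat M I = J \<cdot> P" using le by blast
  then show thesis using that[OF Jinv P(1)] JN PN by blast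
qed

lemma ZPUI_of_h_local:
  assumes hl: "h_local_domain R" shows "ZPUI_domain R"
proof
  fix I assume I: "ideal I R" "I \<noteq> {\<zero>}" "I \<noteq> carrier R"
  obtain x where x: "x \<in> I" "x \<noteq> \<zero>" using I ideal_zero_mem[OF I(1)] by blast
  have "finite {M. maximalideal M R \<and> x \<in> M}" by (rule h_local_finite[OF hl ideal.Icarr[OF I(1) x(1)] x(2)])
  then have "finite {M. maximalideal M R \<and> I \<subseteq> M}" by (rule finite_subset[rotated]) (use x in auto)
  then obtain Ms where Ms: "set Ms = {M. maximalideal M R \<and> I \<subseteq> M}" "distinct Ms"
    using finite_distinct_list[of "{M. maximalideal M R \<and> I \<subseteq> M}"] by auto
  have "\<exists>J P. invertible_ideal R J \<and> primeideal P R \<and> sat M I = J \<cdot> P \<and>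
      (\<forall>N. maximalideal N R \<and> N \<noteq> M \<longrightarrow> \<not> J \<subseteq> N \<and> \<not> P \<subseteq> N)" if M: "M \<in> set Ms" for M
  proof -
    have "maximalideal M R" "I \<subseteq> M" using M Ms by auto
    then show ?thesis using h_local_saturation_factor[OF hl _ I(1,2)] by metis
  qed
  then obtain J P where JP: "\<And>M. M \<in> set Ms \<Longrightarrow> invertible_ideal R (J M) \<and> primeideal (P M) R \<and>
      sat M I = J M \<cdot> P M \<and> (\<forall>N. maximalideal N R \<and> N \<noteq> M \<longrightarrow> \<not> J M \<subseteq> N \<and> \<not> P M \<subseteq> N)"
    by metis
  have JPi: "ideal (J M) R" "ideal (P M) R" "ideal (sat M I) R" if "M \<in> set Ms" for M
  proof -
    show "ideal (J M) R" "ideal (P M) R" using JP[OF that] invertible_is_ideal prime_is_ideal by blast+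
    have "maximalideal M R" using Ms(1) that by simp
    then show "ideal (sat M I) R" by (intro sat_ideal maximalideal_prime I(1))
  qed
  have other: "\<not> sat M I \<subseteq> N" if "M \<in> set Ms" "maximalideal N R" "N \<noteq> M" for M N
    using JP[OF that(1)] that(2,3) prime_inter_prod[OF maximalideal_prime[OF that(2)] JPi(1,2)[OF that(1)]]
    by simp
  have prod_ideal: "ideal (ideal_list_prod R (map (\<lambda>M. sat M I) Ls)) R" if "set Ls \<subseteq> set Ms" for Ls
    using that JPi by (intro list_prod_ideal) auto
  have away: "\<not> ideal_list_prod R (map (\<lambda>M. sat M I) Ls) \<subseteq> N"
    if "set Ls \<subseteq> set Ms" "maximalideal N R" "N \<notin> set Ls" for Ls N
  proof
    assume "ideal_list_prod R (map (\<lambda>M. sat M I) Ls) \<subseteq> N"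
    then have "\<exists>X\<in>set (map (\<lambda>M. sat M I) Ls). X \<subseteq> N"
      using that JPi by (intro list_prod_subset_prime[OF maximalideal_prime[OF that(2)]]) auto
    then show False using other that by auto
  qed
  have near: "sat N I \<subseteq> sat N (ideal_list_prod R (map (\<lambda>M. sat M I) Ls))"
    if "set Ls \<subseteq> set Ms" "distinct Ls" "N \<in> set Ls" for Ls N
    using that
  proof (induct Ls)
    case (Cons L Ls)
    let ?B = "ideal_list_prod R (map (\<lambda>M. sat M I) Ls)"
    have B: "ideal ?B R" using Cons.prems by (intro prod_ideal) auto
    have L: "ideal (sat L I) R" using Cons.prems JPi by auto
    have N: "maximalideal N R" using Cons.prems Ms by auto
    note p = maximalideal_prime[OF N]
    show ?case
    proof (cases "N = L")
      case True
      then have "\<not> ?B \<subseteq> N" using Cons.prems N by (intro away) auto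
      then have "sat L I \<subseteq> sat N (sat L I \<cdot> ?B)" by (rule subset_sat_prod[OF L B])
      then show ?thesis using True by simp
    next
      case False
      then have "sat N I \<subseteq> sat N ?B" using Cons by auto
      moreover have "\<not> sat L I \<subseteq> N" using False Cons.prems N by (intro other) auto
      then have "?B \<subseteq> sat N (?B \<cdot> sat L I)" by (rule subset_sat_prod[OF B L])
      then have "sat N ?B \<subseteq> sat N (?B \<cdot> sat L I)" by (rule sat_least[OF p ideal_prod_is_ideal[OF B L]])
      ultimately show ?thesis using ideal_prod_commute[OF B L] by simp
    qed
  qed simp
  let ?K = "ideal_list_prod R (map (\<lambda>M. sat M I) Ms)"
  have K: "ideal ?K R" by (rule prod_ideal) simp
  have "I = ?K"
  proof
    show "I \<subseteq> ?K"
    proof (rule ideal_subset_local[OF I(1) K])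
      fix N assume N: "maximalideal N R"
      show "I \<subseteq> sat N ?K"
      proof (cases "N \<in> set Ms")
        case True
        then show ?thesis using near[OF subset_refl Ms(2)] subset_sat[OF maximalideal_prime[OF N] I(1)] by blast
      next
        case False
        then show ?thesis using away[OF subset_refl N] sat_eq_carrier[OF K] ideal_subset_carrier[OF I(1)] by simp
      qed
    qed
    show "?K \<subseteq> I"
    proof (rule ideal_subset_local[OF K I(1)])
      fix N assume N: "maximalideal N R"
      show "?K \<subseteq> sat N I"
      proof (cases "N \<in> set Ms")
        case True
        then show ?thesis using JPi by (intro list_prod_subset_mem) auto
      next
        case False
        then have "\<not> I \<subseteq> N" using N Ms by auto
        then show ?thesis using sat_eq_carrier[OF I(1)] ideal_subset_carrier[OF K] by simp
      qed
    qed
  qed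
  also have "map (\<lambda>M. sat M I) Ms = map (\<lambda>M. J M \<cdot> P M) Ms" using JP by simp
  also have "ideal_list_prod R \<dots> = ideal_list_prod R (map J Ms) \<cdot> ideal_list_prod R (map P Ms)"
    using JPi by (intro list_prod_mult) auto
  finally have eq: "I = ideal_list_prod R (map J Ms) \<cdot> ideal_list_prod R (map P Ms)" .
  have inv: "invertible_ideal R (ideal_list_prod R (map J Ms))" using JP by (intro invertible_list_prod) auto
  obtain M where "maximalideal M R" "I \<subseteq> M" using maximal_ideal_ge[OF I(1,3)] by blast
  then have "M \<in> set Ms" using Ms by simp
  then have ne: "map P Ms \<noteq> []" by auto
  \<comment> \<open>The primes belonging to different maximal ideals have no maximal ideal in
    common, so their sum is the whole ring.\<close>
  have com: "comaximal R (map P Ms ! i) (map P Ms ! j)"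
    if "i < length (map P Ms)" "j < length (map P Ms)" "i \<noteq> j" for i j
  proof -
    let ?M = "Ms ! i" and ?N = "Ms ! j"
    have M: "?M \<in> set Ms" "?N \<in> set Ms" and MN: "?M \<noteq> ?N" using that Ms(2) by (auto simp: nth_eq_iff_index_eq)
    have sum: "ideal (P ?M <+> P ?N) R" using M JPi by (intro add_ideals) auto
    have "P ?M <+> P ?N = carrier R"
    proof (rule ccontr)
      assume "P ?M <+> P ?N \<noteq> carrier R"
      then obtain L where L: "maximalideal L R" "P ?M <+> P ?N \<subseteq> L" using maximal_ideal_ge[OF sum] by blast
      then have "P ?M \<subseteq> L" "P ?N \<subseteq> L"
        using add_ideal_mem1[OF JPi(2)[OF M(1)] JPi(2)[OF M(2)]] add_ideal_mem2[OF JPi(2)[OF M(1)] JPi(2)[OF M(2)]] by auto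
      then show False using JP[OF M(1)] JP[OF M(2)] L(1) MN by metis
    qed
    then show ?thesis using that by (simp add: comaximal_def)
  qed
  show "\<exists>J Ps. invertible_ideal R J \<and> Ps \<noteq> [] \<and> (\<forall>P\<in>set Ps. primeideal P R) \<and>
      (\<forall>i<length Ps. \<forall>j<length Ps. i \<noteq> j \<longrightarrow> comaximal R (Ps ! i) (Ps ! j)) \<and> I = J \<cdot> ideal_list_prod R Ps"
    using inv ne JP com eq by (intro exI[of _ "ideal_list_prod R (map J Ms)"] exI[of _ "map P Ms"]) auto
qed

end

theorem corollary10:
  fixes A :: "('a, 'm) ring_scheme" (structure)
  assumes "domain A"
  shows "(ZPUI_domain A \<longleftrightarrow> h_local_domain A \<and> strongly_discrete_pruefer_domain A) \<and>
    (h_local_domain A \<and> strongly_discrete_pruefer_domain A \<longleftrightarrow> h_local_domain A \<and> ISP_domain A) \<and>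
    (h_local_domain A \<and> ISP_domain A \<longleftrightarrow> generalized_dedekind_domain A \<and> ISP_domain A) \<and>
    (generalized_dedekind_domain A \<and> ISP_domain A \<longleftrightarrow>
      ISP_domain A \<and> (\<forall>I. ideal I A \<longrightarrow> finite (minimal_primes A I)))"
proof -
  have ac: "h_local_domain A \<and> ISP_domain A" if "ZPUI_domain A"
    using ZPUI_domain.ZPUI_h_local[OF that] ZPUI_domain.ZPUI_ISP[OF that] by blast
  have cb: "strongly_discrete_pruefer_domain A" if "ISP_domain A"
    using that by (rule ISP_domain.ISP_strongly_discrete_pruefer)
  have ba: "ZPUI_domain A" if "h_local_domain A" "strongly_discrete_pruefer_domain A"
    using that(2,1) by (rule strongly_discrete_pruefer_domain.ZPUI_of_h_local)
  have cd: "generalized_dedekind_domain A" if "h_local_domain A" "ISP_domain A"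
    using that(2,1) by (rule ISP_domain.generalized_dedekind_of_h_local)
  have de: "\<forall>I. ideal I A \<longrightarrow> finite (minimal_primes A I)" if "generalized_dedekind_domain A"
    using generalized_dedekind_domain.finite_minimal_primes_of_ideal[OF that] by blast
  have ec: "h_local_domain A" if "ISP_domain A" "\<forall>I. ideal I A \<longrightarrow> finite (minimal_primes A I)"
    using ISP_domain.h_local_of_finite_minimal_primes[OF that(1)] that(2) by blast
  \<comment> \<open>The implications form two cycles through (c): (c), (b), (a), (c) and (c), (d),
    (e), (c).\<close>
  show ?thesis using ac cb ba cd de ec by blast
qed

end
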